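(* Let $S$ be a set of $n$ distinct points $\beta_1,\dots,\beta_n$ in the complex plane $\mathbb{C}$ symmetric with respect to the real line, i.e. $S=\{\beta_1,\dots,\beta_n\}=\{\overline{\beta_1},\dots,\overline{\beta_n}\}$. Then, for each sufficiently small positive number $\varepsilon$, there exists a constant $C=C(\varepsilon,S)>0$ such that the number of integer polynomials $f$ of degree $n$ and height at most $H$ with Galois group $S_n$ and $n$ roots lying in $\varepsilon$-neighbourhoods of $\beta_1,\dots,\beta_n$ respectively (and, in addition, such that the root of each such $f$ lying in the open disc $|z-\beta_i|<\varepsilon$ is real if and only if the number $\beta_i$ is real) is at least $CH^{n+1}$.
   Context: Here $n$ and $H$ are positive integers. An integer polynomial is an element of $\mathbb{Z}[X]$. The height of a polynomial $f(X)=a_0X^n+a_1X^{n-1}+\cdots+a_n$ is $\max_{0\le j\le n}|a_j|$. The Galois group of $f\in\mathbb{Z}[X]$ is the Galois group of the splitting field of $f$ over $\mathbb{Q}$, and $S_n$ is the full symmetric group on $n$ symbols (not to be confused with the set $S$).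
   Formalization: The lower bound CH^{n+1} is proved for all H at least some H_0 depending on ε and S, not for every positive integer H; for every H it is false, e.g. n=1, S={1000.5}, small ε, H=1, where no such polynomial exists. *)

theory Defs
  imports
    "HOL-Analysis.Analysis"
    "HOL-Computational_Algebra.Polynomial"
    "HOL-Algebra.Algebra"
    "HOL-Algebra.Algebraic_Closure_Type"
begin

definition poly_height :: "int poly \<Rightarrow> int" where
  "poly_height f = Max ((\<lambda>j. \<bar>Polynomial.coeff f j\<bar>) ` {0..Polynomial.degree f})"

definition complex_roots :: "int poly \<Rightarrow> complex set" where
  "complex_roots f = {z. poly (map_poly of_int f) z = 0}"

abbreviation complex_ring :: "complex ring" where
  "complex_ring \<equiv> ring_of_type_algebra"

text \<open>The splitting field over the rationals is taken inside the complex numbers.\<close>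

definition splitting_field :: "int poly \<Rightarrow> complex set" where
  "splitting_field f = generate_field complex_ring (\<rat> \<union> complex_roots f)"

text \<open>Elements of \<^const>\<open>Bij\<close> \<open>L\<close> are extensional, so each automorphism of \<open>L\<close> is
  represented by exactly one function.\<close>

definition galois_group :: "('a, 'b) ring_scheme \<Rightarrow> 'a set \<Rightarrow> 'a set \<Rightarrow> ('a \<Rightarrow> 'a) monoid" where
  "galois_group R L K = BijGroup L
     \<lparr>carrier := {\<sigma> \<in> Bij L. \<sigma> \<in> ring_iso (R\<lparr>carrier := L\<rparr>) (R\<lparr>carrier := L\<rparr>) \<and>
                             (\<forall>x\<in>K. \<sigma> x = x)}\<rparr>"

definition poly_galois_group :: "int poly \<Rightarrow> (complex \<Rightarrow> complex) monoid" where
  "poly_galois_group f = galois_group complex_ring (splitting_field f) \<rat>"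

end

theory Submission
  imports Defs "HOL-Number_Theory.Number_Theory" "HOL-Combinatorics.Combinatorics"
    "HOL-Computational_Algebra.Computational_Algebra"
begin

hide_const (open) Polynomials.degree Polynomials.lead_coeff up_ring.coeff up_ring.monom
  module.smult Coset.order Divisibility.prime

text \<open>
  A congruence condition on the coefficients can force the Galois group to be \<open>S\<^sub>n\<close>, and it only costs a
  constant factor in the count. For a prime \<open>p\<close> and a prime ideal above \<open>p\<close> in the ring generated by the roots
  \<open>\<omega> i\<close> of a monic integer polynomial, some element of the Galois group satisfies \<open>\<sigma> (\<omega> i) \<equiv> (\<omega> i)\<^sup>p\<close> for all \<open>i\<close>.
  Prescribing \<open>f\<close> as \<open>X\<^sup>n - g\<close>, \<open>X\<^sup>n - u X\<close> and \<open>(X\<^sup>2 - v) \<Prod>(X - c)\<close> modulo three primes therefore produces an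
  \<open>n\<close>-cycle, an \<open>(n - 1)\<close>-cycle and a transposition, which generate \<open>S\<^sub>n\<close>. On the other hand, if the coefficient
  vector of \<open>f\<close> is within \<open>\<delta> T\<close> of that of \<open>T \<Prod>(X - \<beta>\<^sub>i)\<close> then \<open>\<bar>f(\<beta>\<^sub>i)\<bar>\<close> is small compared with the leading
  coefficient, so some root is close to each \<open>\<beta>\<^sub>i\<close>. With \<open>T\<close> proportional to \<open>H\<close>, a box of side proportional to \<open>H\<close>
  contains at least \<open>C H\<^bsup>n+1\<^esup>\<close> integer points in the prescribed residue class.
\<close>

text \<open>The difficulty is to know Frobenius elements as permutations without building finite
  fields. Each prime p is taken congruent to 1 modulo the cycle length d that is wanted: if x^d = g
  modulo the prime ideal, then x^p = x * (x^d)^((p-1)/d) = g^((p-1)/d) * x, so Frobenius multiplies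
  these roots by an integer and its iterates are told apart by integer congruences. The existence of
  the permutation itself is also obtained without residue fields, from one polynomial over a
  polynomial ring whose roots are indexed by the Galois group. Only three facts survive into group
  theory: transitivity, transitivity of a point stabiliser on the other points, and one
  transposition, which double transitivity conjugates into all others. The modulus is a product of
  three primes chosen from n alone, so neither the points nor \<epsilon> influence it. The case n =
  1 is separate, since no transposition exists there. The number rings and fields are subsets of the
  complex numbers, which makes towers, embeddings and ideals directly comparable.\<close>

section \<open>Subrings, polynomials over them, and adjunction of elements\<close>

definition is_subring :: "'a::comm_ring_1 set \<Rightarrow> bool" where
  "is_subring R \<longleftrightarrow> 1 \<in> R \<and> (\<forall>x\<in>R. \<forall>y\<in>R. x - y \<in> R \<and> x * y \<in> R)"

definition polys_over :: "'a::comm_ring_1 set \<Rightarrow> 'a poly set" where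
  "polys_over R = {f. \<forall>i. coeff f i \<in> R}"

definition adjoin :: "'a::comm_ring_1 set \<Rightarrow> 'a \<Rightarrow> 'a set" where
  "adjoin R x = (\<lambda>f. poly f x) ` polys_over R"

text \<open>Adjoining one element at a time turns every statement on several generators into an
  induction over simple extensions, with the base changing at each step.\<close>

fun adjoin_list :: "'a::comm_ring_1 set \<Rightarrow> 'a list \<Rightarrow> 'a set" where
  "adjoin_list R [] = R"
| "adjoin_list R (x # xs) = adjoin_list (adjoin R x) xs"

lemma
  assumes "is_subring R"
  shows subring_one: "1 \<in> R"
    and subring_diff: "\<And>x y. x \<in> R \<Longrightarrow> y \<in> R \<Longrightarrow> x - y \<in> R"
    and subring_mult: "\<And>x y. x \<in> R \<Longrightarrow> y \<in> R \<Longrightarrow> x * y \<in> R"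
  using assms by (auto simp: is_subring_def)

lemma subring_zero: "is_subring R \<Longrightarrow> 0 \<in> R"
  using subring_diff[of R 1 1] subring_one by fastforce

lemma subring_uminus: "is_subring R \<Longrightarrow> x \<in> R \<Longrightarrow> - x \<in> R"
  using subring_diff[of R 0 x] subring_zero by fastforce

lemma subring_add: "is_subring R \<Longrightarrow> x \<in> R \<Longrightarrow> y \<in> R \<Longrightarrow> x + y \<in> R"
  using subring_diff[of R x "- y"] subring_uminus by fastforce

lemma subring_power: "is_subring R \<Longrightarrow> x \<in> R \<Longrightarrow> x ^ k \<in> R"
  by (induction k) (auto intro: subring_one subring_mult)

lemma subring_sum: "is_subring R \<Longrightarrow> (\<And>i. i \<in> I \<Longrightarrow> f i \<in> R) \<Longrightarrow> sum f I \<in> R"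
  by (induction I rule: infinite_finite_induct) (auto intro: subring_zero subring_add)

lemma subring_prod: "is_subring R \<Longrightarrow> (\<And>i. i \<in> I \<Longrightarrow> f i \<in> R) \<Longrightarrow> prod f I \<in> R"
  by (induction I rule: infinite_finite_induct) (auto intro: subring_one subring_mult)

lemma subring_of_nat: "is_subring R \<Longrightarrow> of_nat k \<in> R"
  by (induction k) (auto intro: subring_zero subring_one subring_add)

lemma subring_of_int: "is_subring R \<Longrightarrow> of_int k \<in> R"
  by (cases k rule: int_cases2) (auto intro: subring_of_nat subring_uminus)

lemmas subring_intros = subring_zero subring_one subring_uminus subring_add subring_diff
  subring_mult subring_power subring_sum subring_prod subring_of_nat subring_of_int

lemma polys_over_coeff: "f \<in> polys_over R \<Longrightarrow> coeff f i \<in> R"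
  by (simp add: polys_over_def)

lemma is_subring_polys_over: "is_subring R \<Longrightarrow> is_subring (polys_over R)"
  unfolding is_subring_def[of "polys_over R"]
  by (auto simp: polys_over_def coeff_mult coeff_1 intro!: subring_intros)

lemma polys_over_pCons_iff: "pCons a f \<in> polys_over R \<longleftrightarrow> a \<in> R \<and> f \<in> polys_over R"
  unfolding polys_over_def
  by (auto simp: coeff_pCons split: nat.splits)

lemma polys_over_0: "0 \<in> R \<Longrightarrow> 0 \<in> polys_over R"
  by (simp add: polys_over_def)

lemma polys_over_smult: "is_subring R \<Longrightarrow> a \<in> R \<Longrightarrow> f \<in> polys_over R \<Longrightarrow> smult a f \<in> polys_over R"
  by (auto simp: polys_over_def subring_intros)

lemma polys_over_monom: "is_subring R \<Longrightarrow> a \<in> R \<Longrightarrow> monom a k \<in> polys_over R"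
  by (auto simp: polys_over_def subring_intros)

lemma polys_over_pderiv: "is_subring R \<Longrightarrow> f \<in> polys_over R \<Longrightarrow> pderiv f \<in> polys_over R"
  by (auto simp: polys_over_def coeff_pderiv simp del: of_nat_Suc intro!: subring_intros)

lemma subring_poly: "is_subring R \<Longrightarrow> f \<in> polys_over R \<Longrightarrow> x \<in> R \<Longrightarrow> poly f x \<in> R"
  by (auto simp: poly_altdef polys_over_coeff intro!: subring_intros)

lemma is_subring_adjoin:
  assumes "is_subring R"
  shows "is_subring (adjoin R x)"
  unfolding is_subring_def[of "adjoin R x"]
proof (intro conjI ballI)
  note P = is_subring_polys_over[OF assms]
  show "1 \<in> adjoin R x"
    unfolding adjoin_def by (rule image_eqI[of _ _ 1]) (auto intro: subring_one P)
  fix y z assume "y \<in> adjoin R x" "z \<in> adjoin R x"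
  then obtain f g where *: "f \<in> polys_over R" "g \<in> polys_over R" "y = poly f x" "z = poly g x"
    by (auto simp: adjoin_def)
  show "y - z \<in> adjoin R x"
    unfolding adjoin_def by (rule image_eqI[of _ _ "f - g"]) (use * in \<open>auto intro: subring_diff P\<close>)
  show "y * z \<in> adjoin R x"
    unfolding adjoin_def by (rule image_eqI[of _ _ "f * g"]) (use * in \<open>auto intro: subring_mult P\<close>)
qed

lemma subset_adjoin: "is_subring R \<Longrightarrow> R \<subseteq> adjoin R x"
proof
  fix a assume "is_subring R" "a \<in> R"
  then show "a \<in> adjoin R x"
    unfolding adjoin_def
    by (intro image_eqI[of _ _ "[:a:]"]) (auto simp: polys_over_pCons_iff polys_over_0 subring_zero)
qed

lemma mem_adjoin: "is_subring R \<Longrightarrow> x \<in> adjoin R x"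
  unfolding adjoin_def
  by (intro image_eqI[of _ _ "[:0, 1:]"])
     (auto simp: polys_over_pCons_iff polys_over_0 subring_zero subring_one)

lemma is_subring_adjoin_list: "is_subring R \<Longrightarrow> is_subring (adjoin_list R xs)"
  by (induction xs arbitrary: R) (auto intro: is_subring_adjoin)

lemma subset_adjoin_list: "is_subring R \<Longrightarrow> R \<subseteq> adjoin_list R xs"
proof (induction xs arbitrary: R)
  case (Cons x xs)
  then show ?case
    using subset_adjoin[of R x] is_subring_adjoin[of R x] by fastforce
qed auto

lemma mem_adjoin_list: "is_subring R \<Longrightarrow> x \<in> set xs \<Longrightarrow> x \<in> adjoin_list R xs"
proof (induction xs arbitrary: R)
  case (Cons y xs)
  then show ?case
    using subset_adjoin_list[OF is_subring_adjoin[OF Cons.prems(1), of y], of xs]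
      mem_adjoin[OF Cons.prems(1), of y] is_subring_adjoin[OF Cons.prems(1), of y]
    by auto
qed auto

lemma adjoin_list_least:
  assumes "is_subring S" "R \<subseteq> S" "set xs \<subseteq> S"
  shows "adjoin_list R xs \<subseteq> S"
  using assms(2,3)
proof (induction xs arbitrary: R)
  case (Cons x xs)
  have "poly f x \<in> S" if "f \<in> polys_over R" for f
    using that Cons.prems assms(1)
    by (intro subring_poly) (auto simp: polys_over_def)
  then have "adjoin R x \<subseteq> S" by (auto simp: adjoin_def)
  with Cons show ?case by auto
qed auto

subsection \<open>Extension of embeddings and fixed fields\<close>

definition is_subfield :: "'a::field set \<Rightarrow> bool" where
  "is_subfield K \<longleftrightarrow> is_subring K \<and> (\<forall>x\<in>K. inverse x \<in> K)"

lemma is_subfieldD: "is_subfield K \<Longrightarrow> is_subring K"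
  by (simp add: is_subfield_def)

lemma subfield_divide: "is_subfield K \<Longrightarrow> x \<in> K \<Longrightarrow> y \<in> K \<Longrightarrow> x / y \<in> K"
  by (simp add: is_subfield_def divide_inverse subring_mult)

text \<open>The hypothesis on division by the leading coefficient covers two uses: any divisor over
  a subfield, and a monic divisor over a mere subring, as needed for integral elements. The
  induction follows the long-division recursion on \<open>pCons\<close>.\<close>

lemma polys_over_div_mod:
  fixes f m :: "'a::field poly"
  assumes R: "is_subring R" and lc: "\<And>x. x \<in> R \<Longrightarrow> x / lead_coeff m \<in> R"
    and f: "f \<in> polys_over R" and m: "m \<in> polys_over R"
  shows "f div m \<in> polys_over R \<and> f mod m \<in> polys_over R"
  using f
proof (induction f)
  case 0
  then show ?case by simp
next
  case (pCons a f)
  show ?case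
  proof (cases "m = 0")
    case True
    then show ?thesis using pCons.prems R polys_over_0 subring_zero by auto
  next
    case False
    let ?b = "coeff (pCons a (f mod m)) (degree m) / lead_coeff m"
    have *: "a \<in> R" "f div m \<in> polys_over R" "f mod m \<in> polys_over R"
      using pCons by (auto simp: polys_over_pCons_iff)
    have b: "?b \<in> R"
      using * by (intro lc polys_over_coeff[of _ R]) (auto simp: polys_over_pCons_iff)
    have "pCons a f mod m = pCons a (f mod m) - smult ?b m" using False by (simp add: mod_pCons_eq)
    moreover have "pCons a f div m = pCons ?b (f div m)"
      using False by (simp add: div_pCons_eq)
    ultimately show ?thesis
      using * b m R is_subring_polys_over[OF R]
      by (auto simp: polys_over_pCons_iff intro!: polys_over_smult subring_diff)
  qed
qed

lemma polys_over_div_mod_field: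
  assumes "is_subfield K" "f \<in> polys_over K" "m \<in> polys_over K"
  shows "f div m \<in> polys_over K \<and> f mod m \<in> polys_over K"
  using assms
  by (intro polys_over_div_mod) (auto simp: is_subfieldD intro!: subfield_divide polys_over_coeff)

section \<open>Minimal polynomials and inverses in simple algebraic extensions\<close>

definition is_min_poly :: "'a::field set \<Rightarrow> 'a \<Rightarrow> 'a poly \<Rightarrow> bool" where
  "is_min_poly K x m \<longleftrightarrow> m \<in> polys_over K \<and> m \<noteq> 0 \<and> poly m x = 0 \<and>
     (\<forall>g\<in>polys_over K. g \<noteq> 0 \<longrightarrow> poly g x = 0 \<longrightarrow> degree m \<le> degree g)"

definition algebraic_over :: "'a::field set \<Rightarrow> 'a \<Rightarrow> bool" where
  "algebraic_over K x \<longleftrightarrow> (\<exists>g\<in>polys_over K. g \<noteq> 0 \<and> poly g x = 0)"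

lemma algebraic_over_mono: "algebraic_over K x \<Longrightarrow> K \<subseteq> K' \<Longrightarrow> algebraic_over K' x"
  unfolding algebraic_over_def polys_over_def by blast

lemma exists_min_poly:
  assumes "algebraic_over K x"
  shows "\<exists>m. is_min_poly K x m"
proof -
  let ?P = "\<lambda>g. g \<in> polys_over K \<and> g \<noteq> 0 \<and> poly g x = 0"
  from assms obtain g where "?P g" by (auto simp: algebraic_over_def)
  from ex_has_least_nat[of ?P g degree, OF this] show ?thesis
    unfolding is_min_poly_def by blast
qed

lemma min_poly_dvd:
  assumes K: "is_subfield K" and m: "is_min_poly K x m" and g: "g \<in> polys_over K" "poly g x = 0"
  shows "\<exists>q\<in>polys_over K. g = q * m"
proof -
  have D: "g div m \<in> polys_over K" "g mod m \<in> polys_over K"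
    using polys_over_div_mod_field[OF K g(1), of m] m by (auto simp: is_min_poly_def)
  have "poly (g div m * m + g mod m) x = 0" using g(2) by simp
  then have "poly (g mod m) x = 0"
    using m by (simp only: poly_add poly_mult) (simp add: is_min_poly_def)
  then have "g mod m = 0"
    using m D(2) degree_mod_less[of m g] by (force simp: is_min_poly_def)
  then show ?thesis using D(1) by (metis add.right_neutral div_mult_mod_eq)
qed

text \<open>Euclidean descent on the degree of \<open>g\<close>. Reduction modulo \<open>m\<close>
  keeps the value at \<open>x\<close>. Below the degree of \<open>m\<close>, the value of
  \<open>m mod g\<close> is minus that of \<open>m div g\<close> times that of \<open>g\<close>, so
  an inverse for this smaller remainder yields one for \<open>g\<close>.\<close>

lemma adjoin_inverse:
  assumes K: "is_subfield K" and m: "is_min_poly K x m" and g: "g \<in> polys_over K" "poly g x \<noteq> 0"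
  shows "\<exists>u\<in>polys_over K. poly u x * poly g x = 1"
  using g
proof (induction "degree g" arbitrary: g rule: less_induct)
  case less
  note R = is_subfieldD[OF K]
  note P = is_subring_polys_over[OF R]
  have mK: "m \<in> polys_over K" "m \<noteq> 0" "poly m x = 0" using m by (auto simp: is_min_poly_def)
  have m0: "degree m > 0"
  proof (rule ccontr)
    assume "\<not> degree m > 0"
    then obtain c where "m = [:c:]" by (auto elim: degree_eq_zeroE)
    with mK show False by auto
  qed
  consider "degree g = 0" | "degree g > 0" "degree m \<le> degree g" | "degree g > 0" "degree g < degree m"
    by linarith
  then show ?case
  proof cases
    case 1
    then obtain c where c: "g = [:c:]" by (auto elim: degree_eq_zeroE)
    then have "c \<in> K" "c \<noteq> 0" using less.prems by (auto simp: polys_over_pCons_iff)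
    with c K show ?thesis
      by (intro bexI[of _ "[:inverse c:]"])
         (auto simp: polys_over_pCons_iff is_subfield_def polys_over_0 subring_zero)
  next
    case 2
    have r: "g mod m \<in> polys_over K" using polys_over_div_mod_field K less.prems mK by blast
    have e: "poly (g mod m) x = poly g x"
      using mK by (metis add_0 div_mult_mod_eq mult_zero_right poly_add poly_mult)
    have "g mod m = 0 \<or> degree (g mod m) < degree m" using degree_mod_less mK by blast
    then have "degree (g mod m) < degree g" using 2 by auto
    from less.hyps[OF this r] e less.prems show ?thesis by auto
  next
    case 3
    have g0: "g \<noteq> 0" using 3 by auto
    have D: "m div g \<in> polys_over K" "m mod g \<in> polys_over K"
      using polys_over_div_mod_field[OF K mK(1) less.prems(1)] by auto
    have eq: "poly (m div g) x * poly g x + poly (m mod g) x = 0"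
      using mK by (metis div_mult_mod_eq poly_add poly_mult)
    have r: "m mod g = 0 \<or> degree (m mod g) < degree g" using degree_mod_less[OF g0] by blast
    \<comment> \<open>If the remainder vanished at \<open>x\<close>, minimality would make it the
      zero polynomial; then \<open>g\<close> divides \<open>m\<close> and the quotient is an
      annihilator of \<open>x\<close> of smaller degree.\<close>
    have r0: "poly (m mod g) x \<noteq> 0"
    proof
      assume z: "poly (m mod g) x = 0"
      have "m mod g = 0" using z r D(2) m 3 by (force simp: is_min_poly_def)
      then have mm: "m = (m div g) * g" by (metis add.right_neutral div_mult_mod_eq)
      have "poly (m div g) x = 0" using eq z less.prems by simp
      moreover have dg: "m div g \<noteq> 0" using mm mK by auto
      ultimately have "degree m \<le> degree (m div g)" using D(1) m by (auto simp: is_min_poly_def)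
      moreover have "degree m = degree (m div g) + degree g"
        using mm dg g0 by (metis degree_mult_eq)
      ultimately show False using 3 by simp
    qed
    then have "degree (m mod g) < degree g" using r by auto
    from less.hyps[OF this D(2) r0] obtain u where u: "u \<in> polys_over K" "poly u x * poly (m mod g) x = 1"
      by auto
    have "poly (m mod g) x = - (poly (m div g) x * poly g x)" using eq by (simp add: eq_neg_iff_add_eq_0 add.commute)
    then have "poly (- (u * (m div g))) x * poly g x = 1" using u(2) by (simp add: algebra_simps)
    then show ?thesis
      using u(1) D(1) P by (intro bexI[of _ "- (u * (m div g))"]) (auto intro: subring_intros)
  qed
qed

lemma is_subfield_adjoin:
  assumes "is_subfield K" "algebraic_over K x"
  shows "is_subfield (adjoin K x)"
  unfolding is_subfield_def[of "adjoin K x"]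
proof (intro conjI ballI)
  show R: "is_subring (adjoin K x)" using assms is_subfieldD is_subring_adjoin by blast
  fix y assume y: "y \<in> adjoin K x"
  obtain m where m: "is_min_poly K x m" using exists_min_poly assms by blast
  obtain g where g: "g \<in> polys_over K" "y = poly g x" using y by (auto simp: adjoin_def)
  show "inverse y \<in> adjoin K x"
  proof (cases "y = 0")
    case True
    then show ?thesis using subring_zero[OF R] by simp
  next
    case False
    then obtain u where "u \<in> polys_over K" "poly u x * y = 1"
      using adjoin_inverse[OF assms(1) m g(1)] g by auto
    then show ?thesis by (metis adjoin_def image_eqI inverse_unique mult.commute)
  qed
qed

section \<open>Homomorphisms on subrings, their extension, and fixed fields\<close>

text \<open>A total function represents a homomorphism on the subset \<open>R\<close>. For a subring
  its values elsewhere are arbitrary, so extensions and equality of homomorphisms are stated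
  pointwise on the carrier.\<close>

definition hom_on :: "'a::comm_ring_1 set \<Rightarrow> ('a \<Rightarrow> 'b::comm_ring_1) \<Rightarrow> bool" where
  "hom_on R \<sigma> \<longleftrightarrow> \<sigma> 1 = 1 \<and> (\<forall>x\<in>R. \<forall>y\<in>R. \<sigma> (x + y) = \<sigma> x + \<sigma> y \<and> \<sigma> (x * y) = \<sigma> x * \<sigma> y)"

lemma hom_on_zero: "is_subring R \<Longrightarrow> hom_on R \<sigma> \<Longrightarrow> \<sigma> 0 = 0"
  using subring_zero[of R] unfolding hom_on_def by (metis add_cancel_right_right add_0)

lemma hom_on_uminus:
  assumes "is_subring R" "hom_on R \<sigma>" "x \<in> R"
  shows "\<sigma> (- x) = - \<sigma> x"
proof -
  have "\<sigma> (x + - x) = \<sigma> x + \<sigma> (- x)"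
    using assms subring_uminus unfolding hom_on_def by blast
  then show ?thesis using hom_on_zero[OF assms(1,2)] by (simp add: eq_neg_iff_add_eq_0 add.commute)
qed

lemma hom_on_sum:
  assumes "is_subring R" "hom_on R \<sigma>" "\<And>i. i \<in> I \<Longrightarrow> f i \<in> R"
  shows "\<sigma> (sum f I) = (\<Sum>i\<in>I. \<sigma> (f i))"
  using assms(3)
proof (induction I rule: infinite_finite_induct)
  case (insert i I)
  have "\<sigma> (f i + sum f I) = \<sigma> (f i) + \<sigma> (sum f I)"
    using assms(1,2) insert.prems subring_sum[OF assms(1), of I f] unfolding hom_on_def by blast
  with insert show ?case by simp
qed (auto simp: hom_on_zero[OF assms(1,2)])

lemma hom_on_power:
  assumes "is_subring R" "hom_on R \<sigma>" "x \<in> R"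
  shows "\<sigma> (x ^ k) = \<sigma> x ^ k"
proof (induction k)
  case (Suc k)
  have "\<sigma> (x * x ^ k) = \<sigma> x * \<sigma> (x ^ k)"
    using assms subring_power[OF assms(1,3)] unfolding hom_on_def by blast
  with Suc show ?case by simp
qed (use assms in \<open>auto simp: hom_on_def\<close>)

lemma hom_on_poly:
  assumes "is_subring R" "hom_on R \<sigma>" "f \<in> polys_over R" "x \<in> R"
  shows "\<sigma> (poly f x) = poly (map_poly \<sigma> f) (\<sigma> x)"
proof -
  have s: "\<sigma> 0 = 0" using hom_on_zero assms by blast
  have "\<sigma> (poly f x) = (\<Sum>i\<le>degree f. \<sigma> (coeff f i * x ^ i))"
    unfolding poly_altdef using assms
    by (intro hom_on_sum) (auto intro: subring_intros polys_over_coeff)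
  also have "\<dots> = (\<Sum>i\<le>degree f. \<sigma> (coeff f i) * \<sigma> x ^ i)"
  proof (rule sum.cong[OF refl])
    fix i
    have "\<sigma> (coeff f i * x ^ i) = \<sigma> (coeff f i) * \<sigma> (x ^ i)"
      using assms polys_over_coeff[OF assms(3)] subring_power[OF assms(1,4)]
      unfolding hom_on_def by blast
    then show "\<sigma> (coeff f i * x ^ i) = \<sigma> (coeff f i) * \<sigma> x ^ i"
      using hom_on_power[OF assms(1,2,4)] by simp
  qed
  also have "\<dots> = poly (map_poly \<sigma> f) (\<sigma> x)"
  proof -
    have "degree (map_poly \<sigma> f) \<le> degree f"
      by (rule degree_le) (auto simp: coeff_map_poly s coeff_eq_0)
    then have "poly (map_poly \<sigma> f) (\<sigma> x) = (\<Sum>i\<le>degree f. coeff (map_poly \<sigma> f) i * \<sigma> x ^ i)"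
      unfolding poly_altdef by (intro sum.mono_neutral_left) (auto intro: le_degree)
    then show ?thesis by (simp add: coeff_map_poly s)
  qed
  finally show ?thesis .
qed

lemma map_poly_hom_add:
  assumes "is_subring R" "hom_on R \<sigma>" "f \<in> polys_over R" "g \<in> polys_over R"
  shows "map_poly \<sigma> (f + g) = map_poly \<sigma> f + map_poly \<sigma> g"
  using assms hom_on_zero[OF assms(1,2)]
  by (intro poly_eqI) (auto simp: coeff_map_poly polys_over_def hom_on_def)

lemma map_poly_hom_mult:
  assumes "is_subring R" "hom_on R \<sigma>" "f \<in> polys_over R" "g \<in> polys_over R"
  shows "map_poly \<sigma> (f * g) = map_poly \<sigma> f * map_poly \<sigma> g"
proof (rule poly_eqI)
  fix k
  have "\<sigma> (\<Sum>i\<le>k. coeff f i * coeff g (k - i)) = (\<Sum>i\<le>k. \<sigma> (coeff f i * coeff g (k - i)))"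
    using assms by (intro hom_on_sum) (auto intro: subring_intros polys_over_coeff)
  also have "\<dots> = (\<Sum>i\<le>k. \<sigma> (coeff f i) * \<sigma> (coeff g (k - i)))"
    using assms by (intro sum.cong) (auto simp: hom_on_def polys_over_def)
  finally show "coeff (map_poly \<sigma> (f * g)) k = coeff (map_poly \<sigma> f * map_poly \<sigma> g) k"
    using hom_on_zero[OF assms(1,2)] by (simp add: coeff_map_poly coeff_mult)
qed

lemma hom_on_nonzero:
  fixes \<sigma> :: "'a::field \<Rightarrow> 'b::field"
  assumes "is_subfield K" "hom_on K \<sigma>" "x \<in> K" "x \<noteq> 0"
  shows "\<sigma> x \<noteq> 0"
proof
  assume "\<sigma> x = 0"
  have "\<sigma> (x * inverse x) = \<sigma> x * \<sigma> (inverse x)"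
    using assms unfolding hom_on_def is_subfield_def by blast
  with assms \<open>\<sigma> x = 0\<close> show False by (auto simp: hom_on_def)
qed

lemma hom_on_diff:
  assumes "is_subring R" "hom_on R \<sigma>" "x \<in> R" "y \<in> R"
  shows "\<sigma> (x - y) = \<sigma> x - \<sigma> y"
proof -
  have "\<sigma> (x + - y) = \<sigma> x + \<sigma> (- y)"
    using assms subring_uminus unfolding hom_on_def by blast
  then show ?thesis using hom_on_uminus[OF assms(1,2,4)] by simp
qed

lemma hom_on_inj:
  fixes \<sigma> :: "'a::field \<Rightarrow> 'b::field"
  assumes "is_subfield K" "hom_on K \<sigma>"
  shows "inj_on \<sigma> K"
proof (rule inj_onI)
  fix x y assume *: "x \<in> K" "y \<in> K" "\<sigma> x = \<sigma> y"
  have R: "is_subring K" using assms is_subfieldD by blast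
  have "\<sigma> (x - y) = 0" using hom_on_diff[OF R assms(2)] * by simp
  then show "x = y" using hom_on_nonzero[OF assms, of "x - y"] * subring_diff[OF R] by auto
qed

text \<open>The extension sends \<open>poly f x\<close> to the value of the transported polynomial
  at \<open>\<rho>\<close>. This does not depend on \<open>f\<close>: two representatives differ by
  a multiple of \<open>m\<close>, and \<open>\<rho>\<close> is a root of the transported
  \<open>m\<close>.\<close>

lemma hom_on_extend:
  fixes \<sigma> :: "'a::field \<Rightarrow> 'b::field"
  assumes K: "is_subfield K" and \<sigma>: "hom_on K \<sigma>" and m: "is_min_poly K x m"
    and \<rho>: "poly (map_poly \<sigma> m) \<rho> = 0"
  shows "\<exists>\<tau>. hom_on (adjoin K x) \<tau> \<and> (\<forall>y\<in>K. \<tau> y = \<sigma> y) \<and> \<tau> x = \<rho>"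
proof -
  note R = is_subfieldD[OF K]
  note P = is_subring_polys_over[OF R]
  define \<tau> where "\<tau> y = poly (map_poly \<sigma> (SOME g. g \<in> polys_over K \<and> poly g x = y)) \<rho>" for y
  have wd: "poly (map_poly \<sigma> f) \<rho> = poly (map_poly \<sigma> g) \<rho>"
    if fg: "f \<in> polys_over K" "g \<in> polys_over K" "poly f x = poly g x" for f g
  proof -
    have "f - g \<in> polys_over K" using fg P subring_diff by blast
    then obtain q where q: "q \<in> polys_over K" "f - g = q * m"
      using min_poly_dvd[OF K m, of "f - g"] fg(3) by (metis eq_iff_diff_eq_0 poly_diff)
    have mK: "m \<in> polys_over K" using m by (auto simp: is_min_poly_def)
    have "f = q * m + g" using q by (simp add: algebra_simps)
    then have "map_poly \<sigma> f = map_poly \<sigma> (q * m) + map_poly \<sigma> g"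
      using map_poly_hom_add[OF R \<sigma>] q(1) mK fg P subring_mult by blast
    also have "map_poly \<sigma> (q * m) = map_poly \<sigma> q * map_poly \<sigma> m"
      using map_poly_hom_mult[OF R \<sigma>] q(1) mK by blast
    finally show ?thesis using \<rho> by simp
  qed
  have \<tau>: "\<tau> (poly f x) = poly (map_poly \<sigma> f) \<rho>" if "f \<in> polys_over K" for f
  proof -
    let ?g = "SOME g. g \<in> polys_over K \<and> poly g x = poly f x"
    have "?g \<in> polys_over K \<and> poly ?g x = poly f x" by (rule someI[of _ f]) (use that in auto)
    then show ?thesis unfolding \<tau>_def using wd that by blast
  qed
  have s: "\<sigma> 0 = 0" "\<sigma> 1 = 1" using hom_on_zero[OF R \<sigma>] \<sigma> by (auto simp: hom_on_def)
  have c: "\<tau> y = \<sigma> y" if "y \<in> K" for y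
    using \<tau>[of "[:y:]"] that R by (simp add: polys_over_pCons_iff polys_over_0 subring_zero map_poly_pCons s)
  have x: "\<tau> x = \<rho>"
    using \<tau>[of "[:0, 1:]"] R
    by (simp add: polys_over_pCons_iff polys_over_0 subring_zero subring_one map_poly_pCons s)
  have "\<tau> 1 = 1" using c[of 1] subring_one[OF R] s by simp
  moreover have "\<tau> (y + z) = \<tau> y + \<tau> z \<and> \<tau> (y * z) = \<tau> y * \<tau> z"
    if yz: "y \<in> adjoin K x" "z \<in> adjoin K x" for y z
  proof -
    obtain f g where fg: "f \<in> polys_over K" "g \<in> polys_over K" "y = poly f x" "z = poly g x"
      using yz by (auto simp: adjoin_def)
    show ?thesis
      using \<tau>[of "f + g"] \<tau>[of "f * g"] \<tau>[OF fg(1)] \<tau>[OF fg(2)] fg P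
      by (simp add: subring_add subring_mult map_poly_hom_add[OF R \<sigma>] map_poly_hom_mult[OF R \<sigma>])
  qed
  ultimately have "hom_on (adjoin K x) \<tau>" by (simp add: hom_on_def)
  with c x show ?thesis by blast
qed

lemma min_poly_degree_pos: "is_min_poly K x m \<Longrightarrow> degree m > 0"
  unfolding is_min_poly_def by (metis degree_eq_zeroE gr0I poly_const_conv pCons_0_0)

text \<open>Algebraic closedness of the target supplies, at each step of the tower, a root of the
  transported minimal polynomial.\<close>

lemma hom_on_extend_list:
  fixes \<sigma> :: "complex \<Rightarrow> complex"
  assumes "is_subfield K" "hom_on K \<sigma>" "\<And>x. x \<in> set xs \<Longrightarrow> algebraic_over K x"
  shows "\<exists>\<tau>. hom_on (adjoin_list K xs) \<tau> \<and> (\<forall>y\<in>K. \<tau> y = \<sigma> y)"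
  using assms
proof (induction xs arbitrary: K \<sigma>)
  case (Cons x xs)
  note R = is_subfieldD[OF Cons.prems(1)]
  obtain m where m: "is_min_poly K x m" using exists_min_poly Cons.prems(3)[of x] by auto
  have "\<sigma> (lead_coeff m) \<noteq> 0"
    using hom_on_nonzero[OF Cons.prems(1,2), of "lead_coeff m"] m
    by (auto simp: is_min_poly_def polys_over_def)
  then have "coeff (map_poly \<sigma> m) (degree m) \<noteq> 0"
    using hom_on_zero[OF R Cons.prems(2)] by (simp add: coeff_map_poly)
  then have "degree (map_poly \<sigma> m) > 0"
    using min_poly_degree_pos[OF m] le_degree by (metis less_le_trans)
  then obtain \<rho> where "poly (map_poly \<sigma> m) \<rho> = 0"
    by (metis constant_degree fundamental_theorem_of_algebra less_numeral_extra(3))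
  from hom_on_extend[OF Cons.prems(1,2) m this] obtain \<tau> where
    \<tau>: "hom_on (adjoin K x) \<tau>" "\<forall>y\<in>K. \<tau> y = \<sigma> y" by blast
  have "\<exists>\<tau>'. hom_on (adjoin_list (adjoin K x) xs) \<tau>' \<and> (\<forall>y\<in>adjoin K x. \<tau>' y = \<tau> y)"
    using \<tau>(1) Cons.prems is_subfield_adjoin[of K x] subset_adjoin[OF R, of x]
    by (intro Cons.IH) (auto intro: algebraic_over_mono[of K])
  then show ?case using \<tau>(2) subset_adjoin[OF R, of x] by (metis adjoin_list.simps(2) subsetD)
qed auto

lemma rsquarefree_card_roots:
  fixes f :: "complex poly"
  assumes "rsquarefree f"
  shows "card {z. poly f z = 0} = degree f"
proof -
  have f: "f \<noteq> 0" using assms by (auto simp: rsquarefree_def)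
  have "degree f = degree (\<Prod>z|poly f z = 0. [:-z, 1:])"
    using complex_poly_decompose_rsquarefree[OF assms] f by (metis degree_smult_eq leading_coeff_0_iff)
  also have "\<dots> = card {z. poly f z = 0}"
    by (subst degree_prod_eq_sum_degree) auto
  finally show ?thesis by simp
qed

text \<open>The derivative has smaller degree, so it does not vanish at \<open>x\<close> and has an
  inverse \<open>u\<close> there. Then \<open>u * pderiv m - 1\<close> is a multiple of
  \<open>m\<close>, a Bezout relation that excludes multiple roots.\<close>

lemma min_poly_separable:
  fixes m :: "complex poly"
  assumes K: "is_subfield K" and m: "is_min_poly K x m"
  shows "card {z. poly m z = 0} = degree m"
proof -
  note R = is_subfieldD[OF K]
  note P = is_subring_polys_over[OF R]
  have mK: "m \<in> polys_over K" "m \<noteq> 0" using m by (auto simp: is_min_poly_def)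
  have d: "pderiv m \<in> polys_over K" using polys_over_pderiv R mK by blast
  have "poly (pderiv m) x \<noteq> 0"
  proof
    assume "poly (pderiv m) x = 0"
    moreover have "pderiv m \<noteq> 0" using min_poly_degree_pos[OF m] by (simp add: pderiv_eq_0_iff)
    ultimately have "degree m \<le> degree (pderiv m)" using m d by (auto simp: is_min_poly_def)
    then show False using min_poly_degree_pos[OF m] by (simp add: degree_pderiv)
  qed
  then obtain u where u: "u \<in> polys_over K" "poly u x * poly (pderiv m) x = 1"
    using adjoin_inverse[OF K m d] by auto
  have "u * pderiv m - 1 \<in> polys_over K" using u d P by (auto intro: subring_intros)
  then obtain v where v: "u * pderiv m - 1 = v * m"
    using min_poly_dvd[OF K m, of "u * pderiv m - 1"] u by auto
  have "rsquarefree m"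
    unfolding rsquarefree_roots
  proof (intro allI notI)
    fix a assume a: "poly m a = 0 \<and> poly (pderiv m) a = 0"
    have "poly (u * pderiv m - 1) a = poly (v * m) a" using v by simp
    with a show False by simp
  qed
  then show ?thesis
    by (rule rsquarefree_card_roots)
qed

text \<open>By induction \<open>y\<close> already lies in the first simple extension, so
  \<open>y = poly g x\<close> with \<open>degree g < degree m\<close>. Every root \<rho> of
  \<open>m\<close> comes from an embedding over \<open>K\<close>, which fixes \<open>y\<close>;
  hence \<open>g - [:y:]\<close> vanishes at \<open>degree m\<close> distinct points and is zero, so
  \<open>y\<close> is a coefficient of \<open>g\<close>.\<close>

lemma fixed_field:
  fixes K :: "complex set"
  assumes "is_subfield K" "\<And>x. x \<in> set xs \<Longrightarrow> algebraic_over K x" "y \<in> adjoin_list K xs"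
    and "\<And>\<tau> :: complex \<Rightarrow> complex. hom_on (adjoin_list K xs) \<tau> \<Longrightarrow> (\<And>k. k \<in> K \<Longrightarrow> \<tau> k = k) \<Longrightarrow> \<tau> y = y"
  shows "y \<in> K"
  using assms
proof (induction xs arbitrary: K)
  case (Cons x xs)
  note K = Cons.prems(1)
  note R = is_subfieldD[OF K]
  let ?K' = "adjoin K x"
  have ax: "algebraic_over K x" using Cons.prems(2) by auto
  have alg: "algebraic_over ?K' z" if "z \<in> set xs" for z
    using Cons.prems(2)[of z] that subset_adjoin[OF R] by (auto intro: algebraic_over_mono)
  have K': "is_subfield ?K'" using is_subfield_adjoin[OF K ax] .
  have "y \<in> ?K'"
    using K' alg
  proof (rule Cons.IH)
    show "y \<in> adjoin_list ?K' xs" using Cons.prems by simp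
    show "\<tau> y = y" if "hom_on (adjoin_list ?K' xs) \<tau>" "\<And>k. k \<in> ?K' \<Longrightarrow> \<tau> k = k" for \<tau> :: "complex \<Rightarrow> complex"
      using Cons.prems(4)[of \<tau>] that subset_adjoin[OF R, of x] by auto
  qed
  obtain m where m: "is_min_poly K x m" using exists_min_poly ax by blast
  have mK: "m \<in> polys_over K" "m \<noteq> 0" "poly m x = 0" using m by (auto simp: is_min_poly_def)
  obtain g0 where g0: "g0 \<in> polys_over K" "y = poly g0 x" using \<open>y \<in> ?K'\<close> by (auto simp: adjoin_def)
  define g where "g = g0 mod m"
  have gK: "g \<in> polys_over K" unfolding g_def using polys_over_div_mod_field K g0 mK by blast
  have gy: "y = poly g x" unfolding g_def g0(2)
    using mK(3) by (metis add_0 div_mult_mod_eq mult_zero_right poly_add poly_mult)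
  have gd: "degree g < degree m"
    using degree_mod_less[OF mK(2), of g0] min_poly_degree_pos[OF m] by (auto simp: g_def)
  have "poly (g - [:y:]) \<rho> = 0" if \<rho>: "poly m \<rho> = 0" for \<rho>
  proof -
    have id: "hom_on K (\<lambda>z. z)" by (simp add: hom_on_def)
    have mp: "map_poly (\<lambda>z. z) f = f" for f :: "complex poly" by (rule poly_eqI) (simp add: coeff_map_poly)
    obtain \<tau> where \<tau>: "hom_on ?K' \<tau>" "\<forall>z\<in>K. \<tau> z = z" "\<tau> x = \<rho>"
      using hom_on_extend[OF K id m, of \<rho>] \<rho> by (auto simp: mp)
    obtain \<tau>' where \<tau>': "hom_on (adjoin_list ?K' xs) \<tau>'" "\<forall>z\<in>?K'. \<tau>' z = \<tau> z"
      using hom_on_extend_list[OF K' \<tau>(1) alg] by auto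
    have "\<tau>' y = y"
    proof (rule Cons.prems(4))
      show "\<tau>' k = k" if "k \<in> K" for k
        using \<tau>'(2) \<tau>(2) subset_adjoin[OF R, of x] that by auto
    qed (use \<tau>'(1) in simp)
    then have "y = \<tau> (poly g x)" using \<tau>'(2) \<open>y \<in> ?K'\<close> gy by metis
    also have "\<dots> = poly (map_poly \<tau> g) (\<tau> x)"
      using \<tau>(1) gK subset_adjoin[OF R, of x] mem_adjoin[OF R, of x]
      by (intro hom_on_poly[of ?K']) (auto simp: is_subring_adjoin[OF R] polys_over_def)
    also have "map_poly \<tau> g = g"
      using \<tau>(2) gK hom_on_zero[OF is_subring_adjoin[OF R] \<tau>(1)]
      by (intro poly_eqI) (auto simp: coeff_map_poly polys_over_def)
    finally show ?thesis using \<tau>(3) by simp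
  qed
  then have sub: "{z. poly m z = 0} \<subseteq> {z. poly (g - [:y:]) z = 0}" by auto
  have "g - [:y:] = 0"
  proof (rule ccontr)
    assume n: "g - [:y:] \<noteq> 0"
    have "degree m \<le> card {z. poly (g - [:y:]) z = 0}"
      using card_mono[OF poly_roots_finite[OF n] sub] min_poly_separable[OF K m] by simp
    also have "\<dots> \<le> degree (g - [:y:])" using card_poly_roots_bound[OF n] .
    also have "\<dots> < degree m"
      using degree_diff_less[OF gd, of "[:y:]"] min_poly_degree_pos[OF m] by simp
    finally show False by simp
  qed
  then have "g = [:y:]" by simp
  then show ?case using gK by (simp add: polys_over_pCons_iff)
qed auto

subsection \<open>Prime ideals\<close>

definition is_ideal :: "'a::comm_ring_1 set \<Rightarrow> 'a set \<Rightarrow> bool" where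
  "is_ideal R J \<longleftrightarrow> J \<subseteq> R \<and> 0 \<in> J \<and> (\<forall>x\<in>J. \<forall>y\<in>J. x - y \<in> J) \<and> (\<forall>r\<in>R. \<forall>x\<in>J. r * x \<in> J)"

definition is_prime_ideal :: "'a::comm_ring_1 set \<Rightarrow> 'a set \<Rightarrow> bool" where
  "is_prime_ideal R M \<longleftrightarrow>
     is_ideal R M \<and> 1 \<notin> M \<and> (\<forall>x\<in>R. \<forall>y\<in>R. x * y \<in> M \<longrightarrow> x \<in> M \<or> y \<in> M)"

lemma is_prime_idealD: "is_prime_ideal R M \<Longrightarrow> is_ideal R M"
  by (simp add: is_prime_ideal_def)

lemma
  assumes "is_ideal R J"
  shows ideal_subset: "x \<in> J \<Longrightarrow> x \<in> R"
    and ideal_zero: "0 \<in> J"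
    and ideal_diff: "x \<in> J \<Longrightarrow> y \<in> J \<Longrightarrow> x - y \<in> J"
    and ideal_mult_left: "r \<in> R \<Longrightarrow> x \<in> J \<Longrightarrow> r * x \<in> J"
    and ideal_mult_right: "r \<in> R \<Longrightarrow> x \<in> J \<Longrightarrow> x * r \<in> J"
  using assms by (auto simp: is_ideal_def mult.commute)

lemma ideal_uminus: "is_ideal R J \<Longrightarrow> x \<in> J \<Longrightarrow> - x \<in> J"
  using ideal_diff[of R J 0 x] ideal_zero by fastforce

lemma ideal_add: "is_ideal R J \<Longrightarrow> x \<in> J \<Longrightarrow> y \<in> J \<Longrightarrow> x + y \<in> J"
  using ideal_diff[of R J x "- y"] ideal_uminus by fastforce

lemma ideal_sum: "is_ideal R J \<Longrightarrow> (\<And>i. i \<in> I \<Longrightarrow> f i \<in> J) \<Longrightarrow> sum f I \<in> J"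
  by (induction I rule: infinite_finite_induct) (auto intro: ideal_zero ideal_add)

definition ideal_cong :: "'a::comm_ring_1 set \<Rightarrow> 'a \<Rightarrow> 'a \<Rightarrow> bool" where
  "ideal_cong J x y \<longleftrightarrow> x - y \<in> J"

lemma ideal_cong_refl: "is_ideal R J \<Longrightarrow> ideal_cong J x x"
  by (simp add: ideal_cong_def ideal_zero)

lemma ideal_cong_sym: "is_ideal R J \<Longrightarrow> ideal_cong J x y \<Longrightarrow> ideal_cong J y x"
  unfolding ideal_cong_def using ideal_uminus[of R J "x - y"] by simp

lemma ideal_cong_trans: "is_ideal R J \<Longrightarrow> ideal_cong J x y \<Longrightarrow> ideal_cong J y z \<Longrightarrow> ideal_cong J x z"
  unfolding ideal_cong_def using ideal_add[of R J "x - y" "y - z"] by simp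

lemma ideal_cong_add:
  "is_ideal R J \<Longrightarrow> ideal_cong J x y \<Longrightarrow> ideal_cong J x' y' \<Longrightarrow> ideal_cong J (x + x') (y + y')"
  unfolding ideal_cong_def using ideal_add[of R J "x - y" "x' - y'"] by (simp add: algebra_simps)

lemma ideal_cong_mult:
  assumes "is_ideal R J" "ideal_cong J x y" "ideal_cong J x' y'" "x' \<in> R" "y \<in> R"
  shows "ideal_cong J (x * x') (y * y')"
proof -
  have "(x - y) * x' + y * (x' - y') \<in> J"
    using assms unfolding ideal_cong_def
    by (intro ideal_add[of R] ideal_mult_left[of R] ideal_mult_right[of R])
  then show ?thesis by (simp add: ideal_cong_def algebra_simps)
qed

lemma ideal_cong_sum:
  "is_ideal R J \<Longrightarrow> (\<And>i. i \<in> I \<Longrightarrow> ideal_cong J (f i) (g i)) \<Longrightarrow> ideal_cong J (sum f I) (sum g I)"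
  unfolding ideal_cong_def sum_subtractf[symmetric] by (rule ideal_sum)

lemma ideal_cong_power:
  assumes "is_subring R" "is_ideal R J" "ideal_cong J x y" "x \<in> R" "y \<in> R"
  shows "ideal_cong J (x ^ k) (y ^ k)"
  by (induction k) (use assms in \<open>auto intro!: ideal_cong_mult ideal_cong_refl subring_power\<close>)

lemma ideal_cong_mem: "is_ideal R J \<Longrightarrow> ideal_cong J x y \<Longrightarrow> x \<in> J \<longleftrightarrow> y \<in> J"
  unfolding ideal_cong_def
  using ideal_add[of R J "x - y" y] ideal_diff[of R J x "x - y"] by auto

lemma prime_ideal_prod:
  assumes "is_subring R" "is_prime_ideal R M" "finite I" "\<And>i. i \<in> I \<Longrightarrow> f i \<in> R" "prod f I \<in> M"
  shows "\<exists>i\<in>I. f i \<in> M"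
  using assms(3-5)
proof (induction I)
  case (insert i I)
  have "f i * prod f I \<in> M" using insert by simp
  moreover have "f i \<in> R" "prod f I \<in> R" using insert.prems assms(1) by (auto intro: subring_prod)
  ultimately have "f i \<in> M \<or> prod f I \<in> M" using assms(2) by (simp add: is_prime_ideal_def)
  then show ?case using insert by auto
qed (use assms(2) in \<open>simp add: is_prime_ideal_def\<close>)

lemma prime_ideal_power:
  assumes "is_subring R" "is_prime_ideal R M" "x \<in> R" "x ^ k \<in> M"
  shows "x \<in> M"
  using prime_ideal_prod[OF assms(1,2), of "{..<k}" "\<lambda>_. x"] assms by auto

text \<open>Zorn's lemma on the proper ideals containing \<open>a\<close>; that \<open>a\<close> is
  not a unit makes its principal ideal one of them. A maximal \<open>M\<close> is prime: for
  \<open>x\<close> outside \<open>M\<close> there is a relation 1 = m + r x, and y = y m + r x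
  y.\<close>

lemma exists_prime_ideal:
  assumes R: "is_subring R" and a: "a \<in> R" and nu: "\<And>b. b \<in> R \<Longrightarrow> b * a \<noteq> 1"
  shows "\<exists>M. is_prime_ideal R M \<and> a \<in> M"
proof -
  define S where "S = {J. is_ideal R J \<and> a \<in> J \<and> 1 \<notin> J}"
  let ?J = "(\<lambda>b. b * a) ` R"
  have "is_ideal R ?J"
    unfolding is_ideal_def
  proof (intro conjI ballI)
    show "?J \<subseteq> R" using R a by (auto intro: subring_mult)
    show "0 \<in> ?J" using subring_zero[OF R] by (intro image_eqI[of _ _ 0]) auto
  next
    fix x y assume "x \<in> ?J" "y \<in> ?J"
    then obtain b c where "b \<in> R" "c \<in> R" "x = b * a" "y = c * a" by auto
    then show "x - y \<in> ?J"
      using R by (intro image_eqI[of _ _ "b - c"]) (auto simp: algebra_simps intro: subring_diff)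
  next
    fix r x assume "r \<in> R" "x \<in> ?J"
    then obtain b where "b \<in> R" "x = b * a" by auto
    then show "r * x \<in> ?J"
      using R \<open>r \<in> R\<close> by (intro image_eqI[of _ _ "r * b"]) (auto simp: algebra_simps intro: subring_mult)
  qed
  moreover have "a \<in> ?J" using subring_one[OF R] by (intro image_eqI[of _ _ 1]) auto
  moreover have "1 \<notin> ?J" using nu by force
  ultimately have ne: "S \<noteq> {}" by (auto simp: S_def)
  have "\<exists>M\<in>S. \<forall>U\<in>S. M \<subseteq> U \<longrightarrow> U = M"
  proof (rule subset_Zorn_nonempty[OF ne])
    fix C assume C: "C \<noteq> {}" "subset.chain S C"
    then have id: "is_ideal R J" "a \<in> J" "1 \<notin> J" if "J \<in> C" for J
      using that by (auto simp: subset_chain_def S_def)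
    have tot: "U \<subseteq> Y \<or> Y \<subseteq> U" if "U \<in> C" "Y \<in> C" for U Y
      using C(2) that by (auto simp: subset_chain_def S_def)
    have "x - y \<in> (\<Union>C)" if xy: "x \<in> (\<Union>C)" "y \<in> (\<Union>C)" for x y
    proof -
      obtain U Y where "U \<in> C" "Y \<in> C" "x \<in> U" "y \<in> Y" using xy by blast
      then obtain Z where "Z \<in> C" "x \<in> Z" "y \<in> Z" using tot[of U Y] by blast
      then show ?thesis using ideal_diff id(1) by blast
    qed
    moreover have "r * x \<in> (\<Union>C)" if "r \<in> R" "x \<in> (\<Union>C)" for r x
      using that id(1) ideal_mult_left by blast
    moreover have "(\<Union>C) \<subseteq> R" using id(1) ideal_subset by blast
    moreover have "0 \<in> (\<Union>C)" "a \<in> (\<Union>C)" using C(1) id ideal_zero by blast+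
    moreover have "1 \<notin> (\<Union>C)" using id(3) by blast
    ultimately show "(\<Union>C) \<in> S" by (simp add: S_def is_ideal_def del: Union_iff)
  qed
  then obtain M where M: "is_ideal R M" "a \<in> M" "1 \<notin> M"
    and max: "\<And>U. is_ideal R U \<Longrightarrow> a \<in> U \<Longrightarrow> 1 \<notin> U \<Longrightarrow> M \<subseteq> U \<Longrightarrow> U = M"
    by (auto simp: S_def)
  have "y \<in> M" if xy: "x \<in> R" "y \<in> R" "x * y \<in> M" "x \<notin> M" for x y
  proof -
    let ?U = "{m + r * x |m r. m \<in> M \<and> r \<in> R}"
    have "is_ideal R ?U"
      unfolding is_ideal_def
    proof (intro conjI ballI)
      show "?U \<subseteq> R" using R xy M ideal_subset[OF M(1)] by (auto intro!: subring_add subring_mult)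
      show "0 \<in> ?U" using ideal_zero[OF M(1)] subring_zero[OF R] by force
    next
      fix u v assume "u \<in> ?U" "v \<in> ?U"
      then obtain m r m' r' where "u = m + r * x" "v = m' + r' * x" "m \<in> M" "r \<in> R" "m' \<in> M" "r' \<in> R"
        by blast
      then have "u - v = (m - m') + (r - r') * x" "m - m' \<in> M" "r - r' \<in> R"
        using M R by (auto simp: algebra_simps intro: ideal_diff subring_diff)
      then show "u - v \<in> ?U" by blast
    next
      fix s u assume "s \<in> R" "u \<in> ?U"
      then obtain m r where "u = m + r * x" "m \<in> M" "r \<in> R" by blast
      then have "s * u = s * m + (s * r) * x" "s * m \<in> M" "s * r \<in> R"
        using M R \<open>s \<in> R\<close> by (auto simp: algebra_simps intro: ideal_mult_left ideal_mult_right subring_mult)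
      then show "s * u \<in> ?U" by blast
    qed
    moreover have sub: "M \<subseteq> ?U" using subring_zero[OF R] by force
    moreover have "x \<in> ?U" using ideal_zero[OF M(1)] subring_one[OF R] by force
    ultimately have "1 \<in> ?U" using max[of ?U] M(2) xy(4) by blast
    then obtain m r where mr: "1 = m + r * x" "m \<in> M" "r \<in> R" by blast
    have "y = y * m + r * (x * y)" using arg_cong[OF mr(1), of "\<lambda>t. t * y"] by (simp add: algebra_simps)
    also have "\<dots> \<in> M"
      by (rule ideal_add[OF M(1) ideal_mult_left[OF M(1) xy(2) mr(2)] ideal_mult_left[OF M(1) mr(3) xy(3)]])
    finally show ?thesis .
  qed
  then show ?thesis using M by (auto simp: is_prime_ideal_def)
qed

lemma is_ideal_polys_over:
  assumes "is_subring R" "is_ideal R J"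
  shows "is_ideal (polys_over R) (polys_over J)"
  using assms ideal_zero[OF assms(2)] ideal_subset[OF assms(2)]
  unfolding is_ideal_def[of "polys_over R"]
  by (auto simp: polys_over_def coeff_mult intro!: ideal_diff[of R] ideal_sum[of R] ideal_mult_left[of R])

text \<open>Gauss's lemma with lowest coefficients: if i and j are the first indices with
  coefficients outside \<open>M\<close>, then every other summand of the product's coefficient at i
  + j has a factor in \<open>M\<close>.\<close>

lemma is_prime_ideal_polys_over:
  assumes R: "is_subring R" and M: "is_prime_ideal R M"
  shows "is_prime_ideal (polys_over R) (polys_over M)"
  unfolding is_prime_ideal_def[of "polys_over R"]
proof (intro conjI ballI impI)
  note I = is_prime_idealD[OF M]
  show "is_ideal (polys_over R) (polys_over M)" using is_ideal_polys_over R I by blast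
  have "coeff 1 0 \<notin> M" using M by (simp add: is_prime_ideal_def)
  then show "1 \<notin> polys_over M" using polys_over_coeff by blast
  fix f g assume fg: "f \<in> polys_over R" "g \<in> polys_over R" "f * g \<in> polys_over M"
  show "f \<in> polys_over M \<or> g \<in> polys_over M"
  proof (rule ccontr)
    assume neg: "\<not> ?thesis"
    define i where "i = (LEAST i. coeff f i \<notin> M)"
    define j where "j = (LEAST j. coeff g j \<notin> M)"
    have ex: "\<exists>i. coeff f i \<notin> M" "\<exists>j. coeff g j \<notin> M" using neg by (auto simp: polys_over_def)
    have i: "coeff f i \<notin> M" and j: "coeff g j \<notin> M"
      unfolding i_def j_def by (rule LeastI_ex[OF ex(1)], rule LeastI_ex[OF ex(2)])
    have lt: "coeff f k \<in> M" if "k < i" for k using not_less_Least that unfolding i_def by blast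
    have lt': "coeff g k \<in> M" if "k < j" for k using not_less_Least that unfolding j_def by blast
    have "coeff (f * g) (i + j) = coeff f i * coeff g j + (\<Sum>k\<in>{..i+j} - {i}. coeff f k * coeff g (i + j - k))"
      unfolding coeff_mult by (subst sum.remove[of _ i]) auto
    moreover have "(\<Sum>k\<in>{..i+j} - {i}. coeff f k * coeff g (i + j - k)) \<in> M"
    proof (rule ideal_sum[OF I])
      fix k assume k: "k \<in> {..i+j} - {i}"
      show "coeff f k * coeff g (i + j - k) \<in> M"
      proof (cases "k < i")
        case True
        then show ?thesis using lt fg(2) polys_over_coeff by (blast intro: ideal_mult_right[OF I])
      next
        case False
        then have "i + j - k < j" using k by auto
        then show ?thesis using lt' fg(1) polys_over_coeff by (blast intro: ideal_mult_left[OF I])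
      qed
    qed
    moreover have "coeff (f * g) (i + j) \<in> M" using fg(3) polys_over_coeff by blast
    ultimately have "coeff f i * coeff g j \<in> M"
      using ideal_diff[OF I] by (metis add_diff_cancel_right')
    then show False using i j fg M polys_over_coeff unfolding is_prime_ideal_def by blast
  qed
qed

subsection \<open>Integrality\<close>

text \<open>Rational linear functionals take the place of module-finiteness of \<open>\<int>[\<alpha>]\<close> over the integers.\<close>

definition bounded_denominators :: "complex set \<Rightarrow> bool" where
  "bounded_denominators R \<longleftrightarrow> (\<forall>l :: complex \<Rightarrow> rat. (\<forall>x y. l (x + y) = l x + l y) \<longrightarrow>
     (\<exists>D::nat. D > 0 \<and> (\<forall>a\<in>R. of_nat D * l a \<in> \<int>)))"

lemma additive_sum:
  fixes l :: "'a::ab_group_add \<Rightarrow> 'b::ab_group_add"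
  assumes "\<forall>x y. l (x + y) = l x + l y"
  shows "l (sum f I) = (\<Sum>i\<in>I. l (f i))"
proof -
  have "l (0 + 0) = l 0 + l 0" using assms by blast
  then have "l 0 = 0" by simp
  then show ?thesis using assms by (induction I rule: infinite_finite_induct) auto
qed

lemma additive_of_nat_mult:
  fixes l :: "'a::comm_ring_1 \<Rightarrow> 'b::comm_ring_1"
  assumes "\<forall>x y. l (x + y) = l x + l y"
  shows "l (of_nat k * x) = of_nat k * l x"
  using additive_sum[OF assms, of "\<lambda>_. x" "{..<k}"] by simp

lemma additive_of_int_mult:
  fixes l :: "'a::comm_ring_1 \<Rightarrow> 'b::comm_ring_1"
  assumes "\<forall>x y. l (x + y) = l x + l y"
  shows "l (of_int k * x) = of_int k * l x"
proof -
  have "l (0 + 0) = l 0 + l 0" using assms by blast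
  then have "l 0 = 0" by simp
  then have neg: "l (- y) = - l y" for y
    using assms[rule_format, of y "- y"] by (simp add: eq_neg_iff_add_eq_0 add.commute)
  show ?thesis
    by (cases k rule: int_cases2) (auto simp: neg additive_of_nat_mult[OF assms])
qed

lemma bounded_denominators_Ints: "bounded_denominators \<int>"
  unfolding bounded_denominators_def
proof (intro allI impI)
  fix l :: "complex \<Rightarrow> rat" assume l: "\<forall>x y. l (x + y) = l x + l y"
  obtain u v where uv: "quotient_of (l 1) = (u, v)" by (cases "quotient_of (l 1)")
  then have v: "v > 0" "l 1 = of_int u / of_int v"
    using quotient_of_denom_pos quotient_of_div by blast+
  have "of_nat (nat v) * l a \<in> \<int>" if "a \<in> \<int>" for a
  proof -
    obtain k where k: "a = of_int k" using \<open>a \<in> \<int>\<close> by (rule Ints_cases)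
    have "l a = of_int k * l 1" using additive_of_int_mult[OF l, of k 1] k by simp
    then have "of_nat (nat v) * l a = of_int (k * u)" using v by simp
    then show ?thesis by (metis Ints_of_int)
  qed
  then show "\<exists>D::nat. D > 0 \<and> (\<forall>a\<in>\<int>. of_nat D * l a \<in> \<int>)"
    using v(1) by (intro exI[of _ "nat v"]) auto
qed

text \<open>Division by the monic \<open>m\<close> writes each element as a combination of finitely
  many powers of \<open>x\<close> with coefficients in \<open>R\<close>. For each exponent j the map
  taking a to \<open>l (a * x ^ j)\<close> is again additive and so has a common denominator on
  \<open>R\<close>; the product of these serves for the whole extension.\<close>

lemma bounded_denominators_adjoin:
  assumes R: "is_subring R" and B: "bounded_denominators R"
    and m: "m \<in> polys_over R" "lead_coeff m = 1" "poly m x = 0"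
  shows "bounded_denominators (adjoin R x)"
  unfolding bounded_denominators_def
proof (intro allI impI)
  fix l :: "complex \<Rightarrow> rat" assume l: "\<forall>x y. l (x + y) = l x + l y"
  define d where "d = degree m"
  have "\<exists>D::nat. D > 0 \<and> (\<forall>a\<in>R. of_nat D * l (a * x ^ j) \<in> \<int>)" for j
    using B[unfolded bounded_denominators_def, rule_format, of "\<lambda>a. l (a * x ^ j)"] l
    by (auto simp: algebra_simps)
  then obtain D :: "nat \<Rightarrow> nat" where D: "\<And>j. D j > 0" "\<And>j a. a \<in> R \<Longrightarrow> of_nat (D j) * l (a * x ^ j) \<in> \<int>"
    by metis
  have "of_nat (\<Prod>j\<le>d. D j) * l a \<in> \<int>" if a: "a \<in> adjoin R x" for a
  proof -
    obtain f where f: "f \<in> polys_over R" "a = poly f x" using a by (auto simp: adjoin_def)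
    define g where "g = f mod m"
    have m0: "m \<noteq> 0" using m(2) by auto
    have gR: "g \<in> polys_over R"
      unfolding g_def using polys_over_div_mod[OF R _ f(1) m(1)] m(2) by simp
    have "degree g \<le> d" unfolding g_def d_def using degree_mod_less[OF m0, of f] by auto
    have "a = poly g x" unfolding g_def f(2)
      using m(3) by (metis add_0 div_mult_mod_eq mult_zero_right poly_add poly_mult)
    also have "\<dots> = (\<Sum>j\<le>d. coeff g j * x ^ j)"
      unfolding poly_altdef using \<open>degree g \<le> d\<close>
      by (intro sum.mono_neutral_left) (auto intro: le_degree)
    finally have "l a = (\<Sum>j\<le>d. l (coeff g j * x ^ j))" using additive_sum[OF l] by simp
    then have "of_nat (\<Prod>j\<le>d. D j) * l a = (\<Sum>j\<le>d. of_nat (\<Prod>j\<le>d. D j) * l (coeff g j * x ^ j))"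
      by (simp add: sum_distrib_left)
    also have "\<dots> \<in> \<int>"
    proof (rule Ints_sum)
      fix j assume "j \<in> {..d}"
      then have "(\<Prod>j\<le>d. D j) = (\<Prod>j\<in>{..d}-{j}. D j) * D j"
        by (simp add: prod.remove[of _ j] mult.commute)
      moreover have "of_nat (D j) * l (coeff g j * x ^ j) \<in> \<int>"
        using D(2) gR polys_over_coeff by blast
      then have "of_nat (\<Prod>j\<in>{..d}-{j}. D j) * (of_nat (D j) * l (coeff g j * x ^ j)) \<in> \<int>"
        by (rule Ints_mult[OF Ints_of_nat])
      ultimately show "of_nat (\<Prod>j\<le>d. D j) * l (coeff g j * x ^ j) \<in> \<int>"
        by (simp add: mult.assoc)
    qed
    finally show ?thesis .
  qed
  moreover have "(\<Prod>j\<le>d. D j) > 0" using D(1) by (simp add: prod_pos)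
  ultimately show "\<exists>D::nat. D > 0 \<and> (\<forall>a\<in>adjoin R x. of_nat D * l a \<in> \<int>)" by blast
qed

lemma bounded_denominators_adjoin_list:
  assumes "is_subring R" "bounded_denominators R"
    and "\<And>x. x \<in> set xs \<Longrightarrow> \<exists>m\<in>polys_over R. lead_coeff m = 1 \<and> poly m x = 0"
  shows "bounded_denominators (adjoin_list R xs)"
  using assms
proof (induction xs arbitrary: R)
  case (Cons x xs)
  have "\<exists>m\<in>polys_over (adjoin R x). lead_coeff m = 1 \<and> poly m y = 0" if y: "y \<in> set xs" for y
  proof -
    obtain m where "m \<in> polys_over R" "lead_coeff m = 1" "poly m y = 0"
      using Cons.prems(3)[of y] y by auto
    then show ?thesis
      using subset_adjoin[OF Cons.prems(1), of x] by (intro bexI[of _ m]) (auto simp: polys_over_def)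
  qed
  moreover have "bounded_denominators (adjoin R x)"
    using bounded_denominators_adjoin[OF Cons.prems(1,2)] Cons.prems(3)[of x] by auto
  ultimately show ?case using Cons.IH[OF is_subring_adjoin[OF Cons.prems(1)]] by simp
qed auto

text \<open>The single vector 1 is linearly independent over the rationals, so its prescribed image
  extends to a linear functional on the complex numbers.\<close>

lemma exists_rat_functional:
  "\<exists>l :: complex \<Rightarrow> rat. (\<forall>x y. l (x + y) = l x + l y) \<and> l 1 = 1"
proof -
  let ?s = "\<lambda>(q::rat) (x::complex). of_rat q * x"
  have vs: "vector_space ?s"
    by standard (auto simp: algebra_simps of_rat_add of_rat_mult)
  have vp: "vector_space_pair ?s ((*) :: rat \<Rightarrow> rat \<Rightarrow> rat)"
    by (intro vector_space_pair.intro vs vector_space_over_itself.vector_space_axioms)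
  have "\<not> module.dependent ?s {1}"
    using vector_space.dependent_single[OF vs] by simp
  from vector_space_pair.linear_independent_extend[OF vp this, of "\<lambda>_. 1"]
  obtain g where "Vector_Spaces.linear ?s (*) g" "g 1 = 1" by auto
  then show ?thesis
    by (intro exI[of _ g] conjI allI module_hom.add[of ?s "(*)" g] Vector_Spaces.linear.axioms(3))
qed

text \<open>If 1/p lay in \<open>R\<close>, so would all its powers, on which a functional with
  \<open>l 1 = 1\<close> takes the values 1/p^k. Taking the common denominator \<open>D\<close>
  itself as exponent makes p^D divide \<open>D\<close>, against D < 2^D.\<close>

lemma bounded_denominators_not_unit:
  assumes R: "is_subring R" and B: "bounded_denominators R" and p: "p \<ge> 2" and b: "b \<in> R"
  shows "b * of_nat p \<noteq> 1"
proof
  assume e: "b * of_nat p = 1"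
  obtain l :: "complex \<Rightarrow> rat" where l: "\<forall>x y. l (x + y) = l x + l y" "l 1 = 1"
    using exists_rat_functional by (elim exE conjE)
  obtain D :: nat where D: "D > 0" "\<And>a. a \<in> R \<Longrightarrow> of_nat D * l a \<in> \<int>"
    using B[unfolded bounded_denominators_def, rule_format, OF l(1)[rule_format]] by auto
  have "b ^ D \<in> R" using R b by (rule subring_power)
  from D(2)[OF this] obtain t where t: "of_nat D * l (b ^ D) = of_int t" by (rule Ints_cases)
  have "of_nat (p ^ D) * b ^ D = 1"
    using arg_cong[OF e, of "\<lambda>x. x ^ D"] by (simp add: power_mult_distrib mult.commute)
  then have "of_nat (p ^ D) * l (b ^ D) = 1"
    by (simp only: additive_of_nat_mult[OF l(1), symmetric] l(2))
  then have "of_nat D = of_nat (p ^ D) * (of_int t :: rat)"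
    by (simp only: t[symmetric] mult.left_commute[of _ "of_nat D"] mult_1_right)
  then have "of_int (int D) = (of_int (int (p ^ D) * t) :: rat)" by simp
  then have "int D = int (p ^ D) * t" by (simp only: of_int_eq_iff)
  then have "int (p ^ D) dvd int D" by (rule dvdI)
  then have "p ^ D \<le> D" unfolding int_dvd_int_iff using D(1) by (rule dvd_imp_le)
  moreover have "D < 2 ^ D" by (rule less_exp)
  moreover have "2 ^ D \<le> p ^ D" using p by (rule power_mono) simp
  ultimately show False by (metis leD le_trans)
qed

subsection \<open>Frobenius elements\<close>

text \<open>Stated over an arbitrary commutative ring because it is used over the integers, where
  induction turns it into Fermat's little theorem, and over a polynomial ring, where it gives the
  Frobenius argument.\<close>

lemma ideal_cong_add_prime_power:
  assumes R: "is_subring R" and J: "is_ideal R J" and p: "prime p" "of_nat p \<in> J" and xy: "x \<in> R" "y \<in> R"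
  shows "ideal_cong J ((x + y) ^ p) (x ^ p + y ^ p)"
proof -
  have p0: "p > 0" using p(1) by (simp add: prime_gt_0_nat)
  have "{..p} = insert 0 (insert p {1..<p})" using p0 by auto
  then have "(x + y) ^ p = x ^ p + y ^ p + (\<Sum>k\<in>{1..<p}. of_nat (p choose k) * x ^ k * y ^ (p - k))"
    unfolding binomial_ring using p0 by simp
  moreover have "(\<Sum>k\<in>{1..<p}. of_nat (p choose k) * x ^ k * y ^ (p - k)) \<in> J"
  proof (rule ideal_sum[OF J])
    fix k assume "k \<in> {1..<p}"
    then have "p dvd (p choose k)" using p(1) by (intro dvd_choose_prime) auto
    then obtain c where "p choose k = p * c" ..
    then have "of_nat (p choose k) * x ^ k * y ^ (p - k) = of_nat p * (of_nat c * x ^ k * y ^ (p - k))"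
      by simp
    also have "\<dots> \<in> J" using R xy p(2) by (intro ideal_mult_right[OF J]) (auto intro: subring_intros)
    finally show "of_nat (p choose k) * x ^ k * y ^ (p - k) \<in> J" .
  qed
  ultimately show ?thesis by (simp add: ideal_cong_def)
qed

lemma ideal_cong_sum_prime_power:
  assumes R: "is_subring R" and J: "is_ideal R J" and p: "prime p" "of_nat p \<in> J"
    and f: "\<And>i. i \<in> I \<Longrightarrow> f i \<in> R"
  shows "ideal_cong J ((\<Sum>i\<in>I. f i) ^ p) (\<Sum>i\<in>I. f i ^ p)"
  using f
proof (induction I rule: infinite_finite_induct)
  case (insert i I)
  have "ideal_cong J ((f i + sum f I) ^ p) (f i ^ p + sum f I ^ p)"
    using insert.prems R by (intro ideal_cong_add_prime_power[OF R J p]) (auto intro: subring_sum)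
  moreover have "ideal_cong J (f i ^ p + sum f I ^ p) (f i ^ p + (\<Sum>i\<in>I. f i ^ p))"
    using insert by (intro ideal_cong_add[OF J] ideal_cong_refl[OF J]) auto
  ultimately show ?case using ideal_cong_trans[OF J] insert.hyps by simp
qed (use p(1) in \<open>auto simp: prime_gt_0_nat power_0_left intro: ideal_cong_refl[OF J]\<close>)

lemma int_fermat:
  fixes k :: int
  assumes p: "prime p"
  shows "int p dvd k ^ p - k"
proof -
  let ?J = "{x. int p dvd x}"
  have R: "is_subring (UNIV :: int set)" by (simp add: is_subring_def)
  have J: "is_ideal UNIV ?J" by (auto simp: is_ideal_def)
  have nat: "int p dvd int m ^ p - int m" for m
  proof (induction m)
    case (Suc m)
    have "ideal_cong ?J ((int m + 1) ^ p) (int m ^ p + 1 ^ p)"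
      using p by (intro ideal_cong_add_prime_power[OF R J]) auto
    then have "int p dvd ((int m + 1) ^ p - (int m ^ p + 1)) + (int m ^ p - int m)"
      using Suc by (intro dvd_add) (auto simp: ideal_cong_def)
    then show ?case by (simp add: algebra_simps)
  qed (use prime_gt_0_nat[OF p] in \<open>simp add: power_0_left\<close>)
  have p0: "int p > 0" using p by (simp add: prime_gt_0_nat)
  then obtain m where m: "k mod int p = int m" using zero_le_imp_eq_int[of "k mod int p"] by auto
  have k: "[k = int m] (mod int p)" unfolding m[symmetric] by (simp add: cong_def)
  have "[k ^ p - k = int m ^ p - int m] (mod int p)"
    using k by (intro cong_diff cong_pow)
  then show ?thesis using nat[of m] cong_dvd_iff by blast
qed

section \<open>Congruences modulo a prime ideal above p\<close>

locale prime_over =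
  fixes R M :: "complex set" and p :: nat
  assumes R: "is_subring R" and M: "is_prime_ideal R M" and p: "prime p" and pM: "of_nat p \<in> M"
begin

lemma I: "is_ideal R M" using M by (rule is_prime_idealD)

lemma of_int_mem_iff: "of_int k \<in> M \<longleftrightarrow> int p dvd k"
proof
  assume "int p dvd k"
  then obtain c where "k = int p * c" ..
  then have "of_int k = of_int c * (of_nat p :: complex)" by simp
  then show "of_int k \<in> M" using ideal_mult_left[OF I subring_of_int[OF R] pM] by metis
next
  assume k: "of_int k \<in> M"
  show "int p dvd k"
  proof (rule ccontr)
    assume "\<not> int p dvd k"
    then have "coprime (int p) k" using p by (simp add: prime_imp_coprime)
    then obtain a b where "a * int p + b * k = 1" using bezout_int[of "int p" k] by auto
    then have "of_int (a * int p + b * k) = (1::complex)" by simp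
    then have "1 = of_int a * of_nat p + of_int b * (of_int k :: complex)" by simp
    moreover have "of_int a * of_nat p + of_int b * of_int k \<in> M"
      using k pM by (intro ideal_add[OF I] ideal_mult_left[OF I] subring_of_int[OF R])
    ultimately show False using M by (simp add: is_prime_ideal_def)
  qed
qed

text \<open>This avoids showing that rational elements of \<open>R\<close> are integers. For x = u/v
  in lowest terms, p cannot divide v, since v x = u would force it to divide u as well. Fermat for u
  and v puts v (x^p - x) into \<open>M\<close>, and v can be cancelled.\<close>

lemma rat_pow_cong:
  assumes x: "x \<in> R" "x \<in> \<rat>"
  shows "ideal_cong M (x ^ p) x"
proof -
  obtain u v where uv: "v > 0" "coprime u v" "x = of_int u / of_int v"
    using Rats_cases'[OF x(2)] by metis
  have e: "of_int v * x = of_int u" using uv by simp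
  have nv: "\<not> int p dvd v"
  proof
    assume d: "int p dvd v"
    then have "x * of_int v \<in> M" using of_int_mem_iff x(1) ideal_mult_left[OF I] by blast
    then have "int p dvd u" using e of_int_mem_iff by (metis mult.commute)
    then have "is_unit (int p)" using d coprime_common_divisor[OF uv(2)] by blast
    then show False using prime_gt_1_nat[OF p] by simp
  qed
  note fermat = int_fermat[OF p]
  have "of_int v * (x ^ p - x) = - of_int (v ^ p - v) * x ^ p + of_int (u ^ p - u)"
  proof -
    have "of_int v ^ p * x ^ p = (of_int u :: complex) ^ p" using e by (metis power_mult_distrib)
    then show ?thesis using e by (simp add: algebra_simps)
  qed
  also have "\<dots> \<in> M"
    using fermat of_int_mem_iff x(1) R
    by (intro ideal_add[OF I] ideal_mult_right[OF I] ideal_uminus[OF I] subring_power) (auto simp del: of_int_diff of_int_power)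
  finally have "of_int v \<in> M \<or> x ^ p - x \<in> M"
    using M x(1) R by (simp add: is_prime_ideal_def subring_of_int subring_diff subring_power)
  then show ?thesis using nv of_int_mem_iff by (simp add: ideal_cong_def)
qed

end

lemma pcompose_monom_eq_sum:
  fixes f :: "'a::comm_ring_1 poly"
  shows "pcompose f (monom 1 p) = (\<Sum>i\<le>degree f. monom (coeff f i) (p * i))"
proof -
  have m: "pcompose (monom a i) (monom 1 p) = monom a (p * i)" for a :: 'a and i
  proof (induction i)
    case (Suc i)
    have "pcompose (monom a (Suc i)) (monom 1 p) = monom 1 p * pcompose (monom a i) (monom 1 p)"
      by (simp add: monom_Suc pcompose_pCons)
    with Suc show ?case by (simp add: mult_monom algebra_simps)
  qed (simp add: monom_0)
  have "pcompose f (monom 1 p) = pcompose (\<Sum>i\<le>degree f. monom (coeff f i) i) (monom 1 p)"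
    by (simp add: poly_as_sum_of_monoms)
  then show ?thesis by (simp only: pcompose_sum m)
qed

text \<open>Substituting X^p only moves coefficients to the multiples of p, so a congruence between
  composed polynomials can be pulled back coefficient by coefficient.\<close>

lemma coeff_pcompose_monom:
  fixes f :: "'a::comm_ring_1 poly"
  assumes "p > 0"
  shows "coeff (pcompose f (monom 1 p)) (p * i) = coeff f i"
  unfolding pcompose_monom_eq_sum coeff_sum
  using assms by (auto simp: coeff_monom le_degree not_le coeff_eq_0)

lemma polys_over_pcompose_monom:
  assumes "is_subring R" "f \<in> polys_over R"
  shows "pcompose f (monom 1 p) \<in> polys_over R"
  unfolding pcompose_monom_eq_sum using assms
  by (intro subring_sum is_subring_polys_over polys_over_monom polys_over_coeff)

context prime_over
begin

text \<open>The p-th power is taken monomial by monomial, and \<open>d\<close> carries the p-th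
  powers of the coefficients of \<open>c\<close>. A separate \<open>d\<close> serves two cases:
  rational coefficients, where \<open>d\<close> is \<open>c\<close>, and the polynomial built from
  the roots, where \<open>d\<close> really changes. The degree bound lets the sum over the monomials
  of \<open>c\<close> reach all of \<open>d\<close>.\<close>

lemma poly_pow_cong:
  assumes c: "c \<in> polys_over R" and pc: "\<And>i. ideal_cong M (coeff c i ^ p) (coeff d i)"
    and le: "degree d \<le> degree c"
  shows "ideal_cong (polys_over M) (c ^ p) (pcompose d (monom 1 p))"
proof -
  note RP = is_subring_polys_over[OF R]
  note IP = is_ideal_polys_over[OF R I]
  have pP: "of_nat p \<in> polys_over M"
    using pM ideal_zero[OF I] by (simp add: of_nat_poly polys_over_pCons_iff polys_over_0)
  have "ideal_cong (polys_over M) ((\<Sum>i\<le>degree c. monom (coeff c i) i) ^ p)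
          (\<Sum>i\<le>degree c. monom (coeff c i) i ^ p)"
    using c by (intro ideal_cong_sum_prime_power[OF RP IP p pP] polys_over_monom R polys_over_coeff)
  moreover have "ideal_cong (polys_over M) (\<Sum>i\<le>degree c. monom (coeff c i) i ^ p)
     (\<Sum>i\<le>degree c. monom (coeff d i) (p * i))"
  proof (rule ideal_cong_sum[OF IP])
    fix i
    have "monom (coeff c i) i ^ p - monom (coeff d i) (p * i) = monom (coeff c i ^ p - coeff d i) (p * i)"
      by (simp add: monom_power diff_monom mult.commute)
    then show "ideal_cong (polys_over M) (monom (coeff c i) i ^ p) (monom (coeff d i) (p * i))"
      using pc[of i] ideal_zero[OF I] by (simp add: ideal_cong_def polys_over_def)
  qed
  moreover have "(\<Sum>i\<le>degree c. monom (coeff d i) (p * i)) = pcompose d (monom 1 p)"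
    unfolding pcompose_monom_eq_sum using le
    by (intro sum.mono_neutral_right) (auto simp: not_le coeff_eq_0)
  ultimately show ?thesis
    using ideal_cong_trans[OF IP] by (simp add: poly_as_sum_of_monoms)
qed

text \<open>
  The conjugates of \<open>b = \<Sum>i. \<omega> i X\<^sup>i\<close> are the roots of a polynomial \<open>W\<close> with rational coefficients. Raising
  \<open>W(b) = 0\<close> to the power \<open>p\<close> shows that \<open>b' = \<Sum>i. (\<omega> i)\<^sup>p X\<^sup>i\<close> is a root of \<open>W\<close> modulo the prime ideal, hence
  congruent to some conjugate of \<open>b\<close>.
\<close>
lemma exists_frobenius:
  fixes \<omega> :: "nat \<Rightarrow> complex" and G :: "(nat \<Rightarrow> nat) set" and n :: nat
  defines "b \<equiv> \<lambda>\<pi>. \<Sum>i=1..n. monom (\<omega> (\<pi> i)) i"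
  defines "W \<equiv> \<Prod>\<pi>\<in>G. [:- b \<pi>, 1:]"
  assumes G: "finite G" "id \<in> G" "\<And>\<pi> i. \<pi> \<in> G \<Longrightarrow> i \<in> {1..n} \<Longrightarrow> \<pi> i \<in> {1..n}"
    and \<omega>: "\<And>i. i \<in> {1..n} \<Longrightarrow> \<omega> i \<in> R"
    and rat: "\<And>k i. coeff (coeff W k) i \<in> \<rat>"
  shows "\<exists>\<pi>\<in>G. \<forall>i\<in>{1..n}. ideal_cong M (\<omega> (\<pi> i)) (\<omega> i ^ p)"
proof -
  note RP = is_subring_polys_over[OF R]
  note IP = is_ideal_polys_over[OF R I]
  let ?P = "polys_over M"
  let ?T = "monom 1 p :: complex poly"
  define b' where "b' = (\<Sum>i=1..n. monom (\<omega> i ^ p) i)"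
  have coeff_b: "coeff (b \<pi>) i = (if i \<in> {1..n} then \<omega> (\<pi> i) else 0)" for \<pi> i
    unfolding b_def coeff_sum by (auto simp: coeff_monom)
  have coeff_b': "coeff b' i = (if i \<in> {1..n} then \<omega> i ^ p else 0)" for i
    unfolding b'_def coeff_sum by (auto simp: coeff_monom)
  have p0: "p > 0" using p by (simp add: prime_gt_0_nat)
  have bR: "b \<pi> \<in> polys_over R" if "\<pi> \<in> G" for \<pi>
    using G(3)[OF that] \<omega> R by (auto simp: polys_over_def coeff_b subring_zero)
  have b'R: "b' \<in> polys_over R"
    using \<omega> R by (auto simp: polys_over_def coeff_b' subring_zero subring_power)
  have WR: "coeff W k \<in> polys_over R" for k
    unfolding W_def using bR RP R
    by (intro polys_over_coeff[of _ "polys_over R"] subring_prod is_subring_polys_over)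
       (auto simp: polys_over_pCons_iff polys_over_0 subring_zero subring_one subring_uminus)
  \<comment> \<open>Rational coefficients are unchanged modulo \<open>M\<close> by the p-th power,
    so raising a coefficient of \<open>W\<close> to the p-th power merely substitutes X^p.\<close>
  have c: "ideal_cong ?P (coeff W k ^ p) (pcompose (coeff W k) ?T)" for k
    using WR polys_over_coeff[OF WR] rat by (intro poly_pow_cong rat_pow_cong) auto
  \<comment> \<open>A root may be zero, so the degrees need not be \<open>n\<close>; but a
    coefficient of \<open>b'\<close> is a power with positive exponent and vanishes with that of
    \<open>b id\<close>.\<close>
  have dle: "degree b' \<le> degree (b id)"
  proof (rule degree_le, intro allI impI)
    fix i assume "degree (b id) < i"
    then have "coeff (b id) i = 0" by (rule coeff_eq_0)
    then show "coeff b' i = 0" using p0 by (auto simp: coeff_b coeff_b' split: if_splits)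
  qed
  have bp: "ideal_cong ?P (b id ^ p) (pcompose b' ?T)"
    using bR[OF G(2)] by (intro poly_pow_cong dle)
      (use p0 in \<open>auto simp: coeff_b coeff_b' power_0_left intro: ideal_cong_refl[OF I]\<close>)
  have "poly W (b id) = 0"
    unfolding W_def poly_prod using G(1,2) by (intro prod_zero) auto
  then have z: "(\<Sum>k\<le>degree W. coeff W k * b id ^ k) = 0" by (simp add: poly_altdef)
  have pP: "of_nat p \<in> ?P"
    using pM ideal_zero[OF I] by (simp add: of_nat_poly polys_over_pCons_iff polys_over_0)
  have "ideal_cong ?P ((\<Sum>k\<le>degree W. coeff W k * b id ^ k) ^ p) (\<Sum>k\<le>degree W. (coeff W k * b id ^ k) ^ p)"
    using RP WR bR[OF G(2)]
    by (intro ideal_cong_sum_prime_power[OF RP IP p pP]) (auto intro: subring_intros)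
  moreover have "ideal_cong ?P (\<Sum>k\<le>degree W. (coeff W k * b id ^ k) ^ p)
    (\<Sum>k\<le>degree W. pcompose (coeff W k) ?T * pcompose b' ?T ^ k)"
  proof (rule ideal_cong_sum[OF IP])
    fix k
    have "ideal_cong ?P (coeff W k ^ p * (b id ^ p) ^ k) (pcompose (coeff W k) ?T * pcompose b' ?T ^ k)"
      using c bp RP WR bR[OF G(2)] b'R polys_over_pcompose_monom[OF R]
      by (intro ideal_cong_mult[OF IP] ideal_cong_power[OF RP IP]) (auto intro: subring_power)
    then show "ideal_cong ?P ((coeff W k * b id ^ k) ^ p) (pcompose (coeff W k) ?T * pcompose b' ?T ^ k)"
      by (simp add: power_mult_distrib power_mult[symmetric] mult.commute)
  qed
  moreover have "(\<Sum>k\<le>degree W. pcompose (coeff W k) ?T * pcompose b' ?T ^ k) = pcompose (poly W b') ?T"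
  proof -
    have "pcompose (f ^ k) ?T = pcompose f ?T ^ k" for f k
      by (induction k) (auto simp: pcompose_1 pcompose_mult)
    then show ?thesis by (simp add: poly_altdef pcompose_sum pcompose_mult)
  qed
  \<comment> \<open>The p-th power of W(b) = 0 has become W(b') evaluated at X^p.\<close>
  ultimately have "ideal_cong ?P (0 ^ p) (pcompose (poly W b') ?T)"
    unfolding z by (simp only: ideal_cong_trans[OF IP])
  then have "pcompose (poly W b') ?T \<in> ?P"
    using ideal_cong_mem[OF IP] ideal_zero[OF IP] p0 by (simp add: power_0_left)
  then have "coeff (poly W b') i \<in> M" for i
    unfolding coeff_pcompose_monom[OF p0, of "poly W b'" i, symmetric] by (rule polys_over_coeff)
  then have "poly W b' \<in> ?P" by (simp add: polys_over_def)
  \<comment> \<open>Evaluated at \<open>b'\<close>, \<open>W\<close> is a product in the polynomial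
    ring over \<open>R\<close>. Primality there puts one whole factor into the ideal, so a single
    permutation works for all indices at once.\<close>
  then have "(\<Prod>\<pi>\<in>G. b' - b \<pi>) \<in> ?P" unfolding W_def poly_prod by simp
  then obtain \<pi> where "\<pi> \<in> G" "b' - b \<pi> \<in> ?P"
    using prime_ideal_prod[OF RP is_prime_ideal_polys_over[OF R M] G(1), of "\<lambda>\<pi>. b' - b \<pi>"]
      subring_diff[OF RP b'R bR] by auto
  then have "\<omega> i ^ p - \<omega> (\<pi> i) \<in> M" if "i \<in> {1..n}" for i
    using polys_over_coeff[of "b' - b \<pi>" M i] that by (simp add: coeff_b coeff_b')
  then show ?thesis using \<open>\<pi> \<in> G\<close> ideal_cong_sym[OF I] unfolding ideal_cong_def by blast
qed

end

subsection \<open>The Galois group of a monic integer polynomial\<close>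

lemma is_subring_Ints: "is_subring (\<int> :: 'a::comm_ring_1 set)"
  by (auto simp: is_subring_def)

lemma is_subfield_Rats: "is_subfield (\<rat> :: 'a::field_char_0 set)"
  by (auto simp: is_subring_def is_subfield_def)

lemma is_subfield_adjoin_list:
  assumes "is_subfield K" "\<And>x. x \<in> set xs \<Longrightarrow> algebraic_over K x"
  shows "is_subfield (adjoin_list K xs)"
  using assms
proof (induction xs arbitrary: K)
  case (Cons x xs)
  have "algebraic_over (adjoin K x) y" if "y \<in> set xs" for y
    using Cons.prems(2)[of y] that subset_adjoin[OF is_subfieldD[OF Cons.prems(1)], of x]
    by (auto intro: algebraic_over_mono[of K])
  then show ?case using Cons.IH[OF is_subfield_adjoin[OF Cons.prems(1)]] Cons.prems(2)[of x] by auto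
qed auto

lemma hom_on_of_int:
  assumes "is_subring R" "hom_on R \<sigma>"
  shows "\<sigma> (of_int k) = of_int k"
proof -
  have n: "\<sigma> (of_nat m) = of_nat m" for m
  proof (induction m)
    case (Suc m)
    have "\<sigma> (1 + of_nat m) = \<sigma> 1 + \<sigma> (of_nat m)"
      using assms subring_one[OF assms(1)] subring_of_nat[OF assms(1), of m] unfolding hom_on_def by blast
    with Suc assms(2) show ?case by (simp add: hom_on_def)
  qed (use hom_on_zero[OF assms] in simp)
  show ?thesis
    by (cases k rule: int_cases2) (use hom_on_uminus[OF assms subring_of_nat[OF assms(1)]] n in auto)
qed

lemma hom_on_Rats:
  fixes \<sigma> :: "'a::field_char_0 \<Rightarrow> 'a"
  assumes "is_subring R" "hom_on R \<sigma>" "\<rat> \<subseteq> R" "q \<in> \<rat>"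
  shows "\<sigma> q = q"
proof -
  obtain u v where uv: "v > 0" "q = of_int u / of_int v"
    using Rats_cases'[OF assms(4)] by metis
  have e: "of_int v * q = of_int u" using uv by simp
  have "\<sigma> (of_int v * q) = \<sigma> (of_int v) * \<sigma> q"
    using assms subring_of_int[OF assms(1), of v] unfolding hom_on_def by blast
  then have "of_int v * q = of_int v * \<sigma> q"
    unfolding e hom_on_of_int[OF assms(1,2)] .
  then show ?thesis using uv(1) by simp
qed

lemma hom_on_map_poly:
  assumes "is_subring R" "hom_on R \<sigma>"
  shows "hom_on (polys_over R) (map_poly \<sigma>)"
  using assms hom_on_zero[OF assms]
  by (auto simp: hom_on_def[of "polys_over R"] map_poly_hom_add map_poly_hom_mult map_poly_1 hom_on_def)

lemma hom_on_prod:
  assumes "is_subring R" "hom_on R \<sigma>" "\<And>i. i \<in> I \<Longrightarrow> f i \<in> R"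
  shows "\<sigma> (prod f I) = (\<Prod>i\<in>I. \<sigma> (f i))"
  using assms(3)
proof (induction I rule: infinite_finite_induct)
  case (insert i I)
  have "\<sigma> (f i * prod f I) = \<sigma> (f i) * \<sigma> (prod f I)"
    using assms(1,2) insert.prems subring_prod[OF assms(1), of I f] unfolding hom_on_def by blast
  with insert show ?case by simp
qed (use assms in \<open>auto simp: hom_on_def\<close>)

locale monic_int_poly =
  fixes n :: nat and \<omega> :: "nat \<Rightarrow> complex" and h :: "int poly"
  assumes monic: "lead_coeff h = 1"
    and inj: "inj_on \<omega> {1..n}"
    and factor: "map_poly of_int h = (\<Prod>i=1..n. [:- \<omega> i, 1:])"
begin

definition L :: "complex set" where "L = adjoin_list \<rat> (map \<omega> [1..<Suc n])"

definition G :: "(nat \<Rightarrow> nat) set" where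
  "G = {\<pi>. \<pi> permutes {1..n} \<and>
     (\<exists>\<sigma> :: complex \<Rightarrow> complex. hom_on L \<sigma> \<and> (\<forall>i\<in>{1..n}. \<sigma> (\<omega> i) = \<omega> (\<pi> i)))}"

lemma set_roots: "set (map \<omega> [1..<Suc n]) = \<omega> ` {1..n}"
  by (simp add: atLeastLessThanSuc_atLeastAtMost del: upt_Suc)

lemma poly_eq_0_iff: "poly (map_poly of_int h) x = 0 \<longleftrightarrow> x \<in> \<omega> ` {1..n}"
  unfolding factor poly_prod by (auto simp: eq_neg_iff_add_eq_0 neg_eq_iff_add_eq_0 add.commute)

lemma polys_over_h: "is_subring R \<Longrightarrow> map_poly of_int h \<in> polys_over R"
  by (auto simp: polys_over_def coeff_map_poly subring_of_int)

lemma algebraic_roots: "x \<in> set (map \<omega> [1..<Suc n]) \<Longrightarrow> algebraic_over \<rat> x"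
  unfolding set_roots algebraic_over_def
  using poly_eq_0_iff monic polys_over_h[OF is_subfieldD[OF is_subfield_Rats]]
  by (intro bexI[of _ "map_poly of_int h"]) (auto simp: map_poly_eq_0_iff)

lemma subfield_L: "is_subfield L"
  unfolding L_def by (rule is_subfield_adjoin_list[OF is_subfield_Rats algebraic_roots])

lemma subring_L: "is_subring L"
  using subfield_L by (rule is_subfieldD)

lemma Rats_subset_L: "\<rat> \<subseteq> L"
  unfolding L_def by (rule subset_adjoin_list[OF is_subfieldD[OF is_subfield_Rats]])

lemma root_in_L: "i \<in> {1..n} \<Longrightarrow> \<omega> i \<in> L"
  unfolding L_def by (rule mem_adjoin_list[OF is_subfieldD[OF is_subfield_Rats]]) (use set_roots in auto)

lemma hom_on_L_Rats: "hom_on L \<sigma> \<Longrightarrow> q \<in> \<rat> \<Longrightarrow> \<sigma> q = q"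
  using hom_on_Rats[OF subring_L _ Rats_subset_L] .

text \<open>An embedding fixes the integer coefficients of \<open>h\<close>, so it maps roots to
  roots; injectivity on a finite set makes this a permutation.\<close>

lemma hom_on_L_perm:
  fixes \<sigma> :: "complex \<Rightarrow> complex"
  assumes \<sigma>: "hom_on L \<sigma>"
  shows "\<exists>\<pi>\<in>G. \<forall>i\<in>{1..n}. \<sigma> (\<omega> i) = \<omega> (\<pi> i)"
proof -
  have fix_h: "map_poly \<sigma> (map_poly of_int h) = map_poly of_int h"
    using hom_on_of_int[OF subring_L \<sigma>] hom_on_zero[OF subring_L \<sigma>]
    by (intro poly_eqI) (simp add: coeff_map_poly)
  have im: "\<sigma> (\<omega> i) \<in> \<omega> ` {1..n}" if i: "i \<in> {1..n}" for i
  proof -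
    have "poly (map_poly of_int h) (\<sigma> (\<omega> i)) = \<sigma> (poly (map_poly of_int h) (\<omega> i))"
      using hom_on_poly[OF subring_L \<sigma> polys_over_h[OF subring_L] root_in_L[OF i]] fix_h by simp
    also have "poly (map_poly of_int h) (\<omega> i) = 0" using poly_eq_0_iff i by blast
    finally show ?thesis using poly_eq_0_iff hom_on_zero[OF subring_L \<sigma>] by metis
  qed
  define \<pi> where "\<pi> i = (if i \<in> {1..n} then inv_into {1..n} \<omega> (\<sigma> (\<omega> i)) else i)" for i
  have \<pi>: "\<omega> (\<pi> i) = \<sigma> (\<omega> i)" "\<pi> i \<in> {1..n}" if i: "i \<in> {1..n}" for i
    using im[OF i] i unfolding \<pi>_def by (simp_all only: if_True f_inv_into_f inv_into_into)
  have "inj_on \<pi> {1..n}"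
  proof (rule inj_onI)
    fix i j assume ij: "i \<in> {1..n}" "j \<in> {1..n}" "\<pi> i = \<pi> j"
    then have "\<sigma> (\<omega> i) = \<sigma> (\<omega> j)" using \<pi>(1) by metis
    then have "\<omega> i = \<omega> j"
      using hom_on_inj[OF subfield_L \<sigma>] root_in_L ij by (auto dest: inj_onD)
    then show "i = j" using inj ij by (auto dest: inj_onD)
  qed
  then have "bij_betw \<pi> {1..n} {1..n}"
    using \<pi>(2) by (simp add: bij_betw_def endo_inj_surj image_subset_iff)
  then have "\<pi> permutes {1..n}" by (rule bij_imp_permutes) (auto simp: \<pi>_def)
  then have "\<pi> \<in> G" unfolding G_def using \<sigma> \<pi>(1) by auto
  then show ?thesis using \<pi>(1) by (intro bexI[of _ \<pi>] ballI) simp_all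
qed

text \<open>The elements of \<open>L\<close> whose image stays in \<open>L\<close> form a subring
  containing the rationals and the roots, and \<open>L\<close> is the least such subring.\<close>

lemma hom_on_L_range:
  fixes \<sigma> :: "complex \<Rightarrow> complex"
  assumes \<sigma>: "hom_on L \<sigma>" and x: "x \<in> L"
  shows "\<sigma> x \<in> L"
proof -
  let ?S = "{x \<in> L. \<sigma> x \<in> L}"
  have "is_subring ?S"
    unfolding is_subring_def
    using subring_L \<sigma> hom_on_diff[OF subring_L \<sigma>]
    by (auto simp: hom_on_def intro: subring_one subring_diff subring_mult)
  moreover have "\<rat> \<subseteq> ?S" using hom_on_L_Rats[OF \<sigma>] Rats_subset_L by auto
  moreover have "\<omega> i \<in> ?S" if i: "i \<in> {1..n}" for i
  proof -
    obtain \<pi> where "\<pi> \<in> G" "\<sigma> (\<omega> i) = \<omega> (\<pi> i)" using hom_on_L_perm[OF \<sigma>] i by blast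
    then show ?thesis using i root_in_L permutes_in_image[of \<pi> "{1..n}" i] by (auto simp: G_def)
  qed
  ultimately have "L \<subseteq> ?S" unfolding L_def
    by (intro adjoin_list_least) (unfold set_roots, auto)
  then show ?thesis using x by auto
qed

lemma G_permutes: "\<pi> \<in> G \<Longrightarrow> \<pi> permutes {1..n}"
  by (simp add: G_def)

lemma G_in: "\<pi> \<in> G \<Longrightarrow> i \<in> {1..n} \<Longrightarrow> \<pi> i \<in> {1..n}"
  using G_permutes permutes_in_image by metis

lemma finite_G: "finite G"
  by (rule finite_subset[OF _ finite_permutations[of "{1..n}"]]) (auto simp: G_def)

lemma id_in_G: "id \<in> G"
  unfolding G_def by (auto simp: hom_on_def permutes_id intro!: exI[of _ "\<lambda>x. x"])

lemma comp_in_G: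
  assumes "\<pi> \<in> G" "\<rho> \<in> G"
  shows "\<pi> \<circ> \<rho> \<in> G"
proof -
  obtain \<sigma> :: "complex \<Rightarrow> complex" where \<sigma>: "hom_on L \<sigma>" "\<forall>i\<in>{1..n}. \<sigma> (\<omega> i) = \<omega> (\<pi> i)"
    using assms(1) by (auto simp: G_def)
  obtain \<tau> :: "complex \<Rightarrow> complex" where \<tau>: "hom_on L \<tau>" "\<forall>i\<in>{1..n}. \<tau> (\<omega> i) = \<omega> (\<rho> i)"
    using assms(2) by (auto simp: G_def)
  have "hom_on L (\<sigma> \<circ> \<tau>)"
    using \<sigma>(1) \<tau>(1) hom_on_L_range[OF \<tau>(1)] by (simp add: hom_on_def)
  moreover have "\<forall>i\<in>{1..n}. (\<sigma> \<circ> \<tau>) (\<omega> i) = \<omega> ((\<pi> \<circ> \<rho>) i)"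
    using \<sigma>(2) \<tau>(2) G_in[OF assms(2)] by simp
  ultimately show ?thesis
    using assms permutes_compose unfolding G_def by blast
qed

lemma bij_comp_G:
  assumes "\<pi> \<in> G"
  shows "bij_betw (\<lambda>\<rho>. \<pi> \<circ> \<rho>) G G"
proof -
  have "inj \<pi>" using permutes_inj[OF G_permutes[OF assms]] .
  then have "inj_on (\<lambda>\<rho>. \<pi> \<circ> \<rho>) G" by (auto simp: inj_on_def fun_eq_iff)
  moreover have "(\<lambda>\<rho>. \<pi> \<circ> \<rho>) ` G \<subseteq> G" using comp_in_G[OF assms] by auto
  ultimately show ?thesis using finite_G by (simp add: bij_betw_def endo_inj_surj)
qed

text \<open>Left multiplication by \<open>\<pi>\<close> is a bijection of the finite set
  \<open>G\<close>, so it hits the identity; no embedding has to be inverted.\<close>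

lemma inv_in_G:
  assumes "\<pi> \<in> G"
  shows "inv_into UNIV \<pi> \<in> G"
proof -
  obtain \<rho> where "\<rho> \<in> G" "id = \<pi> \<circ> \<rho>"
    using bij_comp_G[OF assms] id_in_G unfolding bij_betw_def by (metis imageE)
  then show ?thesis
    using permutes_inj[OF G_permutes[OF assms]] by (metis inv_o_cancel o_assoc comp_id id_comp)
qed

lemma funpow_in_G: "\<pi> \<in> G \<Longrightarrow> \<pi> ^^ k \<in> G"
  by (induction k) (auto intro: comp_in_G id_in_G[unfolded id_def] simp: id_in_G)

text \<open>Applied to the coefficients, an embedding with permutation \<open>\<rho>\<close>
  replaces each factor for \<open>\<pi>\<close> by the one for \<open>\<rho> \<circ> \<pi>\<close>.
  The product is unchanged, so its coefficients are fixed by all embeddings and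
  \<open>fixed_field\<close> applies. This is the rationality hypothesis of
  \<open>exists_frobenius\<close>.\<close>

lemma rational_conjugates:
  defines "b \<equiv> \<lambda>\<pi>. \<Sum>i=1..n. monom (\<omega> (\<pi> i)) i"
  shows "coeff (coeff (\<Prod>\<pi>\<in>G. [:- b \<pi>, 1:]) k) j \<in> \<rat>"
proof -
  let ?W = "\<Prod>\<pi>\<in>G. [:- b \<pi>, 1:]"
  note RP = is_subring_polys_over[OF subring_L]
  note RPP = is_subring_polys_over[OF RP]
  have coeff_b: "coeff (b \<pi>) i = (if i \<in> {1..n} then \<omega> (\<pi> i) else 0)" for \<pi> i
    unfolding b_def coeff_sum by (auto simp: coeff_monom)
  have bL: "b \<pi> \<in> polys_over L" if "\<pi> \<in> G" for \<pi>
    using G_in[OF that] root_in_L subring_zero[OF subring_L] by (auto simp: polys_over_def coeff_b)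
  have fL: "[:- b \<pi>, 1:] \<in> polys_over (polys_over L)" if "\<pi> \<in> G" for \<pi>
    using bL[OF that] RP by (auto simp: polys_over_pCons_iff polys_over_0 subring_zero subring_one subring_uminus)
  have WL: "coeff (coeff ?W k) j \<in> L"
    using fL RPP by (intro polys_over_coeff[of _ L] polys_over_coeff[of _ "polys_over L"] subring_prod)
  have fixed: "\<sigma> (coeff (coeff ?W k) j) = coeff (coeff ?W k) j" if \<sigma>: "hom_on L \<sigma>" for \<sigma> :: "complex \<Rightarrow> complex"
  proof -
    obtain \<rho> where \<rho>: "\<rho> \<in> G" "\<forall>i\<in>{1..n}. \<sigma> (\<omega> i) = \<omega> (\<rho> i)" using hom_on_L_perm[OF \<sigma>] by blast
    note s0 = hom_on_zero[OF subring_L \<sigma>]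
    have s1: "\<sigma> 1 = 1" using \<sigma> by (simp add: hom_on_def)
    have "map_poly \<sigma> (b \<pi>) = b (\<rho> \<circ> \<pi>)" if "\<pi> \<in> G" for \<pi>
      using \<rho> G_in[OF that] by (intro poly_eqI) (simp add: coeff_map_poly s0 coeff_b)
    then have m: "map_poly (map_poly \<sigma>) [:- b \<pi>, 1:] = [:- b (\<rho> \<circ> \<pi>), 1:]" if "\<pi> \<in> G" for \<pi>
      using that hom_on_uminus[OF RP hom_on_map_poly[OF subring_L \<sigma>] bL[OF that]]
      by (simp add: map_poly_pCons map_poly_1 s1)
    have "map_poly (map_poly \<sigma>) ?W = (\<Prod>\<pi>\<in>G. map_poly (map_poly \<sigma>) [:- b \<pi>, 1:])"
      by (rule hom_on_prod[OF RPP hom_on_map_poly[OF RP hom_on_map_poly[OF subring_L \<sigma>]]]) (rule fL)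
    also have "\<dots> = (\<Prod>\<pi>\<in>G. [:- b (\<rho> \<circ> \<pi>), 1:])" using m by (rule prod.cong[OF refl])
    also have "\<dots> = ?W"
      by (rule prod.reindex_bij_betw[OF bij_comp_G[OF \<rho>(1)], of "\<lambda>\<pi>. [:- b \<pi>, 1:]"])
    finally have "coeff (coeff (map_poly (map_poly \<sigma>) ?W) k) j = coeff (coeff ?W k) j" by simp
    then show ?thesis by (simp add: coeff_map_poly s0)
  qed
  show ?thesis
  proof (rule fixed_field[OF is_subfield_Rats _ WL[unfolded L_def]])
    show "algebraic_over \<rat> x" if "x \<in> set (map \<omega> [1..<Suc n])" for x
      using that by (rule algebraic_roots)
  qed (rule fixed[unfolded L_def])
qed

text \<open>The ring generated by the roots over the integers has bounded denominators because
  \<open>h\<close> is monic; hence p is not a unit in it and lies in a prime ideal.\<close>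

lemma exists_frobenius_G:
  assumes p: "prime p"
  shows "\<exists>R M \<pi>. prime_over R M p \<and> (\<forall>i\<in>{1..n}. \<omega> i \<in> R) \<and> \<pi> \<in> G \<and>
           (\<forall>i\<in>{1..n}. ideal_cong M (\<omega> (\<pi> i)) (\<omega> i ^ p))"
proof -
  define R where "R = adjoin_list \<int> (map \<omega> [1..<Suc n])"
  have R: "is_subring R" unfolding R_def by (rule is_subring_adjoin_list[OF is_subring_Ints])
  have \<omega>R: "\<omega> i \<in> R" if "i \<in> {1..n}" for i
    unfolding R_def by (rule mem_adjoin_list[OF is_subring_Ints]) (use that set_roots in auto)
  have "bounded_denominators R"
    unfolding R_def
  proof (rule bounded_denominators_adjoin_list[OF is_subring_Ints bounded_denominators_Ints])
    fix x assume "x \<in> set (map \<omega> [1..<Suc n])"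
    then have "poly (map_poly of_int h) x = 0" using poly_eq_0_iff set_roots by blast
    moreover have "lead_coeff (map_poly of_int h :: complex poly) = 1"
      using monic by (simp add: degree_map_poly coeff_map_poly)
    ultimately show "\<exists>m\<in>polys_over \<int>. lead_coeff m = 1 \<and> poly m x = 0"
      using polys_over_h[OF is_subring_Ints] by blast
  qed
  then obtain M where M: "is_prime_ideal R M" "of_nat p \<in> M"
    using exists_prime_ideal[OF R subring_of_nat[OF R, of p]] bounded_denominators_not_unit[OF R]
      prime_ge_2_nat[OF p] by blast
  interpret prime_over R M p using R M p by unfold_locales
  have "\<exists>\<pi>\<in>G. \<forall>i\<in>{1..n}. ideal_cong M (\<omega> (\<pi> i)) (\<omega> i ^ p)"
  proof (rule exists_frobenius[OF finite_G id_in_G])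
    show "\<pi> i \<in> {1..n}" if "\<pi> \<in> G" "i \<in> {1..n}" for \<pi> i using that by (rule G_in)
  qed (rule \<omega>R rational_conjugates, assumption?)+
  then show ?thesis using prime_over_axioms \<omega>R by blast
qed

end

subsection \<open>Cycle types of Frobenius elements\<close>

lemma hom_on_of_int_UNIV: "hom_on UNIV (of_int :: int \<Rightarrow> 'a::comm_ring_1)"
  by (simp add: hom_on_def)

lemma is_subring_UNIV: "is_subring UNIV"
  by (simp add: is_subring_def)

lemma of_int_poly_mult:
  "map_poly of_int (f * g) = (map_poly of_int f * map_poly of_int g :: 'a::comm_ring_1 poly)"
  by (rule map_poly_hom_mult[OF is_subring_UNIV hom_on_of_int_UNIV]) (auto simp: polys_over_def)

lemma of_int_poly_prod:
  "map_poly of_int (prod f I) = (\<Prod>i\<in>I. map_poly of_int (f i) :: 'a::comm_ring_1 poly)"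
  by (induction I rule: infinite_finite_induct) (auto simp: of_int_poly_mult map_poly_1)

lemma of_int_poly_diff:
  "map_poly of_int (f - g) = (map_poly of_int f - map_poly of_int g :: 'a::comm_ring_1 poly)"
  by (rule poly_eqI) (simp add: coeff_map_poly)

lemma of_int_poly_pderiv:
  "map_poly of_int (pderiv f) = (pderiv (map_poly of_int f) :: 'a::idom poly)"
  by (rule poly_eqI) (simp add: coeff_map_poly coeff_pderiv)

lemma poly_ideal_cong:
  assumes "is_subring R" "is_ideal R J" "f \<in> polys_over R" "x \<in> R" "y \<in> R" "ideal_cong J x y"
  shows "ideal_cong J (poly f x) (poly f y)"
  unfolding poly_altdef using assms
  by (intro ideal_cong_sum[of R] ideal_cong_mult[of R] ideal_cong_power[of R] ideal_cong_refl[of R]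
      subring_power polys_over_coeff)

text \<open>
  The power \<open>g\<^bsup>(p - 1) / d\<^esup>\<close> has order exactly \<open>d\<close> modulo \<open>p\<close>. Hence the \<open>p\<close>-th power map multiplies a root of
  \<open>X\<^sup>d - g\<close> by a primitive \<open>d\<close>-th root of unity and permutes the \<open>d\<close> roots in a single cycle.
\<close>

definition primitive_residue :: "nat \<Rightarrow> nat \<Rightarrow> int \<Rightarrow> bool" where
  "primitive_residue p d g \<longleftrightarrow> d dvd p - 1 \<and> \<not> int p dvd g \<and>
     (\<forall>j. 0 < j \<and> j < d \<longrightarrow> \<not> int p dvd (g ^ ((p - 1) div d)) ^ j - 1)"

text \<open>\<open>k\<close> is a model of \<open>h\<close> modulo \<open>p\<close> with known
  factorisation, from which the action of \<open>\<pi>\<close> is read off.\<close>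

locale frobenius_element = monic_int_poly n \<omega> h + prime_over R M p
  for n \<omega> h R M p +
  fixes \<pi> :: "nat \<Rightarrow> nat" and k :: "int poly"
  assumes root_R: "i \<in> {1..n} \<Longrightarrow> \<omega> i \<in> R"
    and \<pi>: "\<pi> \<in> G"
    and frob: "i \<in> {1..n} \<Longrightarrow> ideal_cong M (\<omega> (\<pi> i)) (\<omega> i ^ p)"
    and reduction: "int p dvd coeff h j - coeff k j"
begin

lemma poly_in_M:
  assumes "\<And>j. int p dvd coeff f j" "x \<in> R"
  shows "poly (map_poly of_int f) x \<in> M"
proof -
  have "coeff (map_poly of_int f) j * x ^ j \<in> M" for j
    using assms R of_int_mem_iff
    by (intro ideal_mult_right[OF I] subring_power[OF R]) (auto simp: coeff_map_poly)
  then show ?thesis unfolding poly_altdef by (intro ideal_sum[OF I])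
qed

lemma poly_h_cong:
  assumes "x \<in> R"
  shows "ideal_cong M (poly (map_poly of_int h) x) (poly (map_poly of_int k) x)"
  using poly_in_M[of "h - k" x] assms reduction by (simp add: ideal_cong_def of_int_poly_diff)

lemma poly_pderiv_h_cong:
  assumes "x \<in> R"
  shows "ideal_cong M (poly (pderiv (map_poly of_int h)) x) (poly (pderiv (map_poly of_int k)) x)"
proof -
  have "int p dvd coeff (pderiv (h - k)) j" for j
    using reduction by (simp add: coeff_pderiv)
  from poly_in_M[of "pderiv (h - k)" x, OF this assms] show ?thesis
    by (simp add: ideal_cong_def of_int_poly_diff of_int_poly_pderiv pderiv_diff)
qed

lemma root_k:
  assumes "i \<in> {1..n}"
  shows "poly (map_poly of_int k) (\<omega> i) \<in> M"
proof -
  have "poly (map_poly of_int h) (\<omega> i) = 0" using poly_eq_0_iff assms by blast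
  then have "poly (map_poly of_int h) (\<omega> i) \<in> M" using ideal_zero[OF I] by simp
  then show ?thesis using ideal_cong_mem[OF I poly_h_cong[OF root_R[OF assms]]] by blast
qed

text \<open>At \<open>c\<close> the polynomial \<open>h\<close> is the product of the differences
  \<open>c - \<omega> i\<close>; if it lies in the prime ideal, so does one difference.\<close>

lemma root_k_lift:
  assumes "c \<in> R" "poly (map_poly of_int k) c \<in> M"
  shows "\<exists>i\<in>{1..n}. ideal_cong M (\<omega> i) c"
proof -
  have "poly (map_poly of_int h) c \<in> M"
    using ideal_cong_mem[OF I poly_h_cong[OF assms(1)]] assms(2) by blast
  then have "(\<Prod>i=1..n. c - \<omega> i) \<in> M" by (simp add: factor poly_prod)
  then obtain i where "i \<in> {1..n}" "c - \<omega> i \<in> M"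
    using prime_ideal_prod[OF R M, of "{1..n}" "\<lambda>i. c - \<omega> i"] assms(1) root_R subring_diff[OF R] by auto
  then show ?thesis using ideal_cong_sym[OF I] unfolding ideal_cong_def by blast
qed

text \<open>Used contrapositively, to see that roots do not collide modulo \<open>M\<close>. The
  derivative of \<open>h\<close> at a root is the product of its differences to the other roots, one
  of which lies in \<open>M\<close>.\<close>

lemma pderiv_k_mem:
  assumes i: "i \<in> {1..n}" and j: "j \<in> {1..n}" "i \<noteq> j" and c: "ideal_cong M (\<omega> i) (\<omega> j)"
  shows "poly (pderiv (map_poly of_int k)) (\<omega> i) \<in> M"
proof -
  let ?Q = "\<Prod>l\<in>{1..n} - {i}. [:- \<omega> l, 1:]"
  have "map_poly of_int h = [:- \<omega> i, 1:] * ?Q"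
    unfolding factor using i by (simp add: prod.remove)
  then have "poly (pderiv (map_poly of_int h)) (\<omega> i) = poly ?Q (\<omega> i)"
    by (simp only: pderiv_mult) (simp add: pderiv_pCons)
  also have "\<dots> = (\<Prod>l\<in>{1..n} - {i}. \<omega> i - \<omega> l)" by (simp add: poly_prod)
  also have "\<dots> = (\<omega> i - \<omega> j) * (\<Prod>l\<in>{1..n} - {i} - {j}. \<omega> i - \<omega> l)"
    using j by (intro prod.remove) auto
  also have "\<dots> \<in> M"
    using c i root_R subring_diff[OF R]
    by (intro ideal_mult_right[OF I] subring_prod[OF R]) (auto simp: ideal_cong_def)
  finally show ?thesis using ideal_cong_mem[OF I poly_pderiv_h_cong[OF root_R[OF i]]] by blast
qed

lemma funpow_in: "i \<in> {1..n} \<Longrightarrow> (\<pi> ^^ m) i \<in> {1..n}"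
  using G_in[OF funpow_in_G[OF \<pi>]] .

text \<open>With z = g^((p-1)/d), one application of Frobenius multiplies a root of X^d - g by z,
  because p = 1 + d ((p-1)/d). The factor z^m gathered so far is an integer and survives the p-th
  power by Fermat.\<close>

lemma funpow_cong:
  assumes i: "i \<in> {1..n}" and g: "ideal_cong M (\<omega> i ^ d) (of_int g)" and d: "d dvd p - 1"
  shows "ideal_cong M (\<omega> ((\<pi> ^^ m) i)) (of_int ((g ^ ((p - 1) div d)) ^ m) * \<omega> i)"
proof (induction m)
  case 0
  then show ?case by (simp add: ideal_cong_refl[OF I])
next
  case (Suc m)
  let ?e = "(p - 1) div d"
  let ?z = "g ^ ?e"
  note R_intros = root_R[OF i] root_R[OF funpow_in[OF i]] subring_of_int[OF R]
    subring_mult[OF R] subring_power[OF R]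
  have p0: "p = Suc (d * ?e)" using prime_gt_0_nat[OF p] d by simp
  have "ideal_cong M (\<omega> i ^ p) (\<omega> i * of_int ?z)"
  proof -
    have "\<omega> i ^ p = \<omega> i * (\<omega> i ^ d) ^ ?e" by (subst p0) (simp add: power_mult)
    moreover have "ideal_cong M (\<omega> i * (\<omega> i ^ d) ^ ?e) (\<omega> i * of_int g ^ ?e)"
      using g by (intro ideal_cong_mult[OF I] ideal_cong_power[OF R I] ideal_cong_refl[OF I] R_intros)
    ultimately show ?thesis by simp
  qed
  moreover have "ideal_cong M (of_int ((?z ^ m) ^ p)) (of_int (?z ^ m))"
    using int_fermat[OF p, of "?z ^ m"] of_int_mem_iff unfolding ideal_cong_def of_int_diff[symmetric] by blast
  ultimately have "ideal_cong M (of_int ((?z ^ m) ^ p) * \<omega> i ^ p) (of_int (?z ^ m) * (\<omega> i * of_int ?z))"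
    by (intro ideal_cong_mult[OF I] R_intros)
  moreover have "ideal_cong M (\<omega> ((\<pi> ^^ m) i) ^ p) ((of_int (?z ^ m) * \<omega> i) ^ p)"
    using Suc by (intro ideal_cong_power[OF R I] R_intros)
  moreover have "ideal_cong M (\<omega> (\<pi> ((\<pi> ^^ m) i))) (\<omega> ((\<pi> ^^ m) i) ^ p)"
    using frob[OF funpow_in[OF i]] .
  ultimately have "ideal_cong M (\<omega> (\<pi> ((\<pi> ^^ m) i))) (of_int (?z ^ m) * (\<omega> i * of_int ?z))"
    using ideal_cong_trans[OF I] by (metis of_int_power power_mult_distrib)
  then show ?case by (simp add: algebra_simps)
qed

text \<open>A coincidence of the iterates a < b puts z^a (z^(b-a) - 1) \<open>\<omega> i\<close>
  into \<open>M\<close>. Since g is not in \<open>M\<close>, neither are z^a and the root, so p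
  divides z^(b-a) - 1 with 0 < b - a < d.\<close>

lemma funpow_inj:
  assumes i: "i \<in> {1..n}" and g: "ideal_cong M (\<omega> i ^ d) (of_int g)" and pr: "primitive_residue p d g"
  shows "inj_on (\<lambda>m. (\<pi> ^^ m) i) {..<d}"
proof (rule linorder_inj_onI)
  fix a b assume ab: "a < b" "a \<in> {..<d}" "b \<in> {..<d}"
  let ?z = "g ^ ((p - 1) div d)"
  have d: "d dvd p - 1" "\<not> int p dvd g" using pr by (auto simp: primitive_residue_def)
  have gM: "of_int g \<notin> M" using d(2) of_int_mem_iff by blast
  have "d > 0" using ab by auto
  then have iM: "\<omega> i \<notin> M"
    using gM ideal_cong_mem[OF I g] ideal_mult_right[OF I subring_power[OF R root_R[OF i]], of "\<omega> i" "d - 1"]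
    by (metis power_eq_if neq0_conv)
  show "(\<pi> ^^ a) i \<noteq> (\<pi> ^^ b) i"
  proof
    assume "(\<pi> ^^ a) i = (\<pi> ^^ b) i"
    then have "ideal_cong M (of_int (?z ^ b) * \<omega> i) (of_int (?z ^ a) * \<omega> i)"
      using funpow_cong[OF i g d(1), of a] funpow_cong[OF i g d(1), of b]
        ideal_cong_trans[OF I] ideal_cong_sym[OF I] by metis
    moreover have "of_int (?z ^ b) * \<omega> i - of_int (?z ^ a) * \<omega> i = of_int (?z ^ a) * (of_int (?z ^ (b - a) - 1) * \<omega> i)"
    proof -
      have "?z ^ b = ?z ^ a * ?z ^ (b - a)" using ab by (simp flip: power_add)
      then show ?thesis by (simp only: of_int_mult of_int_diff) (simp add: algebra_simps)
    qed
    ultimately have "of_int (?z ^ a) * (of_int (?z ^ (b - a) - 1) * \<omega> i) \<in> M"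
      by (simp add: ideal_cong_def)
    then have "of_int (?z ^ a) \<in> M \<or> of_int (?z ^ (b - a) - 1) \<in> M"
      using M iM root_R[OF i] R unfolding is_prime_ideal_def
      by (metis subring_mult subring_of_int)
    moreover have "of_int (?z ^ a) \<notin> M"
      using gM prime_ideal_power[OF R M subring_of_int[OF R]] by (metis of_int_power power_mult)
    ultimately have "int p dvd ?z ^ (b - a) - 1" using of_int_mem_iff by blast
    then show False using pr ab by (auto simp: primitive_residue_def)
  qed
qed auto

text \<open>Modulo \<open>M\<close> all roots satisfy x^n = g, so any index has \<open>n\<close>
  distinct iterates under \<open>\<pi>\<close>, which exhaust the indices.\<close>

lemma transitive:
  assumes k: "k = monom 1 n - [:g:]" and g: "primitive_residue p n g"
    and i: "i \<in> {1..n}" and j: "j \<in> {1..n}"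
  shows "\<exists>\<rho>\<in>G. \<rho> i = j"
proof -
  have "poly (map_poly of_int k) (\<omega> i) = \<omega> i ^ n - of_int g"
    by (simp add: k of_int_poly_diff map_poly_monom map_poly_pCons poly_monom)
  then have "ideal_cong M (\<omega> i ^ n) (of_int g)"
    using root_k[OF i] by (simp add: ideal_cong_def)
  from funpow_inj[OF i this g] have "card ((\<lambda>m. (\<pi> ^^ m) i) ` {..<n}) = card {1..n}"
    by (simp add: card_image)
  then have "(\<lambda>m. (\<pi> ^^ m) i) ` {..<n} = {1..n}"
    using funpow_in[OF i] by (intro card_subset_eq) auto
  then obtain m where "j = (\<pi> ^^ m) i" using j by blast
  then show ?thesis using funpow_in_G[OF \<pi>] by blast
qed

text \<open>Modulo \<open>M\<close> the polynomial is X (X^(n-1) - g). Its derivative at 0 is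
  congruent to -g when n > 2 and, for n = 2, equals -g too, so exactly one root \<open>r\<close> is
  zero modulo \<open>M\<close> and Frobenius fixes it. The other roots satisfy x^(n-1) = g and form
  one orbit of length \<open>n - 1\<close>.\<close>

lemma stabilizer_transitive:
  assumes n: "n \<ge> 2" and k: "k = monom 1 n - monom g 1" and g: "primitive_residue p (n - 1) g"
  shows "\<exists>r\<in>{1..n}. \<forall>i\<in>{1..n} - {r}. \<forall>j\<in>{1..n} - {r}. \<exists>\<rho>\<in>G. \<rho> r = r \<and> \<rho> i = j"
proof -
  have gM: "of_int g \<notin> M" using g of_int_mem_iff by (auto simp: primitive_residue_def)
  have ev: "poly (map_poly of_int k) x = x * (x ^ (n - 1) - of_int g)" for x :: complex
    using n by (simp add: k of_int_poly_diff map_poly_monom poly_monom algebra_simps flip: power_Suc)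
  obtain r where r: "r \<in> {1..n}" "\<omega> r \<in> M"
    using root_k_lift[OF subring_zero[OF R]] ideal_zero[OF I] by (auto simp: ev ideal_cong_def)
  have uniq: "i = r" if i: "i \<in> {1..n}" "\<omega> i \<in> M" for i
  proof (rule ccontr)
    assume "i \<noteq> r"
    have "poly (pderiv (map_poly of_int k)) (\<omega> i) \<in> M"
      using pderiv_k_mem[OF i(1) r(1) \<open>i \<noteq> r\<close>] ideal_diff[OF I i(2) r(2)] by (simp add: ideal_cong_def)
    then have pd: "of_nat n * \<omega> i ^ (n - 1) - of_int g \<in> M"
      by (simp add: k of_int_poly_diff map_poly_monom pderiv_diff pderiv_monom poly_monom)
    have "\<omega> i ^ (n - 1) = \<omega> i ^ (n - 1 - 1) * \<omega> i"
      using n by (intro power_minus_mult[symmetric]) simp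
    then have "of_nat n * \<omega> i ^ (n - 1) \<in> M"
      using ideal_mult_left[OF I subring_of_nat[OF R]
          ideal_mult_left[OF I subring_power[OF R root_R[OF i(1)]] i(2)]] by simp
    from ideal_diff[OF I this pd] have "of_int g \<in> M" by simp
    then show False using gM by blast
  qed
  have "\<omega> r ^ p \<in> M"
    using ideal_mult_left[OF I subring_power[OF R root_R[OF r(1)]] r(2), of "p - 1"] prime_gt_0_nat[OF p]
    by (metis power_minus_mult)
  then have "\<omega> (\<pi> r) \<in> M" using ideal_cong_mem[OF I frob[OF r(1)]] by blast
  then have \<pi>r: "\<pi> r = r" using uniq G_in[OF \<pi> r(1)] by blast
  then have fr: "(\<pi> ^^ m) r = r" for m by (induction m) auto
  have "\<exists>\<rho>\<in>G. \<rho> r = r \<and> \<rho> i = j" if i: "i \<in> {1..n} - {r}" and j: "j \<in> {1..n} - {r}" for i j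
  proof -
    have i1: "i \<in> {1..n}" "i \<noteq> r" using i by auto
    have "\<omega> i * (\<omega> i ^ (n - 1) - of_int g) \<in> M" using root_k[OF i1(1)] by (simp add: ev)
    moreover have "\<omega> i ^ (n - 1) - of_int g \<in> R"
      using root_R[OF i1(1)] R by (auto intro: subring_intros)
    ultimately have "ideal_cong M (\<omega> i ^ (n - 1)) (of_int g)"
      using M uniq[OF i1(1)] i1(2) root_R[OF i1(1)] unfolding is_prime_ideal_def ideal_cong_def by blast
    from funpow_inj[OF i1(1) this g] have "card ((\<lambda>m. (\<pi> ^^ m) i) ` {..<n - 1}) = card ({1..n} - {r})"
      using r(1) by (simp add: card_image)
    moreover have "(\<pi> ^^ m) i \<noteq> r" for m
    proof
      assume "(\<pi> ^^ m) i = r"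
      then have "(\<pi> ^^ m) i = (\<pi> ^^ m) r" using fr by simp
      then show False
        using permutes_inj[OF G_permutes[OF funpow_in_G[OF \<pi>]]] i1(2) by (auto dest: injD)
    qed
    ultimately have "(\<lambda>m. (\<pi> ^^ m) i) ` {..<n - 1} = {1..n} - {r}"
      using funpow_in[OF i1(1)] by (intro card_subset_eq) auto
    then obtain m where "j = (\<pi> ^^ m) i" using j by blast
    then show ?thesis using funpow_in_G[OF \<pi>] fr by blast
  qed
  then show ?thesis using r(1) by blast
qed

text \<open>Roots congruent to the integers 1, ..., n - 2 are fixed by Frobenius, by Fermat. The two
  remaining ones are square roots of g modulo \<open>M\<close> and are moved, hence exchanged. The
  bound p > n keeps these integers nonzero and distinct modulo p.\<close>

lemma transposition:
  assumes n: "n \<ge> 2" and pn: "p > n"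
    and k: "k = [:- g, 0, 1:] * (\<Prod>c=1..n-2. [:- int c, 1:])" and g: "primitive_residue p 2 g"
  shows "\<exists>a\<in>{1..n}. \<exists>b\<in>{1..n}. a \<noteq> b \<and> Transposition.transpose a b \<in> G"
proof -
  let ?C = "{1..n-2}"
  have gM: "of_int g \<notin> M" using g of_int_mem_iff by (auto simp: primitive_residue_def)
  define Q where "Q = (\<Prod>c\<in>?C. [:- of_nat c, 1:] :: complex poly)"
  have mk: "map_poly of_int k = [:- of_int g, 0, 1:] * Q"
    unfolding k Q_def by (simp add: of_int_poly_mult of_int_poly_prod map_poly_pCons del: mult_pCons_left)
  have evQ: "poly Q x = (\<Prod>c\<in>?C. x - of_nat c)" for x
    unfolding Q_def by (simp add: poly_prod)
  have ev: "poly (map_poly of_int k) x = (x ^ 2 - of_int g) * (\<Prod>c\<in>?C. x - of_nat c)" for x :: complex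
    by (simp add: mk evQ power2_eq_square algebra_simps del: mult_pCons_left)
  have small: "of_nat c - of_nat c' \<notin> M" if "c \<in> ?C" "c' \<in> ?C" "c \<noteq> c'" for c c' :: nat
  proof
    assume "of_nat c - of_nat c' \<in> M"
    then have "int p dvd int c - int c'" using of_int_mem_iff[of "int c - int c'"] by simp
    then have "int p \<le> \<bar>int c - int c'\<bar>" using that(3) by (intro zdvd_imp_le) auto
    then show False using that pn by auto
  qed
  \<comment> \<open>If c^2 were congruent to g, then g^((p-1)/2) would be congruent to c^(p-1),
    hence to 1, which \<open>primitive_residue\<close> with d = 2 excludes at j = 1.\<close>
  have nonres: "of_nat c ^ 2 - of_int g \<notin> M" if c: "c \<in> ?C" for c :: nat
  proof
    assume a: "of_nat c ^ 2 - of_int g \<in> M"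
    let ?e = "(p - 1) div 2"
    have e: "2 * ?e = p - 1" using g by (simp add: primitive_residue_def)
    have "ideal_cong M ((of_nat c ^ 2) ^ ?e) (of_int g ^ ?e)"
      using a R by (intro ideal_cong_power[OF R I]) (auto simp: ideal_cong_def intro: subring_intros)
    then have "of_int (int c ^ (p - 1) - g ^ ?e) \<in> M"
      using e by (simp add: ideal_cong_def flip: power_mult)
    then have 1: "int p dvd int c ^ (p - 1) - g ^ ?e" using of_int_mem_iff by blast
    have "\<not> p dvd c" using c pn by (intro nat_dvd_not_less) auto
    then have "\<not> int p dvd int c" by (simp only: int_dvd_int_iff not_False_eq_True)
    moreover have "int p dvd int c * (int c ^ (p - 1) - 1)"
      using int_fermat[OF p, of "int c"] power_minus_mult[of p "int c"] prime_gt_0_nat[OF p]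
      by (simp add: algebra_simps)
    ultimately have "int p dvd int c ^ (p - 1) - 1"
      using p by (simp add: prime_dvd_mult_iff)
    from dvd_diff[OF this 1] have "int p dvd (g ^ ?e) ^ 1 - 1" by simp
    moreover have "\<not> int p dvd (g ^ ?e) ^ 1 - 1"
      using g[unfolded primitive_residue_def, THEN conjunct2, THEN conjunct2, rule_format, of 1] by simp
    ultimately show False by contradiction
  qed
  have "\<exists>i\<in>{1..n}. ideal_cong M (\<omega> i) (of_nat c)" if c: "c \<in> ?C" for c :: nat
  proof (rule root_k_lift[OF subring_of_nat[OF R]])
    have z: "(\<Prod>c'\<in>?C. of_nat c - of_nat c' :: complex) = 0" using c by (intro prod_zero) auto
    show "poly (map_poly of_int k) (of_nat c :: complex) \<in> M"
      unfolding ev z using ideal_zero[OF I] by simp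
  qed
  then obtain f where f: "\<And>c. c \<in> ?C \<Longrightarrow> f c \<in> {1..n}" "\<And>c. c \<in> ?C \<Longrightarrow> ideal_cong M (\<omega> (f c)) (of_nat c)"
    by metis
  \<comment> \<open>c is a simple zero modulo \<open>M\<close>: after splitting off X - c, the
    cofactor \<open>?S\<close> at c is the nonresidue factor times differences of distinct small
    integers, none of which lies in \<open>M\<close>.\<close>
  have uniq: "i = f c" if i: "i \<in> {1..n}" and c: "c \<in> ?C" and cong: "ideal_cong M (\<omega> i) (of_nat c)" for i c
  proof (rule ccontr)
    assume "i \<noteq> f c"
    moreover have "ideal_cong M (\<omega> i) (\<omega> (f c))"
      using cong f(2)[OF c] ideal_cong_trans[OF I] ideal_cong_sym[OF I] by blast
    ultimately have "poly (pderiv (map_poly of_int k)) (\<omega> i) \<in> M"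
      by (intro pderiv_k_mem[OF i f(1)[OF c]])
    let ?Q' = "\<Prod>l\<in>?C - {c}. [:- of_nat l, 1:] :: complex poly"
    let ?S = "[:- of_int g, 0, 1:] * ?Q'"
    have "map_poly of_int k = [:- of_nat c, 1:] * ?S"
    proof -
      have "Q = [:- of_nat c, 1:] * ?Q'" unfolding Q_def using c by (intro prod.remove) auto
      then show ?thesis unfolding mk by (simp only: mult.left_commute)
    qed
    then have pd: "pderiv (map_poly of_int k) = [:- of_nat c, 1:] * pderiv ?S + ?S"
      by (simp only: pderiv_mult) (simp add: pderiv_pCons)
    have SR: "?S \<in> polys_over R"
      using R is_subring_polys_over[OF R]
      by (intro subring_mult[OF is_subring_polys_over[OF R]] subring_prod)
         (auto simp: polys_over_pCons_iff polys_over_0 intro!: subring_intros)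
    have "(\<omega> i - of_nat c) * poly (pderiv ?S) (\<omega> i) \<in> M"
      using cong SR root_R[OF i] R
      by (intro ideal_mult_right[OF I] subring_poly polys_over_pderiv) (auto simp: ideal_cong_def)
    moreover have "(\<omega> i - of_nat c) * poly (pderiv ?S) (\<omega> i) + poly ?S (\<omega> i) \<in> M"
      using \<open>poly (pderiv (map_poly of_int k)) (\<omega> i) \<in> M\<close> unfolding pd by (simp add: algebra_simps)
    ultimately have "poly ?S (\<omega> i) \<in> M" using ideal_diff[OF I] by (metis add_diff_cancel_left')
    moreover have "ideal_cong M (poly ?S (\<omega> i)) (poly ?S (of_nat c))"
      using cong by (intro poly_ideal_cong[OF R I SR] root_R[OF i] subring_of_nat[OF R])
    ultimately have "poly ?S (of_nat c) \<in> M" using ideal_cong_mem[OF I] by blast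
    moreover have "poly ?S (of_nat c) = (of_nat c ^ 2 - of_int g) * (\<Prod>l\<in>?C - {c}. of_nat c - of_nat l)"
      by (simp add: poly_prod power2_eq_square algebra_simps)
    moreover have "(\<Prod>l\<in>?C - {c}. of_nat c - of_nat l :: complex) \<in> R" "of_nat c ^ 2 - of_int g \<in> R"
      using R by (auto intro!: subring_intros)
    ultimately have "(\<Prod>l\<in>?C - {c}. of_nat c - of_nat l) \<in> M"
      using M nonres[OF c] unfolding is_prime_ideal_def by metis
    then obtain l where "l \<in> ?C - {c}" "of_nat c - of_nat l \<in> M"
      using prime_ideal_prod[OF R M, of "?C - {c}" "\<lambda>l. of_nat c - of_nat l"]
        subring_diff[OF R subring_of_nat[OF R] subring_of_nat[OF R]] by blast
    then show False using small[OF c] by blast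
  qed
  have fix_f: "\<pi> (f c) = f c" if c: "c \<in> ?C" for c
  proof (rule uniq[OF G_in[OF \<pi> f(1)[OF c]] c])
    have "ideal_cong M (\<omega> (f c) ^ p) (of_nat c ^ p)"
      using f[OF c] root_R R by (intro ideal_cong_power[OF R I]) (auto intro: subring_intros)
    moreover have "ideal_cong M (of_nat c ^ p) (of_nat c)"
      using int_fermat[OF p, of "int c"] of_int_mem_iff[of "int c ^ p - int c"] by (simp add: ideal_cong_def)
    ultimately show "ideal_cong M (\<omega> (\<pi> (f c))) (of_nat c)"
      using frob[OF f(1)[OF c]] ideal_cong_trans[OF I] by blast
  qed
  have inj_f: "inj_on f ?C"
  proof (rule inj_onI, rule ccontr)
    fix c c' assume c: "c \<in> ?C" "c' \<in> ?C" "f c = f c'" "c \<noteq> c'"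
    then have "ideal_cong M (of_nat c) (of_nat c')"
      using f(2)[OF c(1)] f(2)[OF c(2)] ideal_cong_trans[OF I] ideal_cong_sym[OF I] by metis
    then show False using small[OF c(1,2,4)] by (simp add: ideal_cong_def)
  qed
  let ?D = "{1..n} - f ` ?C"
  have "card ?D = card {1..n} - card (f ` ?C)" using f(1) by (intro card_Diff_subset) auto
  then have "card ?D = 2" unfolding card_image[OF inj_f] using n by simp
  then obtain a b where ab: "?D = {a, b}" "a \<noteq> b" by (auto simp: card_2_iff)
  \<comment> \<open>Such an index belongs to a root of X^2 - g modulo \<open>M\<close>, whose
    iterates 0 and 1 under \<open>\<pi>\<close> differ.\<close>
  have move: "\<pi> i \<noteq> i" if i: "i \<in> ?D" for i
  proof -
    have i1: "i \<in> {1..n}" using i by auto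
    have "(\<omega> i ^ 2 - of_int g) * (\<Prod>c\<in>?C. \<omega> i - of_nat c) \<in> M" using root_k[OF i1] by (simp add: ev)
    moreover have "(\<Prod>c\<in>?C. \<omega> i - of_nat c) \<notin> M"
    proof
      assume "(\<Prod>c\<in>?C. \<omega> i - of_nat c) \<in> M"
      then obtain c where c: "c \<in> ?C" "\<omega> i - of_nat c \<in> M"
        using prime_ideal_prod[OF R M, of ?C "\<lambda>l. \<omega> i - of_nat l"]
          subring_diff[OF R root_R[OF i1] subring_of_nat[OF R]] by blast
      then show False using uniq[OF i1 c(1)] i by (auto simp: ideal_cong_def)
    qed
    moreover have "(\<Prod>c\<in>?C. \<omega> i - of_nat c) \<in> R" "\<omega> i ^ 2 - of_int g \<in> R"
      using root_R[OF i1] R by (auto intro!: subring_intros)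
    ultimately have "ideal_cong M (\<omega> i ^ 2) (of_int g)"
      using M unfolding is_prime_ideal_def ideal_cong_def by blast
    from inj_onD[OF funpow_inj[OF i1 this g], of 1 0] show ?thesis by auto
  qed
  have bij: "inj \<pi>" using permutes_inj[OF G_permutes[OF \<pi>]] .
  have D: "\<pi> i \<in> ?D" if i: "i \<in> ?D" for i
  proof -
    have "\<pi> i \<notin> f ` ?C"
    proof
      assume "\<pi> i \<in> f ` ?C"
      then obtain c where c: "c \<in> ?C" "\<pi> i = f c" by blast
      then have "i = f c" using fix_f[OF c(1)] injD[OF bij, of i "f c"] by simp
      then show False using i c(1) by blast
    qed
    moreover have "\<pi> i \<in> {1..n}" using G_in[OF \<pi>] i by blast
    ultimately show ?thesis by blast
  qed
  have "\<pi> a = b" "\<pi> b = a" using D move unfolding ab(1) by blast+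
  moreover have "\<pi> x = x" if "x \<noteq> a" "x \<noteq> b" for x
  proof (cases "x \<in> {1..n}")
    case True
    then have "x \<in> f ` ?C" using ab(1) that by blast
    then show ?thesis using fix_f by blast
  next
    case False
    then show ?thesis using G_permutes[OF \<pi>] by (simp add: permutes_def)
  qed
  ultimately have "\<pi> = Transposition.transpose a b" by (auto simp: fun_eq_iff Transposition.transpose_def)
  moreover have "a \<in> {1..n}" "b \<in> {1..n}" using ab(1) by blast+
  ultimately show ?thesis using \<pi> ab(2) by blast
qed

end

subsection \<open>The full symmetric group\<close>

text \<open>Transitivity together with transitivity of one point stabiliser gives double
  transitivity. So every transposition is a conjugate of the given one, and transpositions generate
  all permutations.\<close>

lemma permutes_generated:
  fixes G :: "('a \<Rightarrow> 'a) set"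
  assumes S: "finite S" and G: "id \<in> G" "\<And>\<pi> \<rho>. \<pi> \<in> G \<Longrightarrow> \<rho> \<in> G \<Longrightarrow> \<pi> \<circ> \<rho> \<in> G"
      "\<And>\<pi>. \<pi> \<in> G \<Longrightarrow> inv_into UNIV \<pi> \<in> G" "\<And>\<pi>. \<pi> \<in> G \<Longrightarrow> \<pi> permutes S"
    and trans: "\<And>i j. i \<in> S \<Longrightarrow> j \<in> S \<Longrightarrow> \<exists>\<rho>\<in>G. \<rho> i = j"
    and stab: "r \<in> S" "\<And>i j. i \<in> S - {r} \<Longrightarrow> j \<in> S - {r} \<Longrightarrow> \<exists>\<rho>\<in>G. \<rho> r = r \<and> \<rho> i = j"
    and ab: "a \<in> S" "b \<in> S" "a \<noteq> b" "Transposition.transpose a b \<in> G"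
    and \<pi>: "\<pi> permutes S"
  shows "\<pi> \<in> G"
proof -
  have bij: "bij \<rho>" if "\<rho> \<in> G" for \<rho> using permutes_bij[OF G(4)[OF that]] .
  have img: "\<rho> i \<in> S" if "\<rho> \<in> G" "i \<in> S" for \<rho> i
    using permutes_in_image[OF G(4)[OF that(1)]] that(2) by blast
  have tr: "Transposition.transpose x y \<in> G" if xy: "x \<in> S" "y \<in> S" "x \<noteq> y" for x y
  proof -
    obtain \<rho>1 where 1: "\<rho>1 \<in> G" "\<rho>1 a = r" using trans[OF ab(1) stab(1)] by blast
    obtain \<rho>2 where 2: "\<rho>2 \<in> G" "\<rho>2 x = r" using trans[OF xy(1) stab(1)] by blast
    have "\<rho>1 b \<in> S - {r}" "\<rho>2 y \<in> S - {r}"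
      using img[OF 1(1) ab(2)] img[OF 2(1) xy(2)] 1(2) 2(2) ab(3) xy(3)
        injD[OF bij_is_inj[OF bij[OF 1(1)]], of a b] injD[OF bij_is_inj[OF bij[OF 2(1)]], of x y] by auto
    then obtain \<tau> where \<tau>: "\<tau> \<in> G" "\<tau> r = r" "\<tau> (\<rho>1 b) = \<rho>2 y" using stab(2) by blast
    \<comment> \<open>Routing through the distinguished point: a goes to r, stays there, and goes on
      to x, while \<open>\<tau>\<close> is chosen so that b ends at y.\<close>
    define \<rho> where "\<rho> = inv_into UNIV \<rho>2 \<circ> (\<tau> \<circ> \<rho>1)"
    have \<rho>: "\<rho> \<in> G" unfolding \<rho>_def by (intro G(2,3) 1(1) 2(1) \<tau>(1))
    have "inv_into UNIV \<rho>2 (\<rho>2 z) = z" for z by (rule inv_f_f[OF bij_is_inj[OF bij[OF 2(1)]]])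
    moreover have "\<tau> (\<rho>1 a) = \<rho>2 x" unfolding 1(2) \<tau>(2) 2(2) ..
    ultimately have \<rho>ab: "\<rho> a = x" "\<rho> b = y" unfolding \<rho>_def o_apply by (simp_all only: \<tau>(3))
    have "\<rho> \<circ> Transposition.transpose a b \<circ> inv_into UNIV \<rho> = Transposition.transpose x y"
    proof
      fix z
      have inj: "inj \<rho>" by (rule bij_is_inj[OF bij[OF \<rho>]])
      obtain w where w: "z = \<rho> w" using bij_is_surj[OF bij[OF \<rho>]] by (rule surjE)
      have "inv_into UNIV \<rho> z = w" unfolding w by (rule inv_f_f[OF inj])
      moreover have "\<rho> w = x \<longleftrightarrow> w = a" "\<rho> w = y \<longleftrightarrow> w = b"
        unfolding \<rho>ab[symmetric] using inj by (auto simp: inj_eq)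
      ultimately show "(\<rho> \<circ> Transposition.transpose a b \<circ> inv_into UNIV \<rho>) z = Transposition.transpose x y z"
        using \<rho>ab unfolding w by (simp add: Transposition.transpose_def)
    qed
    moreover have "\<rho> \<circ> Transposition.transpose a b \<circ> inv_into UNIV \<rho> \<in> G"
      by (rule G(2)[OF G(2)[OF \<rho> ab(4)] G(3)[OF \<rho>]])
    ultimately show ?thesis by simp
  qed
  show ?thesis
    using \<pi> S
  proof (induction rule: permutes_induct)
    case id
    show ?case by (rule G(1))
  next
    case (swap a b p)
    show ?case by (rule G(2)[OF tr[OF swap(1-3)] swap.IH])
  qed
qed

section \<open>The permutation group as a group of automorphisms of the splitting field\<close>

lemma complex_ring_simps:
  "carrier complex_ring = UNIV" "x \<oplus>\<^bsub>complex_ring\<^esub> y = x + y" "x \<otimes>\<^bsub>complex_ring\<^esub> y = x * y"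
  "\<one>\<^bsub>complex_ring\<^esub> = 1" "\<zero>\<^bsub>complex_ring\<^esub> = 0"
  by (simp_all add: ring_of_type_algebra_def)

lemma complex_ring_inverses:
  "\<ominus>\<^bsub>complex_ring\<^esub> x = - x" "x \<noteq> 0 \<Longrightarrow> inv\<^bsub>complex_ring\<^esub> x = inverse x"
proof -
  interpret F: field complex_ring by (rule field_from_type_algebra)
  show "\<ominus>\<^bsub>complex_ring\<^esub> x = - x"
    by (rule F.minus_equality) (simp_all add: complex_ring_simps)
  show "inv\<^bsub>complex_ring\<^esub> x = inverse x" if "x \<noteq> 0"
    by (rule F.comm_inv_char) (use that in \<open>simp_all add: complex_ring_simps\<close>)
qed

context monic_int_poly
begin

lemma hom_on_L_eqI:
  fixes \<sigma> \<tau> :: "complex \<Rightarrow> complex"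
  assumes "hom_on L \<sigma>" "hom_on L \<tau>" "\<And>i. i \<in> {1..n} \<Longrightarrow> \<sigma> (\<omega> i) = \<tau> (\<omega> i)" "x \<in> L"
  shows "\<sigma> x = \<tau> x"
proof -
  let ?S = "{x \<in> L. \<sigma> x = \<tau> x}"
  have "is_subring ?S"
    unfolding is_subring_def
    using subring_L assms(1,2) hom_on_diff[OF subring_L assms(1)] hom_on_diff[OF subring_L assms(2)]
    by (auto simp: hom_on_def intro: subring_one subring_diff subring_mult)
  moreover have "\<rat> \<subseteq> ?S" using hom_on_L_Rats[OF assms(1)] hom_on_L_Rats[OF assms(2)] Rats_subset_L by auto
  moreover have "\<omega> ` {1..n} \<subseteq> ?S" using root_in_L assms(3) by auto
  ultimately have "L \<subseteq> ?S" unfolding L_def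
    by (intro adjoin_list_least) (unfold set_roots, auto)
  then show ?thesis using assms(4) by auto
qed

text \<open>The roots of \<open>f\<close> are those of the monic polynomial divided by a nonzero
  integer, so together with the rationals both sets generate the same field.\<close>

lemma splitting_field_eq:
  assumes a: "a \<noteq> 0" and roots: "complex_roots f = (\<lambda>i. \<omega> i / of_int a) ` {1..n}"
  shows "splitting_field f = L"
proof
  let ?F = "generate_field complex_ring (\<rat> \<union> complex_roots f)"
  have "x \<in> L" if "x \<in> ?F" for x
    using that
  proof (induction rule: generate_field.induct)
    case (incl x)
    then show ?case
      using Rats_subset_L roots root_in_L subring_of_int[OF subring_L] subfield_divide[OF subfield_L] by auto
  next
    case (m_inv x)
    then show ?case
      using subfield_L by (simp add: complex_ring_simps complex_ring_inverses is_subfield_def)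
  qed (use subring_L in \<open>auto simp: complex_ring_simps complex_ring_inverses intro: subring_intros\<close>)
  then show "splitting_field f \<subseteq> L" by (auto simp: splitting_field_def)
  have F: "is_subring ?F"
    unfolding is_subring_def
  proof (intro conjI ballI)
    show "1 \<in> ?F" using generate_field.one[of complex_ring] by (simp add: complex_ring_simps)
    fix x y assume xy: "x \<in> ?F" "y \<in> ?F"
    show "x - y \<in> ?F"
      using generate_field.eng_add[OF xy(1) generate_field.a_inv[OF xy(2)]]
      by (simp add: complex_ring_simps complex_ring_inverses)
    show "x * y \<in> ?F" using generate_field.eng_mult[OF xy] by (simp add: complex_ring_simps)
  qed
  have "\<omega> i \<in> ?F" if "i \<in> {1..n}" for i
  proof -
    have "\<omega> i / of_int a \<in> complex_roots f" unfolding roots using that by (rule imageI)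
    then have "\<omega> i / of_int a \<in> ?F" by (intro generate_field.incl UnI2)
    from subring_mult[OF F this subring_of_int[OF F, of a]] show ?thesis using a by simp
  qed
  then show "L \<subseteq> splitting_field f"
    unfolding L_def splitting_field_def
    by (intro adjoin_list_least F) (unfold set_roots, auto intro: generate_field.incl)
qed

lemma galois_group_carrier_iff:
  "\<sigma> \<in> carrier (galois_group complex_ring L \<rat>) \<longleftrightarrow> \<sigma> \<in> extensional L \<and> bij_betw \<sigma> L L \<and> hom_on L \<sigma>"
proof -
  have hom: "\<sigma> \<in> ring_hom (complex_ring\<lparr>carrier := L\<rparr>) (complex_ring\<lparr>carrier := L\<rparr>) \<longleftrightarrow>
      \<sigma> \<in> L \<rightarrow> L \<and> (\<forall>x y. x \<in> L \<and> y \<in> L \<longrightarrow> \<sigma> (x * y) = \<sigma> x * \<sigma> y \<and> \<sigma> (x + y) = \<sigma> x + \<sigma> y) \<and> \<sigma> 1 = 1"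
    unfolding ring_hom_def by (simp add: complex_ring_simps)
  have carr: "\<sigma> \<in> carrier (galois_group complex_ring L \<rat>) \<longleftrightarrow> \<sigma> \<in> Bij L \<and>
      \<sigma> \<in> ring_hom (complex_ring\<lparr>carrier := L\<rparr>) (complex_ring\<lparr>carrier := L\<rparr>) \<and> bij_betw \<sigma> L L \<and> (\<forall>x\<in>\<rat>. \<sigma> x = x)"
    by (simp add: galois_group_def ring_iso_def)
  show ?thesis
  proof
    assume "\<sigma> \<in> carrier (galois_group complex_ring L \<rat>)"
    then show "\<sigma> \<in> extensional L \<and> bij_betw \<sigma> L L \<and> hom_on L \<sigma>"
      unfolding carr hom hom_on_def Bij_def by blast
  next
    assume r: "\<sigma> \<in> extensional L \<and> bij_betw \<sigma> L L \<and> hom_on L \<sigma>"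
    then have "\<forall>x\<in>\<rat>. \<sigma> x = x" using hom_on_L_Rats by blast
    moreover have "\<sigma> \<in> L \<rightarrow> L" using r by (auto simp: bij_betw_def)
    ultimately show "\<sigma> \<in> carrier (galois_group complex_ring L \<rat>)"
      using r unfolding carr hom hom_on_def Bij_def by blast
  qed
qed

text \<open>An embedding is chosen for each permutation. Embeddings are determined on
  \<open>L\<close> by their values on the roots, so the choice respects composition, and every
  automorphism arises from its permutation of the roots.\<close>

lemma galois_group_iso:
  assumes a: "a \<noteq> 0" and roots: "complex_roots f = (\<lambda>i. \<omega> i / of_int a) ` {1..n}"
    and all: "\<And>\<pi>. \<pi> permutes {1..n} \<Longrightarrow> \<pi> \<in> G"
  shows "poly_galois_group f \<cong> sym_group n"
proof -
  let ?Gal = "galois_group complex_ring L \<rat>"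
  have "\<exists>\<sigma> :: complex \<Rightarrow> complex. hom_on L \<sigma> \<and> (\<forall>i\<in>{1..n}. \<sigma> (\<omega> i) = \<omega> (\<pi> i))"
    if "\<pi> permutes {1..n}" for \<pi>
    using all[OF that] by (simp add: G_def)
  then obtain \<tau> :: "(nat \<Rightarrow> nat) \<Rightarrow> complex \<Rightarrow> complex" where
    \<tau>: "\<And>\<pi>. \<pi> permutes {1..n} \<Longrightarrow> hom_on L (\<tau> \<pi>)"
       "\<And>\<pi> i. \<pi> permutes {1..n} \<Longrightarrow> i \<in> {1..n} \<Longrightarrow> \<tau> \<pi> (\<omega> i) = \<omega> (\<pi> i)"
    by metis
  \<comment> \<open>Restriction discards the arbitrary values outside \<open>L\<close> and makes the
    result extensional, as membership in \<open>Bij L\<close> requires.\<close>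
  define \<Phi> where "\<Phi> \<pi> = restrict (\<tau> \<pi>) L" for \<pi>
  have \<tau>_comp: "\<tau> (\<pi> \<circ> \<rho>) x = \<tau> \<pi> (\<tau> \<rho> x)" if "\<pi> permutes {1..n}" "\<rho> permutes {1..n}" "x \<in> L" for \<pi> \<rho> x
  proof -
    have "hom_on L (\<lambda>x. \<tau> \<pi> (\<tau> \<rho> x))"
      using \<tau>(1)[OF that(1)] \<tau>(1)[OF that(2)] hom_on_L_range[OF \<tau>(1)[OF that(2)]]
      by (simp add: hom_on_def)
    moreover have "\<tau> (\<pi> \<circ> \<rho>) (\<omega> i) = \<tau> \<pi> (\<tau> \<rho> (\<omega> i))" if i: "i \<in> {1..n}" for i
      using \<tau>(2) \<open>\<pi> permutes _\<close> \<open>\<rho> permutes _\<close> permutes_compose[of \<rho> "{1..n}" \<pi>] permutes_in_image[of \<rho> "{1..n}" i] i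
      by simp
    ultimately show ?thesis
      using hom_on_L_eqI[OF \<tau>(1)[OF permutes_compose[OF that(2,1)]]] that(3) by blast
  qed
  have \<tau>_id: "\<tau> id x = x" if "x \<in> L" for x
    using hom_on_L_eqI[OF \<tau>(1)[OF permutes_id], of "\<lambda>x. x"] \<tau>(2)[OF permutes_id] that
    by (auto simp: hom_on_def)
  have carr: "\<Phi> \<pi> \<in> carrier ?Gal" if \<pi>: "\<pi> permutes {1..n}" for \<pi>
  proof -
    have "bij_betw (\<tau> \<pi>) L L"
    proof (rule bij_betw_byWitness[where f' = "\<tau> (inv_into UNIV \<pi>)"])
      note \<pi>' = permutes_inv[OF \<pi>]
      show "\<forall>x\<in>L. \<tau> (inv_into UNIV \<pi>) (\<tau> \<pi> x) = x" "\<forall>x\<in>L. \<tau> \<pi> (\<tau> (inv_into UNIV \<pi>) x) = x"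
        using \<tau>_comp[OF \<pi>' \<pi>] \<tau>_comp[OF \<pi> \<pi>'] \<tau>_id permutes_inv_o[OF \<pi>] by auto
      show "\<tau> \<pi> ` L \<subseteq> L" "\<tau> (inv_into UNIV \<pi>) ` L \<subseteq> L"
        using hom_on_L_range \<tau>(1) \<pi> \<pi>' by auto
    qed
    moreover have "hom_on L (\<Phi> \<pi>)"
      using \<tau>(1)[OF \<pi>] subring_L unfolding \<Phi>_def
      by (auto simp: hom_on_def subring_one subring_add subring_mult)
    ultimately show ?thesis unfolding galois_group_carrier_iff \<Phi>_def
      by (auto simp: bij_betw_def inj_on_def)
  qed
  have "\<Phi> \<in> iso (sym_group n) ?Gal"
  proof (rule isoI)
    show "\<Phi> \<in> hom (sym_group n) ?Gal"
    proof (rule homI)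
      show "\<Phi> \<pi> \<in> carrier ?Gal" if "\<pi> \<in> carrier (sym_group n)" for \<pi>
        using that carr by (simp add: sym_group_carrier)
      fix \<pi> \<rho> assume "\<pi> \<in> carrier (sym_group n)" "\<rho> \<in> carrier (sym_group n)"
      then have *: "\<pi> permutes {1..n}" "\<rho> permutes {1..n}" by (auto simp: sym_group_carrier)
      have Bij: "\<Phi> \<pi> \<in> Bij L" "\<Phi> \<rho> \<in> Bij L"
        using carr[OF *(1)] carr[OF *(2)] by (auto simp: galois_group_def)
      have "\<Phi> (\<pi> \<circ> \<rho>) = compose L (\<Phi> \<pi>) (\<Phi> \<rho>)"
        using \<tau>_comp[OF *] hom_on_L_range[OF \<tau>(1)[OF *(2)]]
        by (auto simp: \<Phi>_def compose_def restrict_def fun_eq_iff)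
      then show "\<Phi> (\<pi> \<otimes>\<^bsub>sym_group n\<^esub> \<rho>) = \<Phi> \<pi> \<otimes>\<^bsub>?Gal\<^esub> \<Phi> \<rho>"
        using Bij by (simp add: sym_group_mult galois_group_def BijGroup_def)
    qed
    show "bij_betw \<Phi> (carrier (sym_group n)) (carrier ?Gal)"
      unfolding bij_betw_def
    proof (intro conjI inj_onI equalityI subsetI)
      fix \<pi> \<rho> assume "\<pi> \<in> carrier (sym_group n)" "\<rho> \<in> carrier (sym_group n)" and eq: "\<Phi> \<pi> = \<Phi> \<rho>"
      then have *: "\<pi> permutes {1..n}" "\<rho> permutes {1..n}" by (auto simp: sym_group_carrier)
      show "\<pi> = \<rho>"
      proof
        fix i
        show "\<pi> i = \<rho> i"
        proof (cases "i \<in> {1..n}")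
          case True
          have "\<Phi> \<pi> (\<omega> i) = \<Phi> \<rho> (\<omega> i)" using eq by simp
          then have "\<omega> (\<pi> i) = \<omega> (\<rho> i)" using \<tau>(2) * True root_in_L by (simp add: \<Phi>_def)
          then show ?thesis
            using inj permutes_in_image[OF *(1), of i] permutes_in_image[OF *(2), of i] True by (auto dest: inj_onD)
        next
          case False
          then show ?thesis using * by (simp add: permutes_def)
        qed
      qed
    next
      fix \<sigma> assume "\<sigma> \<in> \<Phi> ` carrier (sym_group n)"
      then show "\<sigma> \<in> carrier ?Gal" using carr by (auto simp: sym_group_carrier)
    next
      fix \<sigma> assume "\<sigma> \<in> carrier ?Gal"
      then have \<sigma>: "\<sigma> \<in> extensional L" "hom_on L \<sigma>" by (auto simp: galois_group_carrier_iff)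
      obtain \<pi> where \<pi>: "\<pi> \<in> G" "\<And>i. i \<in> {1..n} \<Longrightarrow> \<sigma> (\<omega> i) = \<omega> (\<pi> i)"
        using hom_on_L_perm[OF \<sigma>(2)] by blast
      note p = G_permutes[OF \<pi>(1)]
      have "\<sigma> x = \<tau> \<pi> x" if "x \<in> L" for x
        using hom_on_L_eqI[OF \<sigma>(2) \<tau>(1)[OF p] _ that] \<pi>(2) \<tau>(2)[OF p] by simp
      then have "\<sigma> = \<Phi> \<pi>" using \<sigma>(1) by (auto simp: \<Phi>_def restrict_def fun_eq_iff extensional_def)
      then show "\<sigma> \<in> \<Phi> ` carrier (sym_group n)" using p by (auto simp: sym_group_carrier)
    qed
  qed
  then have "sym_group n \<cong> ?Gal" by (auto simp: is_iso_def)
  then have "?Gal \<cong> sym_group n" by (rule group.iso_sym[OF sym_group_is_group])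
  then show ?thesis unfolding poly_galois_group_def splitting_field_eq[OF a roots] .
qed

end

subsection \<open>Primes congruent to 1\<close>

text \<open>
  The polynomial \<open>\<psi>\<close> below plays the role of the \<open>d\<close>-th cyclotomic polynomial: since \<open>(X\<^sup>e - 1) \<psi>\<close> divides \<open>X\<^sup>d - 1\<close>
  for every proper divisor \<open>e\<close> of \<open>d\<close>, a common zero of \<open>\<psi>\<close> and \<open>X\<^sup>e - 1\<close> modulo a prime \<open>q\<close> is a double zero of
  \<open>X\<^sup>d - 1\<close>, which forces \<open>q\<close> to divide \<open>d\<close>. So \<open>a\<close> has order \<open>d\<close> modulo the prime divisors of \<open>\<psi> a\<close>.
\<close>

lemma exists_prime_cong_1:
  fixes d B :: nat
  assumes d: "d > 0"
  shows "\<exists>p. prime p \<and> p > B \<and> d dvd p - 1"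
proof -
  let ?u = "\<lambda>e. monom 1 e - 1 :: int poly"
  let ?D = "{e. e dvd d \<and> e < d}"
  \<comment> \<open>Dividing X^d - 1 by this least common multiple removes every root whose order is
    a proper divisor of d.\<close>
  define E where "E = Lcm (?u ` ?D)"
  have D0: "e > 0" if "e \<in> ?D" for e using that d by (cases e) auto
  have finD: "finite ?D" by simp
  have u_dvd: "?u e dvd ?u d" if ed: "e dvd d" for e
  proof -
    obtain c where c: "d = e * c" using ed ..
    have "?u d = monom 1 e ^ c - 1 ^ c" by (simp add: c monom_power)
    also have "\<dots> = ?u e * (\<Sum>i<c. monom 1 e ^ i * 1 ^ (c - Suc i))"
      unfolding power_diff_sumr2 by (simp add: mult.commute)
    also have "?u e dvd \<dots>" by (rule dvd_triv_left)
    finally show ?thesis .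
  qed
  have "E dvd ?u d" unfolding E_def using u_dvd by (intro Lcm_least) auto
  then obtain \<psi> where \<psi>: "?u d = E * \<psi>" ..
  have u_E: "?u e dvd E" if "e \<in> ?D" for e unfolding E_def using that by (intro dvd_Lcm) auto
  have E_P: "E dvd (\<Prod>e\<in>?D. ?u e)" unfolding E_def
    using finD by (intro Lcm_least) (auto intro: dvd_prodI)
  \<comment> \<open>A complex primitive d-th root of unity is a root of X^d - 1 but not of
    \<open>E\<close>, hence of \<open>\<psi>\<close>; with the nonzero constant term this shows that
    \<open>\<psi>\<close> is not constant.\<close>
  define \<zeta> where "\<zeta> = cis (2 * pi / real d)"
  have ev: "poly (map_poly of_int (?u e)) z = z ^ e - 1" for e and z :: complex
    by (simp add: of_int_poly_diff map_poly_monom poly_monom map_poly_1)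
  have \<zeta>d: "\<zeta> ^ d = 1" unfolding \<zeta>_def Complex.DeMoivre using d by simp
  have \<zeta>e: "\<zeta> ^ e \<noteq> 1" if e: "e \<in> ?D" for e
  proof
    assume "\<zeta> ^ e = 1"
    then have "cis (2 * pi * real e / real d) = 1" by (simp add: \<zeta>_def Complex.DeMoivre algebra_simps)
    then have "cos (2 * pi * real e / real d) = 1" by (simp add: complex_eq_iff)
    then obtain m :: int where "2 * pi * real e / real d = of_int m * 2 * pi"
      unfolding cos_one_2pi_int by auto
    then have "real e = of_int m * real d" using d by (simp add: field_simps)
    then have "int e = m * int d" by (metis of_int_eq_iff of_int_mult of_int_of_nat_eq)
    then have "int d dvd int e" by simp
    then have "d \<le> e" using D0[OF e] by (intro dvd_imp_le) auto
    then show False using e by simp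
  qed
  have "poly (map_poly of_int (\<Prod>e\<in>?D. ?u e)) \<zeta> \<noteq> 0"
    using finD \<zeta>e by (simp add: of_int_poly_prod poly_prod ev)
  then have "poly (map_poly of_int E) \<zeta> \<noteq> 0" using E_P by (auto simp: of_int_poly_mult elim!: dvdE)
  moreover have "poly (map_poly of_int E) \<zeta> * poly (map_poly of_int \<psi>) \<zeta> = 0"
    using ev[of d \<zeta>] \<zeta>d unfolding \<psi> by (simp add: of_int_poly_mult)
  ultimately have \<psi>\<zeta>: "poly (map_poly of_int \<psi>) \<zeta> = 0" by simp
  have "poly (?u d) 0 = -1" using d by (simp add: poly_monom power_0_left)
  then have E\<psi>: "poly E 0 * poly \<psi> 0 = -1" by (simp add: \<psi>)
  then have \<psi>0: "poly \<psi> 0 = 1 \<or> poly \<psi> 0 = -1"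
  proof -
    have "poly \<psi> 0 dvd -1" by (rule dvdI[of _ _ "poly E 0"]) (simp add: E\<psi>[symmetric])
    then show ?thesis by (auto simp: abs_if split: if_splits)
  qed
  have deg: "degree \<psi> > 0"
  proof (rule ccontr)
    assume "\<not> degree \<psi> > 0"
    then obtain c where c: "\<psi> = [:c:]" by (auto elim: degree_eq_zeroE)
    then have "c = 0" using \<psi>\<zeta> by (simp add: map_poly_pCons)
    then show False using \<psi>0 c by simp
  qed
  \<comment> \<open>At a multiple a of d B! the value of \<open>\<psi>\<close> is congruent modulo a
    to its constant term, which is 1 or -1. So its prime divisors divide neither d nor B!, and
    therefore exceed B.\<close>
  define A where "A = d * fact B"
  have A0: "A > 0" using d by (simp add: A_def)
  \<comment> \<open>Only finitely many arguments make the value 1 or -1; elsewhere it has a prime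
    divisor.\<close>
  let ?bad = "{x. poly (\<psi> - 1) x = 0} \<union> {x. poly (\<psi> + 1) x = 0}"
  have "\<psi> - 1 \<noteq> 0" "\<psi> + 1 \<noteq> 0" using deg by (auto simp: eq_neg_iff_add_eq_0[symmetric])
  then have "finite ?bad" using poly_roots_finite by blast
  moreover have "infinite ((\<lambda>t. int (A * t)) ` UNIV)"
    using A0 by (intro range_inj_infinite) (auto simp: inj_def)
  ultimately have "\<exists>x\<in>(\<lambda>t. int (A * t)) ` UNIV. x \<notin> ?bad" by (meson finite_subset subsetI)
  then obtain t where "int (A * t) \<notin> ?bad" by blast
  then have "poly \<psi> (int (A * t)) \<noteq> 1" "poly \<psi> (int (A * t)) \<noteq> -1" by (auto simp: eq_neg_iff_add_eq_0)
  define a where "a = A * t"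
  have "\<bar>poly \<psi> (int a)\<bar> \<noteq> 1"
    using \<open>poly \<psi> (int (A * t)) \<noteq> 1\<close> \<open>poly \<psi> (int (A * t)) \<noteq> -1\<close> by (auto simp: a_def abs_if split: if_splits)
  then have "nat \<bar>poly \<psi> (int a)\<bar> \<noteq> 1" by linarith
  then obtain q where q: "prime q" "q dvd nat \<bar>poly \<psi> (int a)\<bar>"
    using prime_factor_nat by blast
  from q(2) have "int q dvd int (nat \<bar>poly \<psi> (int a)\<bar>)" by (simp only: int_dvd_int_iff)
  then have q\<psi>: "int q dvd poly \<psi> (int a)" by simp
  have dvd: "int a dvd poly \<psi> (int a) - poly \<psi> 0" by (cases \<psi>) simp
  have qA: "\<not> q dvd A"
  proof
    assume "q dvd A"
    then have "int q dvd int a" by (simp add: a_def)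
    from dvd_trans[OF this dvd] have "int q dvd poly \<psi> 0"
      using q\<psi> by (simp add: dvd_diff_right_iff)
    then show False using \<psi>0 prime_gt_1_nat[OF q(1)] by auto
  qed
  have qB: "q > B"
    using qA prime_dvd_fact_iff[OF q(1), of B] by (auto simp: A_def intro: dvd_mult)
  have qd: "\<not> q dvd d" using qA by (auto simp: A_def)
  have evZ: "poly (?u e) (int a) = int a ^ e - 1" for e by (simp add: poly_monom)
  have "int q dvd poly (?u d) (int a)" unfolding \<psi> poly_mult by (rule dvd_mult[OF q\<psi>])
  then have ad: "int q dvd int a ^ d - 1" unfolding evZ .
  have cong_iff: "[a ^ e = 1] (mod q) \<longleftrightarrow> int q dvd int a ^ e - 1" for e
  proof -
    have "[a ^ e = 1] (mod q) \<longleftrightarrow> [int (a ^ e) = int 1] (mod int q)" by (simp only: cong_int_iff)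
    then show ?thesis by (simp add: cong_iff_dvd_diff)
  qed
  have qa: "\<not> q dvd a"
  proof
    assume "q dvd a"
    then have "int q dvd int a ^ d" using d by (simp add: dvd_power_le dvd_trans[OF _ dvd_power])
    from dvd_diff[OF this ad] show False using prime_gt_1_nat[OF q(1)] by simp
  qed
  define e where "e = ord q a"
  have ed: "e dvd d" using ad cong_iff ord_divides unfolding e_def by blast
  have "e = d"
  proof (rule ccontr)
    assume "e \<noteq> d"
    then have "e \<in> ?D" using ed d by (auto dest: dvd_imp_le)
    from u_E[OF this] obtain s where s: "E = ?u e * s" ..
    have "[a ^ e = 1] (mod q)" unfolding e_def by (rule ord)
    then have "int q dvd poly (?u e) (int a)" unfolding evZ cong_iff .
    then have "int q dvd poly E (int a) * poly (pderiv \<psi>) (int a) + poly \<psi> (int a) * poly (pderiv E) (int a)"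
      using q\<psi> by (simp add: s)
    also have "\<dots> = poly (pderiv (?u d)) (int a)" by (simp add: \<psi> pderiv_mult)
    also have "\<dots> = int d * int a ^ (d - 1)" by (simp add: pderiv_diff pderiv_monom poly_monom pderiv_1)
    also have "\<dots> = int (d * a ^ (d - 1))" by simp
    finally have "q dvd d * a ^ (d - 1)" by (simp only: int_dvd_int_iff)
    then show False using qd qa q(1) prime_dvd_mult_iff prime_dvd_power by blast
  qed
  moreover have "e dvd q - 1"
    using fermat_theorem[OF q(1) qa] ord_divides unfolding e_def by blast
  ultimately show ?thesis using q(1) qB by blast
qed

text \<open>A primitive root modulo \<open>p\<close> works for every d: its power with exponent
  (p-1)/d has order d.\<close>

lemma exists_primitive_residue:
  assumes p: "prime p" and d: "d > 0" "d dvd p - 1"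
  shows "\<exists>g. primitive_residue p d g"
proof -
  have p1: "p > 1" using prime_gt_1_nat[OF p] .
  obtain g where g: "residue_primroot p g" using prime_primitive_root_exists[OF p1 p] by blast
  then have c: "coprime p g" and o: "ord p g = p - 1"
    using p by (auto simp: residue_primroot_def totient_prime)
  obtain e where e: "p - 1 = d * e" using d(2) ..
  have e0: "e > 0" using p1 e by (cases e) auto
  have div: "(p - 1) div d = e" unfolding e using d(1) by simp
  have "\<not> int p dvd (int g ^ e) ^ j - 1" if j: "0 < j" "j < d" for j
  proof
    assume "int p dvd (int g ^ e) ^ j - 1"
    then have "[int (g ^ (e * j)) = int 1] (mod int p)" by (simp add: cong_iff_dvd_diff power_mult)
    then have "[g ^ (e * j) = 1] (mod p)" by (simp only: cong_int_iff)
    then have "ord p g dvd e * j" by (simp only: ord_divides)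
    then have "e * d dvd e * j" unfolding o e by (simp only: mult.commute)
    then have "d dvd j" using e0 by simp
    then show False using j by (auto dest: dvd_imp_le)
  qed
  moreover have "\<not> int p dvd int g"
  proof
    assume "int p dvd int g"
    then have "p dvd g" by (simp only: int_dvd_int_iff)
    then have "is_unit p" using coprime_common_divisor[OF c] by simp
    then show False using p1 by simp
  qed
  ultimately have "primitive_residue p d (int g)" using d unfolding primitive_residue_def div by blast
  then show ?thesis ..
qed

subsection \<open>Polynomials close to a given one\<close>

lemma poly_eq_smult_prod_roots:
  fixes f :: "complex poly"
  assumes inj: "inj_on \<alpha> {1..n}" and roots: "\<And>i. i \<in> {1..n} \<Longrightarrow> poly f (\<alpha> i) = 0" and deg: "degree f = n"
  shows "f = smult (lead_coeff f) (\<Prod>i=1..n. [:- \<alpha> i, 1:])"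
proof -
  let ?Q = "\<Prod>i=1..n. [:- \<alpha> i, 1:]"
  let ?g = "f - smult (lead_coeff f) ?Q"
  have dQ: "degree ?Q = n" by (subst degree_prod_eq_sum_degree) auto
  have lQ: "lead_coeff ?Q = 1" by (simp add: lead_coeff_prod)
  have "?g = 0"
  proof (rule ccontr)
    assume g: "?g \<noteq> 0"
    have le: "degree ?g \<le> n" using dQ deg by (intro degree_diff_le) auto
    moreover have "coeff ?g n = 0" using dQ lQ deg by simp
    ultimately have lt: "degree ?g < n" using g by (metis le_neq_implies_less leading_coeff_0_iff)
    have "poly ?Q (\<alpha> i) = 0" if "i \<in> {1..n}" for i
      unfolding poly_prod using that by (intro prod_zero) auto
    then have "\<alpha> ` {1..n} \<subseteq> {z. poly ?g z = 0}" using roots by auto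
    then have "card (\<alpha> ` {1..n}) \<le> card {z. poly ?g z = 0}"
      using poly_roots_finite[OF g] by (rule card_mono[rotated])
    also have "\<dots> \<le> degree ?g" using card_poly_roots_bound[OF g] .
    finally show False using lt card_image[OF inj] by simp
  qed
  then show ?thesis by simp
qed

text \<open>The modulus of a polynomial at \<open>w\<close> is that of its leading coefficient times
  the distances from \<open>w\<close> to the roots. Contrapositively, a small value forces a nearby
  root.\<close>

lemma power_le_norm_poly:
  fixes f :: "complex poly"
  assumes e: "e \<ge> 0" and far: "\<And>z. poly f z = 0 \<Longrightarrow> e \<le> cmod (w - z)"
  shows "cmod (lead_coeff f) * e ^ degree f \<le> cmod (poly f w)"
  using far
proof (induction "degree f" arbitrary: f)
  case 0
  then obtain c where "f = [:c:]" by (metis degree_eq_zeroE)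
  then show ?case by simp
next
  case (Suc d)
  then obtain z where z: "poly f z = 0"
    by (metis constant_degree fundamental_theorem_of_algebra nat.distinct(1))
  then obtain g where g: "f = [:- z, 1:] * g" by (auto simp: poly_eq_0_iff_dvd)
  have g0: "g \<noteq> 0" using Suc.hyps(2) g by auto
  have d: "degree f = Suc (degree g)" unfolding g using g0 by (subst degree_mult_eq) auto
  have "cmod (lead_coeff g) * e ^ degree g \<le> cmod (poly g w)"
    using Suc.hyps(2) d Suc.prems by (intro Suc.hyps(1)) (auto simp: g)
  moreover have "e \<le> cmod (w - z)" using Suc.prems z by blast
  ultimately have "e * (cmod (lead_coeff g) * e ^ degree g) \<le> cmod (w - z) * cmod (poly g w)"
    using e by (intro mult_mono) auto
  moreover have "lead_coeff f = lead_coeff g" unfolding g by (subst lead_coeff_mult) simp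
  moreover have "poly f w = (w - z) * poly g w" unfolding g by (simp add: algebra_simps)
  then have "cmod (poly f w) = cmod (w - z) * cmod (poly g w)" by (simp add: norm_mult)
  ultimately show ?case unfolding d power_Suc by (simp only: mult.left_commute)
qed

text \<open>Here the symmetry of the point set enters: conjugation permutes the linear factors, so
  the coefficients are real and their multiples can be approximated by integers.\<close>

lemma coeff_conj_invariant_prod:
  assumes inj: "inj_on \<beta> {1..n}" and conj: "\<beta> ` {1..n} = (\<lambda>i. cnj (\<beta> i)) ` {1..n}"
  shows "coeff (\<Prod>i=1..n. [:- \<beta> i, 1:]) j = of_real (Re (coeff (\<Prod>i=1..n. [:- \<beta> i, 1:]) j))"
proof -
  let ?F = "\<Prod>i=1..n. [:- \<beta> i, 1:]"
  let ?S = "\<beta> ` {1..n}"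
  have F: "?F = (\<Prod>z\<in>?S. [:- z, 1:])" using inj by (simp add: prod.reindex)
  have cnj: "hom_on UNIV cnj" by (simp add: hom_on_def)
  have "map_poly cnj ?F = (\<Prod>i=1..n. map_poly cnj [:- \<beta> i, 1:])"
    by (rule hom_on_prod[OF is_subring_polys_over[OF is_subring_UNIV] hom_on_map_poly[OF is_subring_UNIV cnj]])
       (simp add: polys_over_def)
  also have "\<dots> = (\<Prod>i=1..n. [:- cnj (\<beta> i), 1:])" by (simp add: map_poly_pCons)
  also have "\<dots> = (\<Prod>z\<in>(\<lambda>i. cnj (\<beta> i)) ` {1..n}. [:- z, 1:])"
    using inj by (subst prod.reindex) (auto simp: inj_on_def)
  also have "\<dots> = ?F" unfolding F conj[symmetric] ..
  finally have "coeff (map_poly cnj ?F) j = coeff ?F j" by simp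
  then have "cnj (coeff ?F j) = coeff ?F j" by (simp add: coeff_map_poly)
  then show ?thesis by (metis Reals_cnj_iff of_real_Re)
qed

lemma exists_pos_lower_bound:
  fixes A :: "real set"
  assumes "finite A" "\<And>x. x \<in> A \<Longrightarrow> x > 0"
  shows "\<exists>e>0. \<forall>x\<in>A. e \<le> x"
  using assms by (intro exI[of _ "Min (insert 1 A)"]) auto

lemma complex_root_cnj: "z \<in> complex_roots f \<Longrightarrow> cnj z \<in> complex_roots f"
proof -
  assume "z \<in> complex_roots f"
  then have "poly (map_poly of_int f) z = 0" by (simp add: complex_roots_def)
  then have "cnj (poly (map_poly of_int f) z) = 0" by simp
  moreover have "cnj (poly (map_poly of_int f) z) = poly (map_poly of_int f) (cnj z)"
    by (simp add: poly_altdef coeff_map_poly)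
  ultimately show ?thesis by (simp add: complex_roots_def)
qed

text \<open>Since \<open>?F\<close> vanishes at \<open>\<beta> i\<close>, the value of
  \<open>f\<close> there only sees the coefficient errors, while the leading coefficient is at least
  T/2; both scale with \<open>T\<close>, so \<open>\<delta>\<close> is independent of it. Disjoint
  discs then account for all roots. A disc about a nonreal point misses the real axis, and a root
  near a real point shares its disc with its conjugate.\<close>

lemma roots_near:
  fixes \<beta> :: "nat \<Rightarrow> complex" and n :: nat and \<epsilon> :: real and b :: "nat \<Rightarrow> real"
  assumes n: "n \<ge> 1" and \<epsilon>: "\<epsilon> > 0"
    and sep: "\<And>i j. i \<in> {1..n} \<Longrightarrow> j \<in> {1..n} \<Longrightarrow> i \<noteq> j \<Longrightarrow> 2 * \<epsilon> < dist (\<beta> i) (\<beta> j)"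
    and im: "\<And>i. i \<in> {1..n} \<Longrightarrow> \<beta> i \<notin> \<real> \<Longrightarrow> \<epsilon> < \<bar>Im (\<beta> i)\<bar>"
    and b: "\<And>j. coeff (\<Prod>i=1..n. [:- \<beta> i, 1:]) j = of_real (b j)"
  shows "\<exists>\<delta>>0. \<delta> < 1 \<and> (\<forall>T>0. \<forall>f :: int poly. degree f = n \<longrightarrow>
      (\<forall>j\<le>n. \<bar>of_int (coeff f j) - T * b j\<bar> \<le> \<delta> * T) \<longrightarrow>
      (\<exists>\<alpha>. bij_betw \<alpha> {1..n} (complex_roots f) \<and> (\<forall>i\<in>{1..n}. \<alpha> i \<in> ball (\<beta> i) \<epsilon>)) \<and>
      (\<forall>i\<in>{1..n}. \<forall>z\<in>complex_roots f \<inter> ball (\<beta> i) \<epsilon>. z \<in> \<real> \<longleftrightarrow> \<beta> i \<in> \<real>))"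
proof -
  let ?F = "\<Prod>i=1..n. [:- \<beta> i, 1:]"
  have dF: "degree ?F = n" by (subst degree_prod_eq_sum_degree) auto
  have "lead_coeff ?F = 1" by (simp add: lead_coeff_prod)
  then have bn: "b n = 1" using b[of n] dF by simp
  define K where "K = (\<Sum>i=1..n. \<Sum>j\<le>n. cmod (\<beta> i) ^ j) + 1"
  have K0: "K > 0" unfolding K_def by (intro add_nonneg_pos sum_nonneg) auto
  \<comment> \<open>The bound 1/2 protects the leading coefficient, since \<open>b n = 1\<close>.
    The other bound makes the total error \<delta> T K smaller than (T/2) \<epsilon>^n; the 4 leaves
    room for strictness.\<close>
  define \<delta> where "\<delta> = min (1/2) (\<epsilon> ^ n / (4 * K))"
  have \<delta>: "\<delta> > 0" "\<delta> \<le> 1/2" "\<delta> * K < \<epsilon> ^ n / 2"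
  proof -
    show "\<delta> > 0" "\<delta> \<le> 1/2" using \<epsilon> K0 by (auto simp: \<delta>_def)
    have "\<delta> * K \<le> \<epsilon> ^ n / (4 * K) * K" using K0 by (intro mult_right_mono) (auto simp: \<delta>_def)
    also have "\<dots> = \<epsilon> ^ n / 4" using K0 by simp
    also have "\<dots> < \<epsilon> ^ n / 2" using \<epsilon> by simp
    finally show "\<delta> * K < \<epsilon> ^ n / 2" .
  qed
  have main: "(\<exists>\<alpha>. bij_betw \<alpha> {1..n} (complex_roots f) \<and> (\<forall>i\<in>{1..n}. \<alpha> i \<in> ball (\<beta> i) \<epsilon>)) \<and>
      (\<forall>i\<in>{1..n}. \<forall>z\<in>complex_roots f \<inter> ball (\<beta> i) \<epsilon>. z \<in> \<real> \<longleftrightarrow> \<beta> i \<in> \<real>)"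
    if T: "T > 0" and deg: "degree f = n" and near: "\<forall>j\<le>n. \<bar>of_int (coeff f j) - T * b j\<bar> \<le> \<delta> * T"
    for T :: real and f :: "int poly"
  proof -
    let ?f = "map_poly of_int f :: complex poly"
    have f0: "?f \<noteq> 0" using deg n by (auto simp: map_poly_eq_0_iff)
    have df: "degree ?f = n" using deg by (simp add: degree_map_poly)
    have "\<bar>of_int (coeff f n) - T\<bar> \<le> \<delta> * T" using near bn by auto
    moreover have "\<delta> * T \<le> 1/2 * T" using \<delta> T by (intro mult_right_mono) auto
    ultimately have "T / 2 \<le> \<bar>of_int (coeff f n)\<bar>" by linarith
    then have lc: "T / 2 \<le> cmod (lead_coeff ?f)" by (simp add: df coeff_map_poly)
    have ex: "\<exists>z. poly ?f z = 0 \<and> z \<in> ball (\<beta> i) \<epsilon>" if i: "i \<in> {1..n}" for i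
    proof (rule ccontr)
      assume "\<not> ?thesis"
      then have "cmod (lead_coeff ?f) * \<epsilon> ^ degree ?f \<le> cmod (poly ?f (\<beta> i))"
        using \<epsilon> by (intro power_le_norm_poly) (auto simp: dist_norm not_less)
      moreover have "T / 2 * \<epsilon> ^ n \<le> cmod (lead_coeff ?f) * \<epsilon> ^ degree ?f"
        unfolding df using mult_right_mono[OF lc] \<epsilon> df by simp
      ultimately have "T / 2 * \<epsilon> ^ n \<le> cmod (poly ?f (\<beta> i))" by linarith
      also have "poly ?f (\<beta> i) = (\<Sum>j\<le>n. (of_int (coeff f j) - of_real (T * b j)) * \<beta> i ^ j)"
      proof -
        have "poly ?F (\<beta> i) = 0" unfolding poly_prod using i by (intro prod_zero) auto
        then have "(\<Sum>j\<le>n. of_real (b j) * \<beta> i ^ j) = 0" unfolding poly_altdef dF b .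
        then have "of_real T * (\<Sum>j\<le>n. of_real (b j) * \<beta> i ^ j) = 0" by simp
        then have "(\<Sum>j\<le>n. of_real (T * b j) * \<beta> i ^ j) = 0" by (simp add: sum_distrib_left mult.assoc)
        then show ?thesis by (simp add: poly_altdef df coeff_map_poly left_diff_distrib sum_subtractf)
      qed
      also have "cmod \<dots> \<le> (\<Sum>j\<le>n. cmod ((of_int (coeff f j) - of_real (T * b j)) * \<beta> i ^ j))"
        by (rule norm_sum)
      also have "\<dots> \<le> (\<Sum>j\<le>n. \<delta> * T * cmod (\<beta> i) ^ j)"
      proof (rule sum_mono)
        fix j assume "j \<in> {..n}"
        then have "cmod (of_real (of_int (coeff f j) - T * b j)) \<le> \<delta> * T"
          unfolding norm_of_real using near by simp
        moreover have "of_real (of_int (coeff f j) - T * b j) = of_int (coeff f j) - complex_of_real (T * b j)"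
          by simp
        ultimately have "cmod (of_int (coeff f j) - complex_of_real (T * b j)) \<le> \<delta> * T" by metis
        then show "cmod ((of_int (coeff f j) - of_real (T * b j)) * \<beta> i ^ j) \<le> \<delta> * T * cmod (\<beta> i) ^ j"
          unfolding norm_mult norm_power by (rule mult_right_mono) simp
      qed
      also have "\<dots> = \<delta> * T * (\<Sum>j\<le>n. cmod (\<beta> i) ^ j)" by (simp add: sum_distrib_left)
      also have "\<dots> \<le> \<delta> * T * K"
      proof -
        have "(\<Sum>j\<le>n. cmod (\<beta> i) ^ j) \<le> (\<Sum>i=1..n. \<Sum>j\<le>n. cmod (\<beta> i) ^ j)"
          using i by (intro member_le_sum) (auto intro: sum_nonneg)
        then show ?thesis using \<delta> T by (intro mult_left_mono) (auto simp: K_def)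
      qed
      finally have "T * (\<epsilon> ^ n / 2) \<le> T * (\<delta> * K)" by (simp add: algebra_simps)
      then show False using T \<delta>(3) by simp
    qed
    then obtain \<alpha> where \<alpha>: "\<And>i. i \<in> {1..n} \<Longrightarrow> poly ?f (\<alpha> i) = 0" "\<And>i. i \<in> {1..n} \<Longrightarrow> \<alpha> i \<in> ball (\<beta> i) \<epsilon>"
      by metis
    have disj: "i = j" if "i \<in> {1..n}" "j \<in> {1..n}" "z \<in> ball (\<beta> i) \<epsilon>" "z \<in> ball (\<beta> j) \<epsilon>" for i j z
    proof (rule ccontr)
      assume "i \<noteq> j"
      then have "2 * \<epsilon> < dist (\<beta> i) (\<beta> j)" using sep that by blast
      also have "\<dots> \<le> dist (\<beta> i) z + dist (\<beta> j) z" by (rule dist_triangle2)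
      finally show False using that by simp
    qed
    have inj: "inj_on \<alpha> {1..n}" using disj \<alpha>(2) by (metis inj_onI)
    have "\<alpha> ` {1..n} = complex_roots f"
    proof (rule card_subset_eq)
      show "finite (complex_roots f)" unfolding complex_roots_def by (rule poly_roots_finite[OF f0])
      show "\<alpha> ` {1..n} \<subseteq> complex_roots f" using \<alpha>(1) by (auto simp: complex_roots_def)
      then have "card (\<alpha> ` {1..n}) \<le> card (complex_roots f)"
        by (intro card_mono \<open>finite (complex_roots f)\<close>)
      moreover have "card (complex_roots f) \<le> n"
        unfolding complex_roots_def using card_poly_roots_bound[OF f0] df by simp
      ultimately show "card (\<alpha> ` {1..n}) = card (complex_roots f)" using card_image[OF inj] by simp
    qed
    then have bij: "bij_betw \<alpha> {1..n} (complex_roots f)" using inj by (simp add: bij_betw_def)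
    have "z \<in> \<real> \<longleftrightarrow> \<beta> i \<in> \<real>" if i: "i \<in> {1..n}" and z: "z \<in> complex_roots f" "z \<in> ball (\<beta> i) \<epsilon>" for i z
    proof
      assume "z \<in> \<real>"
      show "\<beta> i \<in> \<real>"
      proof (rule ccontr)
        assume "\<beta> i \<notin> \<real>"
        then have "\<epsilon> < \<bar>Im (\<beta> i)\<bar>" using im i by blast
        also have "\<dots> = \<bar>Im (\<beta> i - z)\<bar>" using \<open>z \<in> \<real>\<close> by (simp add: complex_is_Real_iff)
        also have "\<dots> \<le> cmod (\<beta> i - z)" by (rule abs_Im_le_cmod)
        finally show False using z(2) by (simp add: dist_norm)
      qed
    next
      assume r: "\<beta> i \<in> \<real>"
      have uniq: "y = \<alpha> i" if y: "y \<in> complex_roots f" "y \<in> ball (\<beta> i) \<epsilon>" for y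
      proof -
        obtain j where j: "j \<in> {1..n}" "y = \<alpha> j" using bij_betw_imp_surj_on[OF bij] y(1) by blast
        then have "j = i" using disj[OF j(1) i, of y] \<alpha>(2)[OF j(1)] y(2) by simp
        then show ?thesis using j by simp
      qed
      have "dist (\<beta> i) (cnj z) = dist (\<beta> i) z"
      proof -
        have "\<beta> i - cnj z = cnj (\<beta> i - z)" using r by (simp add: Reals_cnj_iff)
        then show ?thesis unfolding dist_norm by (metis complex_mod_cnj)
      qed
      then have "cnj z \<in> ball (\<beta> i) \<epsilon>" using z(2) by simp
      then have "cnj z = z" using uniq[OF z] uniq[OF complex_root_cnj[OF z(1)]] by simp
      then show "z \<in> \<real>" by (simp add: Reals_cnj_iff)
    qed
    then show ?thesis using bij \<alpha>(2) by blast
  qed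
  have "\<delta> < 1" using \<delta>(2) by simp
  then show ?thesis using \<delta>(1) main by blast
qed

subsection \<open>Counting in a residue class\<close>

text \<open>An infinite set has cardinality 0, so a lower bound on \<open>card\<close> obtained from
  an injection needs finiteness.\<close>

lemma finite_bounded_height: "finite {f :: int poly. degree f = n \<and> poly_height f \<le> H}"
proof (rule finite_subset)
  let ?g = "\<lambda>c. \<Sum>j\<le>n. monom (c j) j :: int poly"
  show "finite (?g ` ({..n} \<rightarrow>\<^sub>E {-H..H}))" by (intro finite_imageI finite_PiE) auto
  show "{f. degree f = n \<and> poly_height f \<le> H} \<subseteq> ?g ` ({..n} \<rightarrow>\<^sub>E {-H..H})"
  proof
    fix f :: "int poly" assume "f \<in> {f. degree f = n \<and> poly_height f \<le> H}"
    then have f: "degree f = n" "poly_height f \<le> H" by auto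
    have "\<bar>coeff f j\<bar> \<le> H" if "j \<le> n" for j
    proof -
      have "\<bar>coeff f j\<bar> \<le> poly_height f" unfolding poly_height_def using that f(1) by (intro Max_ge) auto
      then show ?thesis using f(2) by simp
    qed
    then have "coeff f j \<in> {-H..H}" if "j \<in> {..n}" for j using that by (simp add: abs_le_iff minus_le_iff)
    then have "restrict (coeff f) {..n} \<in> {..n} \<rightarrow>\<^sub>E {-H..H}" by (intro restrict_PiE_iff[THEN iffD2] ballI)
    moreover have "f = ?g (restrict (coeff f) {..n})" using poly_as_sum_of_monoms[of f] f(1) by simp
    ultimately show "f \<in> ?g ` ({..n} \<rightarrow>\<^sub>E {-H..H})" by blast
  qed
qed

text \<open>The n + 1 coefficients are chosen independently, each among a number of values
  proportional to \<open>H\<close> in an interval of length \<delta> T and in its residue class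
  modulo \<open>N\<close>.\<close>

lemma count_lattice_points:
  fixes b :: "nat \<Rightarrow> real" and r :: "nat \<Rightarrow> int" and N :: int and P :: "int poly \<Rightarrow> bool"
  assumes N: "N > 0" and \<delta>: "\<delta> > 0" and bn: "b n = 1"
    and P: "\<And>T f. T > 0 \<Longrightarrow> degree f = n \<Longrightarrow> (\<And>j. j \<le> n \<Longrightarrow> \<bar>of_int (coeff f j) - T * b j\<bar> \<le> \<delta> * T) \<Longrightarrow>
       (\<And>j. j \<le> n \<Longrightarrow> [coeff f j = r j] (mod N)) \<Longrightarrow> P f"
  shows "\<exists>C::real. C > 0 \<and> (\<exists>H\<^sub>0::nat. \<forall>H\<ge>H\<^sub>0.
     C * real H ^ (n + 1) \<le> real (card {f. degree f = n \<and> poly_height f \<le> int H \<and> P f}))"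
proof -
  define B where "B = (\<Sum>j\<le>n. \<bar>b j\<bar>) + \<delta>"
  have Bj: "\<bar>b j\<bar> + \<delta> \<le> B" if "j \<le> n" for j
    unfolding B_def using that by (intro add_right_mono member_le_sum) auto
  have B0: "B > 0" unfolding B_def using \<delta> by (intro add_nonneg_pos sum_nonneg) auto
  \<comment> \<open>With T = H/B, the interval contains 2 D H steps of length \<open>N\<close>. Once
    D H is at least 1, rounding down leaves at least D H of them, which also explains the threshold
    for \<open>H\<close>.\<close>
  define D where "D = \<delta> / (2 * of_int N * B)"
  have D0: "D > 0" using \<delta> N B0 by (simp add: D_def)
  have "D ^ (n + 1) * real H ^ (n + 1) \<le> real (card {f. degree f = n \<and> poly_height f \<le> int H \<and> P f})"
    if H: "H \<ge> nat \<lceil>1 / D\<rceil>" for H :: nat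
  proof -
    have "1 / D \<le> real H" using H by linarith
    then have DH: "1 \<le> D * real H" using D0 by (simp add: field_simps)
    then have H0: "real H > 0" using D0 by (metis mult_zero_right not_one_le_zero of_nat_0_le_iff order_le_less)
    \<comment> \<open>The coefficients are then at most T (|b j| + \<delta>), hence at most T B = H,
      in absolute value.\<close>
    define T where "T = real H / B"
    have T0: "T > 0" using H0 B0 by (simp add: T_def)
    define K where "K = nat \<lfloor>\<delta> * T / of_int N\<rfloor>"
    have dT: "\<delta> * T / of_int N = 2 * (D * real H)" using B0 N by (simp add: D_def T_def field_simps)
    have K1: "real K \<le> \<delta> * T / of_int N" unfolding K_def using dT DH by simp
    have K2: "D * real H \<le> real K" unfolding K_def using dT DH by linarith
    \<comment> \<open>The least multiplier that brings the residue class up to T b j; all chosen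
      coefficients lie above this point.\<close>
    define m where "m j = \<lceil>(T * b j - of_int (r j)) / of_int N\<rceil>" for j
    define c where "c v j = r j + N * (m j + int (v j))" for v :: "nat \<Rightarrow> nat" and j
    define g where "g v = (\<Sum>j\<le>n. monom (c v j) j)" for v
    have coeff_g: "coeff (g v) j = (if j \<le> n then c v j else 0)" for v j
      unfolding g_def coeff_sum by (auto simp: coeff_monom)
    have c_bounds: "0 \<le> of_int (c v j) - T * b j" "of_int (c v j) - T * b j \<le> \<delta> * T"
      if v: "v j < K" for v j
    proof -
      let ?x = "(T * b j - of_int (r j)) / of_int N"
      have "of_int N * ?x \<le> of_int N * (of_int (m j) :: real)"
        unfolding m_def using N by (intro mult_left_mono) auto
      then have 1: "T * b j - of_int (r j) \<le> of_int N * of_int (m j)" using N by simp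
      have "of_int N * of_int (m j) \<le> of_int N * (?x + 1)"
        unfolding m_def using N by (intro mult_left_mono) (auto simp: of_int_ceiling_le_add_one)
      then have 2: "of_int N * of_int (m j) \<le> T * b j - of_int (r j) + of_int N"
        using N by (simp add: distrib_left)
      have v0: "0 \<le> of_int N * real (v j)" using N by simp
      have "of_int N * (real (v j) + 1) \<le> of_int N * real K" using N v by (intro mult_left_mono) auto
      also have "\<dots> \<le> \<delta> * T" using K1 N by (simp add: field_simps)
      finally have 3: "of_int N * real (v j) + of_int N \<le> \<delta> * T" by (simp add: distrib_left)
      have c: "of_int (c v j) = of_int (r j) + of_int N * of_int (m j) + of_int N * real (v j)"
        by (simp add: c_def algebra_simps)
      show "0 \<le> of_int (c v j) - T * b j" "of_int (c v j) - T * b j \<le> \<delta> * T"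
        unfolding c using 1 2 3 v0 by linarith+
    qed
    let ?V = "{..n} \<rightarrow>\<^sub>E {..<K}"
    let ?A = "{f. degree f = n \<and> poly_height f \<le> int H \<and> P f}"
    have gA: "g v \<in> ?A" if v: "v \<in> ?V" for v
    proof -
      have vK: "v j < K" if "j \<le> n" for j using v that by (auto simp: PiE_def Pi_def)
      have near: "\<bar>of_int (coeff (g v) j) - T * b j\<bar> \<le> \<delta> * T" if "j \<le> n" for j
        using c_bounds[of v j, OF vK[OF that]] that by (simp add: coeff_g)
      \<comment> \<open>The approximation is from above, so the leading coefficient is at least T b
        n = T and the degree is exactly \<open>n\<close>.\<close>
      have "0 < (of_int (c v n) :: real)" using c_bounds(1)[of v n] vK[of n] bn T0 by simp
      then have "coeff (g v) n \<noteq> 0" by (simp add: coeff_g)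
      then have deg: "degree (g v) = n"
        using coeff_g by (intro antisym degree_le le_degree) auto
      have "\<bar>coeff (g v) j\<bar> \<le> int H" if j: "j \<le> n" for j
      proof -
        have "\<bar>of_int (coeff (g v) j)\<bar> \<le> \<bar>T * b j\<bar> + \<delta> * T" using near[OF j] by linarith
        also have "\<dots> = T * (\<bar>b j\<bar> + \<delta>)" using T0 by (simp add: abs_mult algebra_simps)
        also have "\<dots> \<le> T * B" using T0 Bj[OF j] by (intro mult_left_mono) auto
        also have "\<dots> = real H" using B0 by (simp add: T_def)
        finally have "of_int \<bar>coeff (g v) j\<bar> \<le> (of_int (int H) :: real)" by simp
        then show ?thesis by (simp only: of_int_le_iff)
      qed
      then have "poly_height (g v) \<le> int H" unfolding poly_height_def deg by (intro Max.boundedI) auto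
      moreover have "[coeff (g v) j = r j] (mod N)" if "j \<le> n" for j
        using that by (simp add: coeff_g c_def cong_iff_dvd_diff)
      then have "P (g v)" using near by (intro P[OF T0 deg]) auto
      ultimately show ?thesis using deg by simp
    qed
    have "inj_on g ?V"
    proof (rule inj_onI)
      fix v w assume vw: "v \<in> ?V" "w \<in> ?V" "g v = g w"
      have "v j = w j" if "j \<in> {..n}" for j
      proof -
        have "coeff (g v) j = coeff (g w) j" using vw(3) by simp
        then show ?thesis using that N by (simp add: coeff_g c_def)
      qed
      then show "v = w" using vw(1,2) by (intro PiE_ext[of v "{..n}" "\<lambda>_. {..<K}" w]) auto
    qed
    then have "card ?V = card (g ` ?V)" by (simp add: card_image)
    also have "\<dots> \<le> card ?A"
      using gA finite_subset[OF _ finite_bounded_height[of n "int H"], of ?A] by (intro card_mono) auto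
    finally have "K ^ (n + 1) \<le> card ?A" by (simp add: card_funcsetE)
    then have "real K ^ (n + 1) \<le> real (card ?A)" by (metis of_nat_le_iff of_nat_power)
    moreover have "(D * real H) ^ (n + 1) \<le> real K ^ (n + 1)" using K2 DH by (intro power_mono) auto
    ultimately show ?thesis unfolding power_mult_distrib by linarith
  qed
  moreover have "D ^ (n + 1) > 0" using D0 by (rule zero_less_power)
  ultimately show ?thesis by blast
qed

subsection \<open>A residue class with symmetric Galois group\<close>

text \<open>
  Multiplying the roots of \<open>f\<close> by its leading coefficient \<open>a\<close> gives the roots of a monic polynomial, whose
  coefficients are congruent to those of \<open>f\<close> modulo every \<open>m\<close> with \<open>a \<equiv> 1\<close>.
\<close>

definition monic_transform :: "nat \<Rightarrow> int poly \<Rightarrow> int poly" where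
  "monic_transform n f = monom 1 n + (\<Sum>j<n. monom (coeff f j * coeff f n ^ (n - 1 - j)) j)"

lemma coeff_monic_transform:
  "coeff (monic_transform n f) j =
     (if j = n then 1 else if j < n then coeff f j * coeff f n ^ (n - 1 - j) else 0)"
  unfolding monic_transform_def coeff_add coeff_sum by (auto simp: coeff_monom)

text \<open>With a the leading coefficient, the transform satisfies h(a y) = a^(n-1) f(y). Comparing
  values at x = a y with the factorisation of \<open>f\<close> gives the factorisation of h.\<close>

lemma monic_int_poly_transform:
  assumes n: "n \<ge> 1" and deg: "degree f = n" and bij: "bij_betw \<alpha> {1..n} (complex_roots f)"
  shows "monic_int_poly n (\<lambda>i. of_int (lead_coeff f) * \<alpha> i) (monic_transform n f)"
proof
  let ?a = "lead_coeff f"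
  let ?c = "of_int ?a :: complex"
  let ?h = "monic_transform n f"
  have "f \<noteq> 0" using deg n by (intro notI) simp
  then have a0: "?a \<noteq> 0" by simp
  have inj: "inj_on \<alpha> {1..n}" using bij by (simp add: bij_betw_def)
  have degh: "degree ?h = n"
    using coeff_monic_transform[of n f] by (intro antisym degree_le le_degree) auto
  show "lead_coeff ?h = 1" using degh by (simp add: coeff_monic_transform)
  show "inj_on (\<lambda>i. ?c * \<alpha> i) {1..n}"
  proof (rule inj_onI)
    fix i j assume ij: "i \<in> {1..n}" "j \<in> {1..n}" "?c * \<alpha> i = ?c * \<alpha> j"
    from ij(3) a0 have "\<alpha> i = \<alpha> j" by simp
    then show "i = j" using ij(1,2) by (rule inj_onD[OF inj])
  qed
  have r: "poly (map_poly of_int f) (\<alpha> i) = 0" if "i \<in> {1..n}" for i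
    using bij_betw_apply[OF bij that] by (simp add: complex_roots_def)
  have d: "degree (map_poly of_int f :: complex poly) = n" using deg by (simp add: degree_map_poly)
  have lc: "lead_coeff (map_poly of_int f :: complex poly) = ?c" by (simp add: degree_map_poly coeff_map_poly)
  have f: "map_poly of_int f = smult ?c (\<Prod>i=1..n. [:- \<alpha> i, 1:])"
    unfolding lc[symmetric] by (rule poly_eq_smult_prod_roots[OF inj _ d]) (rule r)
  have pm: "?c ^ (n - 1) * ?c = ?c ^ n" using n by (intro power_minus_mult) simp
  show "map_poly of_int ?h = (\<Prod>i=1..n. [:- (?c * \<alpha> i), 1:])"
  proof (rule poly_eq_poly_eq_iff[THEN iffD1], rule ext)
    fix x :: complex
    define y where "y = x / ?c"
    have x: "x = ?c * y" using a0 by (simp add: y_def)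
    have "poly (map_poly of_int ?h) x = (\<Sum>j\<le>n. of_int (coeff ?h j) * x ^ j)"
      unfolding poly_altdef by (simp add: degree_map_poly degh coeff_map_poly)
    also have "\<dots> = (\<Sum>j\<le>n. ?c ^ (n - 1) * (of_int (coeff f j) * y ^ j))"
    proof (rule sum.cong[OF refl])
      fix j assume j: "j \<in> {..n}"
      have "of_int (coeff ?h j) * ?c ^ j = ?c ^ (n - 1) * of_int (coeff f j)"
      proof (cases "j = n")
        case True
        then show ?thesis using deg pm by (simp add: coeff_monic_transform)
      next
        case False
        then have "?c ^ (n - 1) = ?c ^ (n - 1 - j) * ?c ^ j" using j by (simp flip: power_add)
        then show ?thesis using False j deg by (simp add: coeff_monic_transform)
      qed
      then have "of_int (coeff ?h j) * ?c ^ j * y ^ j = ?c ^ (n - 1) * of_int (coeff f j) * y ^ j"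
        by (simp only:)
      then show "of_int (coeff ?h j) * x ^ j = ?c ^ (n - 1) * (of_int (coeff f j) * y ^ j)"
        unfolding x power_mult_distrib by (simp only: mult.assoc)
    qed
    also have "\<dots> = ?c ^ (n - 1) * poly (map_poly of_int f) y"
      unfolding poly_altdef by (simp add: degree_map_poly deg coeff_map_poly sum_distrib_left)
    also have "\<dots> = ?c ^ (n - 1) * ?c * (\<Prod>i=1..n. y - \<alpha> i)"
      by (subst f) (simp add: poly_prod)
    also have "\<dots> = ?c ^ n * (\<Prod>i=1..n. y - \<alpha> i)"
      by (simp only: pm)
    also have "\<dots> = (\<Prod>i=1..n. ?c * (y - \<alpha> i))" by (simp add: prod.distrib)
    also have "\<dots> = poly (\<Prod>i=1..n. [:- (?c * \<alpha> i), 1:]) x"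
      unfolding poly_prod x by (simp add: right_diff_distrib)
    finally show "poly (map_poly of_int ?h) x = poly (\<Prod>i=1..n. [:- (?c * \<alpha> i), 1:]) x" .
  qed
qed

text \<open>As \<open>k\<close> is monic of degree \<open>n\<close>, the congruence at index
  \<open>n\<close> makes the leading coefficient of \<open>f\<close> congruent to 1, so the monic
  transform is still congruent to \<open>k\<close>.\<close>

lemma exists_frobenius_element:
  assumes n: "n \<ge> 1" and deg: "degree f = n" and bij: "bij_betw \<alpha> {1..n} (complex_roots f)"
    and p: "prime p" and k: "degree k = n" "lead_coeff k = 1"
    and cong: "\<And>j. j \<le> n \<Longrightarrow> [coeff f j = coeff k j] (mod int p)"
  shows "\<exists>R M \<pi>. frobenius_element n (\<lambda>i. of_int (lead_coeff f) * \<alpha> i) (monic_transform n f) R M p \<pi> k"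
proof -
  interpret monic_int_poly n "\<lambda>i. of_int (lead_coeff f) * \<alpha> i" "monic_transform n f"
    by (rule monic_int_poly_transform[OF n deg bij])
  have a: "[coeff f n = 1] (mod int p)" using cong[of n] k by simp
  have red: "int p dvd coeff (monic_transform n f) j - coeff k j" for j
  proof -
    consider "j = n" | "j < n" | "j > n" by linarith
    then show ?thesis
    proof cases
      case 2
      have "[coeff f j * coeff f n ^ (n - 1 - j) = coeff k j * 1 ^ (n - 1 - j)] (mod int p)"
        using 2 by (intro cong_mult cong_pow a cong) auto
      then show ?thesis using 2 by (simp add: coeff_monic_transform cong_iff_dvd_diff)
    qed (use k in \<open>auto simp: coeff_monic_transform coeff_eq_0\<close>)
  qed
  obtain R M \<pi> where *: "prime_over R M p" "\<forall>i\<in>{1..n}. of_int (lead_coeff f) * \<alpha> i \<in> R" "\<pi> \<in> G"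
    "\<forall>i\<in>{1..n}. ideal_cong M (of_int (lead_coeff f) * \<alpha> (\<pi> i)) ((of_int (lead_coeff f) * \<alpha> i) ^ p)"
    using exists_frobenius_G[OF p] by blast
  interpret prime_over R M p by fact
  have "frobenius_element n (\<lambda>i. of_int (lead_coeff f) * \<alpha> i) (monic_transform n f) R M p \<pi> k"
    by unfold_locales (use * red in auto)
  then show ?thesis by blast
qed

text \<open>
  Modulo a suitable prime, Frobenius acts on the roots of these polynomials as an \<open>n\<close>-cycle, as an
  \<open>(n - 1)\<close>-cycle with one fixed point, and as a transposition.
\<close>

definition full_cycle_poly :: "nat \<Rightarrow> int \<Rightarrow> int poly" where
  "full_cycle_poly n g = monom 1 n - [:g:]"

definition point_stabilizer_poly :: "nat \<Rightarrow> int \<Rightarrow> int poly" where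
  "point_stabilizer_poly n g = monom 1 n - monom g 1"

definition transposition_poly :: "nat \<Rightarrow> int \<Rightarrow> int poly" where
  "transposition_poly n g = [:- g, 0, 1:] * (\<Prod>c=1..n-2. [:- int c, 1:])"

lemma monic_full_cycle_poly:
  assumes "n \<ge> 1"
  shows "degree (full_cycle_poly n g) = n" "lead_coeff (full_cycle_poly n g) = 1"
proof -
  have c: "coeff (full_cycle_poly n g) j = (if j = n then 1 else if j = 0 then - g else 0)" for j
    using assms by (auto simp: full_cycle_poly_def coeff_monom coeff_pCons split: nat.splits)
  then show "degree (full_cycle_poly n g) = n" by (intro antisym degree_le le_degree) auto
  then show "lead_coeff (full_cycle_poly n g) = 1" using c by simp
qed

lemma monic_point_stabilizer_poly:
  assumes "n \<ge> 2"
  shows "degree (point_stabilizer_poly n g) = n" "lead_coeff (point_stabilizer_poly n g) = 1"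
proof -
  have c: "coeff (point_stabilizer_poly n g) j = (if j = n then 1 else if j = 1 then - g else 0)" for j
    using assms by (auto simp: point_stabilizer_poly_def coeff_monom)
  then show "degree (point_stabilizer_poly n g) = n" using assms by (intro antisym degree_le le_degree) auto
  then show "lead_coeff (point_stabilizer_poly n g) = 1" using c by simp
qed

lemma monic_transposition_poly:
  assumes "n \<ge> 2"
  shows "degree (transposition_poly n g) = n" "lead_coeff (transposition_poly n g) = 1"
proof -
  let ?Q = "\<Prod>c=1..n-2. [:- int c, 1:]"
  have dQ: "degree ?Q = n - 2" by (subst degree_prod_eq_sum_degree) auto
  have lQ: "lead_coeff ?Q = 1" by (simp add: lead_coeff_prod)
  then have "?Q \<noteq> 0" by force
  then have "degree ([:- g, 0, 1:] * ?Q) = 2 + (n - 2)"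
    using dQ by (subst degree_mult_eq) auto
  then show "degree (transposition_poly n g) = n" using assms unfolding transposition_poly_def by simp
  show "lead_coeff (transposition_poly n g) = 1"
    unfolding transposition_poly_def lead_coeff_mult lQ by simp
qed

text \<open>The ring, the prime ideal and the Frobenius element change from prime to prime, but the
  roots and the monic polynomial do not; so all three elements lie in the same group
  \<open>G\<close>.\<close>

lemma galois_group_symmetric:
  assumes n: "n \<ge> 2" and deg: "degree f = n" and bij: "bij_betw \<alpha> {1..n} (complex_roots f)"
    and p: "prime p" "primitive_residue p n g" "\<And>j. j \<le> n \<Longrightarrow> [coeff f j = coeff (full_cycle_poly n g) j] (mod int p)"
    and q: "prime q" "primitive_residue q (n - 1) u" "\<And>j. j \<le> n \<Longrightarrow> [coeff f j = coeff (point_stabilizer_poly n u) j] (mod int q)"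
    and s: "prime s" "primitive_residue s 2 v" "s > n" "\<And>j. j \<le> n \<Longrightarrow> [coeff f j = coeff (transposition_poly n v) j] (mod int s)"
  shows "poly_galois_group f \<cong> sym_group n"
proof -
  let ?\<omega> = "\<lambda>i. of_int (lead_coeff f) * \<alpha> i"
  let ?h = "monic_transform n f"
  have n1: "n \<ge> 1" using n by simp
  interpret monic_int_poly n ?\<omega> ?h by (rule monic_int_poly_transform[OF n1 deg bij])
  obtain R M \<pi> where "frobenius_element n ?\<omega> ?h R M p \<pi> (full_cycle_poly n g)"
    using exists_frobenius_element[OF n1 deg bij p(1) monic_full_cycle_poly[OF n1] p(3)] by blast
  note trans = frobenius_element.transitive[OF this full_cycle_poly_def p(2)]
  obtain R M \<pi> where "frobenius_element n ?\<omega> ?h R M q \<pi> (point_stabilizer_poly n u)"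
    using exists_frobenius_element[OF n1 deg bij q(1) monic_point_stabilizer_poly[OF n] q(3)] by blast
  from frobenius_element.stabilizer_transitive[OF this n point_stabilizer_poly_def q(2)]
  obtain r where r: "r \<in> {1..n}"
    "\<And>i j. i \<in> {1..n} - {r} \<Longrightarrow> j \<in> {1..n} - {r} \<Longrightarrow> \<exists>\<rho>\<in>G. \<rho> r = r \<and> \<rho> i = j" by blast
  obtain R M \<pi> where "frobenius_element n ?\<omega> ?h R M s \<pi> (transposition_poly n v)"
    using exists_frobenius_element[OF n1 deg bij s(1) monic_transposition_poly[OF n] s(4)] by blast
  from frobenius_element.transposition[OF this n s(3) transposition_poly_def s(2)]
  obtain a b where ab: "a \<in> {1..n}" "b \<in> {1..n}" "a \<noteq> b" "Transposition.transpose a b \<in> G" by blast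
  have a0: "lead_coeff f \<noteq> 0" using deg n by auto
  have roots: "complex_roots f = (\<lambda>i. ?\<omega> i / of_int (lead_coeff f)) ` {1..n}"
    using bij_betw_imp_surj_on[OF bij] a0 by simp
  have "\<pi> \<in> G" if "\<pi> permutes {1..n}" for \<pi>
    by (rule permutes_generated[OF finite_atLeastAtMost id_in_G comp_in_G inv_in_G G_permutes trans r ab that])
  then show ?thesis by (rule galois_group_iso[OF a0 roots])
qed

lemma galois_group_linear:
  fixes \<alpha> :: "nat \<Rightarrow> complex"
  assumes deg: "degree f = 1" and bij: "bij_betw \<alpha> {1..1} (complex_roots f)"
  shows "poly_galois_group f \<cong> sym_group 1"
proof -
  let ?\<omega> = "\<lambda>i. of_int (lead_coeff f) * \<alpha> i"
  interpret monic_int_poly 1 ?\<omega> "monic_transform 1 f"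
    by (rule monic_int_poly_transform[OF _ deg bij]) simp
  have "f \<noteq> 0" using deg by (intro notI) simp
  then have a0: "lead_coeff f \<noteq> 0" by simp
  have roots: "complex_roots f = (\<lambda>i. ?\<omega> i / of_int (lead_coeff f)) ` {1..1}"
    using bij_betw_imp_surj_on[OF bij] a0 by simp
  have "\<pi> \<in> G" if "\<pi> permutes {1..1}" for \<pi>
    using that id_in_G by simp
  then show ?thesis by (rule galois_group_iso[OF a0 roots])
qed

lemma chinese_remainder_three:
  fixes p q s :: nat
  assumes "prime p" "prime q" "prime s" "p \<noteq> q" "p \<noteq> s" "q \<noteq> s"
  shows "\<exists>x. [x = a] (mod int p) \<and> [x = b] (mod int q) \<and> [x = c] (mod int s)"
proof -
  have 1: "coprime (int p) (int q)" "coprime (int p * int q) (int s)"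
    using assms primes_coprime[of p q] primes_coprime[of p s] primes_coprime[of q s]
    by (auto simp: coprime_int_iff)
  obtain y where y: "[y = a] (mod int p)" "[y = b] (mod int q)"
    using binary_chinese_remainder_int[OF 1(1)] by blast
  obtain x where x: "[x = y] (mod int p * int q)" "[x = c] (mod int s)"
    using binary_chinese_remainder_int[OF 1(2)] by blast
  have "[x = y] (mod int p)" "[x = y] (mod int q)"
    using x(1) cong_modulus_mult[of x y "int p" "int q"] cong_modulus_mult[of x y "int q" "int p"]
    by (simp_all add: mult.commute)
  then show ?thesis using y x(2) by (blast intro: cong_trans)
qed

lemma exists_symmetric_residue_class:
  assumes n: "n \<ge> 1"
  shows "\<exists>(N::int) r. N > 0 \<and> (\<forall>f \<alpha>. degree f = n \<longrightarrow> bij_betw \<alpha> {1..n} (complex_roots f) \<longrightarrow>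
    (\<forall>j\<le>n. [coeff f j = r j] (mod N)) \<longrightarrow> poly_galois_group f \<cong> sym_group n)"
proof (cases "n = 1")
  case True
  have "(1::int) > 0" by simp
  then show ?thesis unfolding True using galois_group_linear by blast
next
  case False
  with n have n2: "n \<ge> 2" by simp
  \<comment> \<open>The increasing bounds make the primes distinct, as the Chinese remainder theorem
    needs; the last one also exceeds \<open>n\<close>, which keeps the linear factors of the
    transposition polynomial distinct.\<close>
  obtain p where p: "prime p" "n dvd p - 1" using exists_prime_cong_1[of n 0] n by auto
  obtain q where q: "prime q" "q > p" "n - 1 dvd q - 1" using exists_prime_cong_1[of "n - 1" p] n2 by auto
  obtain s where s: "prime s" "s > q + n" "2 dvd s - 1" using exists_prime_cong_1[of 2 "q + n"] by auto
  obtain g where g: "primitive_residue p n g" using exists_primitive_residue[OF p(1) _ p(2)] n by auto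
  obtain u where u: "primitive_residue q (n - 1) u" using exists_primitive_residue[OF q(1) _ q(3)] n2 by auto
  obtain v where v: "primitive_residue s 2 v" using exists_primitive_residue[OF s(1) _ s(3)] by auto
  have "\<exists>x. [x = coeff (full_cycle_poly n g) j] (mod int p) \<and> [x = coeff (point_stabilizer_poly n u) j] (mod int q) \<and>
      [x = coeff (transposition_poly n v) j] (mod int s)" for j
    using p q s by (intro chinese_remainder_three) auto
  then obtain r where r: "\<And>j. [r j = coeff (full_cycle_poly n g) j] (mod int p)"
    "\<And>j. [r j = coeff (point_stabilizer_poly n u) j] (mod int q)"
    "\<And>j. [r j = coeff (transposition_poly n v) j] (mod int s)" by metis
  let ?N = "int p * int q * int s"
  have dvd: "int p dvd ?N" "int q dvd ?N" "int s dvd ?N" by simp_all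
  have "poly_galois_group f \<cong> sym_group n"
    if f: "degree f = n" "bij_betw \<alpha> {1..n} (complex_roots f)" "\<forall>j\<le>n. [coeff f j = r j] (mod ?N)" for f \<alpha>
  proof (rule galois_group_symmetric[OF n2 f(1,2) p(1) g _ q(1) u _ s(1) v])
    fix j assume "j \<le> n"
    then have c: "[coeff f j = r j] (mod ?N)" using f(3) by blast
    show "[coeff f j = coeff (full_cycle_poly n g) j] (mod int p)"
      using cong_dvd_modulus[OF c dvd(1)] r(1) by (rule cong_trans)
    show "[coeff f j = coeff (point_stabilizer_poly n u) j] (mod int q)"
      using cong_dvd_modulus[OF c dvd(2)] r(2) by (rule cong_trans)
    show "[coeff f j = coeff (transposition_poly n v) j] (mod int s)"
      using cong_dvd_modulus[OF c dvd(3)] r(3) by (rule cong_trans)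
  qed (use s in simp)
  moreover have "?N > 0" using p(1) q(1) s(1) by (simp add: prime_gt_0_nat)
  ultimately show ?thesis by blast
qed

section \<open>Combination of the geometric and arithmetic conditions into the count\<close>

theorem theorem1p3:
  fixes n :: nat and \<beta> :: "nat \<Rightarrow> complex" and S :: "complex set"
  assumes "n \<ge> 1"
    and "inj_on \<beta> {1..n}"
    and "S = \<beta> ` {1..n}"
    and "S = (\<lambda>i. cnj (\<beta> i)) ` {1..n}"
  shows "\<exists>\<epsilon>\<^sub>0>0. \<forall>\<epsilon>::real. 0 < \<epsilon> \<and> \<epsilon> < \<epsilon>\<^sub>0 \<longrightarrow>
    (\<exists>C::real. C > 0 \<and> (\<exists>H\<^sub>0::nat. \<forall>H\<ge>H\<^sub>0.
      C * real H ^ (n + 1) \<le> real (card {f :: int poly.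
        Polynomial.degree f = n \<and> poly_height f \<le> int H \<and>
        poly_galois_group f \<cong> sym_group n \<and>
        (\<exists>\<alpha>. bij_betw \<alpha> {1..n} (complex_roots f) \<and> (\<forall>i\<in>{1..n}. \<alpha> i \<in> ball (\<beta> i) \<epsilon>)) \<and>
        (\<forall>i\<in>{1..n}. \<forall>z \<in> complex_roots f \<inter> ball (\<beta> i) \<epsilon>. z \<in> \<real> \<longleftrightarrow> \<beta> i \<in> \<real>)})))"
proof -
  define F where "F = (\<Prod>i=1..n. [:- \<beta> i, 1:])"
  define b where "b j = Re (coeff F j)" for j
  have b: "coeff (\<Prod>i=1..n. [:- \<beta> i, 1:]) j = of_real (b j)" for j
    unfolding b_def F_def using coeff_conj_invariant_prod[OF assms(2)] assms(3,4) by simp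
  have "degree F = n" unfolding F_def by (subst degree_prod_eq_sum_degree) auto
  moreover have "lead_coeff F = 1" unfolding F_def by (simp add: lead_coeff_prod)
  ultimately have bn: "b n = 1" by (simp add: b_def)
  \<comment> \<open>Staying below half of all distances makes the discs disjoint; staying below the
    imaginary parts of the nonreal points keeps their discs off the real axis.\<close>
  define A where "A = (\<lambda>(i, j). dist (\<beta> i) (\<beta> j) / 2) ` {(i, j). i \<in> {1..n} \<and> j \<in> {1..n} \<and> i \<noteq> j} \<union>
    (\<lambda>i. \<bar>Im (\<beta> i)\<bar>) ` {i \<in> {1..n}. \<beta> i \<notin> \<real>}"
  have "finite {(i, j). i \<in> {1..n} \<and> j \<in> {1..n} \<and> i \<noteq> j}"
    by (rule finite_subset[of _ "{1..n} \<times> {1..n}"]) auto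
  then have "finite A" unfolding A_def by auto
  moreover have "x > 0" if "x \<in> A" for x
    using that unfolding A_def by (auto simp: complex_is_Real_iff inj_on_eq_iff[OF assms(2)])
  ultimately obtain e where e: "e > 0" "\<forall>x\<in>A. e \<le> x" using exists_pos_lower_bound by blast
  obtain N r where N: "N > 0" and Nr: "\<And>f \<alpha>. degree f = n \<Longrightarrow> bij_betw \<alpha> {1..n} (complex_roots f) \<Longrightarrow>
    (\<And>j. j \<le> n \<Longrightarrow> [coeff f j = r j] (mod N)) \<Longrightarrow> poly_galois_group f \<cong> sym_group n"
    using exists_symmetric_residue_class[OF assms(1)] by blast
  show ?thesis
  proof (rule exI[of _ e], intro conjI e(1) allI impI, elim conjE)
    fix \<epsilon> :: real assume \<epsilon>: "0 < \<epsilon>" "\<epsilon> < e"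
    have sep: "2 * \<epsilon> < dist (\<beta> i) (\<beta> j)" if "i \<in> {1..n}" "j \<in> {1..n}" "i \<noteq> j" for i j
    proof -
      have "dist (\<beta> i) (\<beta> j) / 2 \<in> A" unfolding A_def using that by (intro UnI1 image_eqI[of _ _ "(i, j)"]) auto
      then show ?thesis using e(2) \<epsilon>(2) by fastforce
    qed
    have im: "\<epsilon> < \<bar>Im (\<beta> i)\<bar>" if "i \<in> {1..n}" "\<beta> i \<notin> \<real>" for i
    proof -
      have "\<bar>Im (\<beta> i)\<bar> \<in> A" unfolding A_def using that by (intro UnI2 imageI) auto
      then show ?thesis using e(2) \<epsilon>(2) by fastforce
    qed
    obtain \<delta> where \<delta>: "\<delta> > 0" and near: "\<And>T f. T > 0 \<Longrightarrow> degree f = n \<Longrightarrow>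
        (\<And>j. j \<le> n \<Longrightarrow> \<bar>of_int (coeff f j) - T * b j\<bar> \<le> \<delta> * T) \<Longrightarrow>
        (\<exists>\<alpha>. bij_betw \<alpha> {1..n} (complex_roots f) \<and> (\<forall>i\<in>{1..n}. \<alpha> i \<in> ball (\<beta> i) \<epsilon>)) \<and>
        (\<forall>i\<in>{1..n}. \<forall>z\<in>complex_roots f \<inter> ball (\<beta> i) \<epsilon>. z \<in> \<real> \<longleftrightarrow> \<beta> i \<in> \<real>)"
      using roots_near[OF assms(1) \<epsilon>(1) sep im b] by blast
    show "\<exists>C::real. C > 0 \<and> (\<exists>H\<^sub>0::nat. \<forall>H\<ge>H\<^sub>0.
      C * real H ^ (n + 1) \<le> real (card {f :: int poly.
        Polynomial.degree f = n \<and> poly_height f \<le> int H \<and>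
        poly_galois_group f \<cong> sym_group n \<and>
        (\<exists>\<alpha>. bij_betw \<alpha> {1..n} (complex_roots f) \<and> (\<forall>i\<in>{1..n}. \<alpha> i \<in> ball (\<beta> i) \<epsilon>)) \<and>
        (\<forall>i\<in>{1..n}. \<forall>z \<in> complex_roots f \<inter> ball (\<beta> i) \<epsilon>. z \<in> \<real> \<longleftrightarrow> \<beta> i \<in> \<real>)}))"
    proof (rule count_lattice_points[OF N \<delta>, where b = b and r = r])
      show "b n = 1" by (rule bn)
      fix T :: real and f :: "int poly"
      assume f: "T > 0" "degree f = n" "\<And>j. j \<le> n \<Longrightarrow> \<bar>of_int (coeff f j) - T * b j\<bar> \<le> \<delta> * T"
        "\<And>j. j \<le> n \<Longrightarrow> [coeff f j = r j] (mod N)"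
      from near[OF f(1-3)] obtain \<alpha> where "bij_betw \<alpha> {1..n} (complex_roots f)" by blast
      from Nr[OF f(2) this f(4)] near[OF f(1-3)]
      show "poly_galois_group f \<cong> sym_group n \<and>
        (\<exists>\<alpha>. bij_betw \<alpha> {1..n} (complex_roots f) \<and> (\<forall>i\<in>{1..n}. \<alpha> i \<in> ball (\<beta> i) \<epsilon>)) \<and>
        (\<forall>i\<in>{1..n}. \<forall>z \<in> complex_roots f \<inter> ball (\<beta> i) \<epsilon>. z \<in> \<real> \<longleftrightarrow> \<beta> i \<in> \<real>)"
        by blast
    qed
  qed
qed

end
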